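(* Let $f:\{0,1\}^n\to\{0,1\}^n$ be a one-way function, and let $G=G^f$ be the efficient block-generator on seeds $x\in\{0,1\}^n$ (with no public parameter) whose first $m$ output blocks are the consecutive $\log n$-bit pieces of $f(x)$ and whose last block is $x$: $$G^f(x)=\big(f(x)_{1,\dots,\log n},\ f(x)_{\log n+1,\dots,2\log n},\ \dots,\ f(x)_{n-\log n+1,\dots,n},\ x\big).$$ Then $G^f$ has accessible entropy at most $n-\omega(\log n)$; that is, for every constant $c>0$, $G^f$ has accessible entropy at most $n-c\log n$.
   Context: All logarithms are base 2; $n$ is the security parameter; $U_n$ is uniform on $\{0,1\}^n$; a function is negligible ($\mathrm{neg}(n)$) if it is eventually smaller than $1/p(n)$ for every positive polynomial $p$; PPT means probabilistic polynomial time (uniform). Rounding convention: $\log n$ is treated as an integer dividing $n$; in general, use block length $\lambda=\lceil\log n\rceil$, $m=\lceil n/\lambda\rceil$, and pad $f(x)$ with zeros to length $m\lambda$. So $G^f$ has $m+1$ blocks, with $m=n/\log n$. One-way function: a polynomial-time computable $f:\{0,1\}^n\to\{0,1\}^n$ (defined for every $n$) such that for every PPT $A$, $\Pr_{y\leftarrow f(U_n)}[A(1^n,y)\in f^{-1}(y)]=\mathrm{neg}(n)$. Block-generator (no public parameter): with $s=s(n)$ and $M=M(n)$, an $M$-block generator is a function $G:\{0,1\}^{s}\to(\{0,1\}^* )^{M}$; it is efficient if computable in time polynomial in $n$. Online block-generator: an $M$-block online generator is a function $\tilde G:(\{0,1\}^{v})^{M}\to(\{0,1\}^* )^{M}$,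 for some $v=v(n)$, whose $i$-th output block depends only on its first $i$ input blocks. Its transcript is $T_{\tilde G}(1^n)=(R_1,Y_1,\dots,R_M,Y_M)$, where $(R_1,\dots,R_M)$ is uniform on $(\{0,1\}^v)^M$ and $(Y_1,\dots,Y_M)=\tilde G(R_1,\dots,R_M)$. The accessible sample-entropy of a transcript value $t=(r_1,y_1,\dots,r_M,y_M)$ is $\mathrm{AccH}_{\tilde G}(t)=\sum_{i=1}^M\log\frac{1}{\Pr[Y_i=y_i\mid R_{<i}=r_{<i}]}$, where $R_{<i}=(R_1,\dots,R_{i-1})$. $\tilde G$ is $G$-consistent if, for every $n$, the support of the output of $\tilde G$ on uniform input is contained in the support of $G(U_{s(n)})$. $G$ has accessible entropy at most $k=k(n)$ if for every efficient (polynomial-time computable) $G$-consistent online generator $\tilde G$ and all large enough $n$, $\mathbb E_{t\leftarrow T_{\tilde G}(1^n)}[\mathrm{AccH}_{\tilde G}(t)]\le k(n)$. *)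

theory Defs
  imports
    "HOL-Probability.Probability"
    "HOL-Computational_Algebra.Polynomial"
begin

section \<open>Computation in polynomial time\<close>

text \<open>
  The machine model is that of multi-stack machines over a three-letter alphabet, programmed in a
  structured way. Every instruction pushes one symbol, pops one symbol or inspects one top symbol,
  and takes one time step. A fixed program mentions finitely many stacks only, so up to a polynomial
  change of the running time this is the multi-tape Turing machine model (a tape is a pair of
  stacks).
\<close>

datatype symbol = Bit bool | Sep

type_synonym store = "nat \<Rightarrow> symbol list"

definition top_symbol :: "symbol list \<Rightarrow> symbol option" where
  "top_symbol w = (case w of [] \<Rightarrow> None | a # _ \<Rightarrow> Some a)"

text \<open>The set in a branch or loop instruction is a condition on the top symbol of the given stack,
  with \<^term>\<open>None\<close> standing for an empty stack.\<close>

datatype program =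
    Skip
  | Push nat symbol
  | Pop nat
  | Seq program program
  | Branch nat "symbol option set" program program
  | Loop nat "symbol option set" program

text \<open>\<open>exec c s t s'\<close>: started in \<open>s\<close>, program \<open>c\<close> halts in \<open>s'\<close> after exactly \<open>t\<close> steps.\<close>

inductive exec :: "program \<Rightarrow> store \<Rightarrow> nat \<Rightarrow> store \<Rightarrow> bool" where
  Skip: "exec Skip s 1 s"
| Push: "exec (Push i a) s 1 (s(i := a # s i))"
| Pop: "exec (Pop i) s 1 (s(i := tl (s i)))"
| Seq: "exec c1 s t1 s' \<Longrightarrow> exec c2 s' t2 s'' \<Longrightarrow> exec (Seq c1 c2) s (t1 + t2) s''"
| BranchT: "top_symbol (s i) \<in> A \<Longrightarrow> exec c1 s t s' \<Longrightarrow> exec (Branch i A c1 c2) s (Suc t) s'"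
| BranchF: "top_symbol (s i) \<notin> A \<Longrightarrow> exec c2 s t s' \<Longrightarrow> exec (Branch i A c1 c2) s (Suc t) s'"
| LoopF: "top_symbol (s i) \<notin> A \<Longrightarrow> exec (Loop i A c) s 1 s"
| LoopT: "top_symbol (s i) \<in> A \<Longrightarrow> exec c s t1 s' \<Longrightarrow> exec (Loop i A c) s' t2 s''
    \<Longrightarrow> exec (Loop i A c) s (Suc (t1 + t2)) s''"

inductive_cases exec_SkipE: "exec Skip s t s'"
inductive_cases exec_PushE: "exec (Push i a) s t s'"
inductive_cases exec_PopE: "exec (Pop i) s t s'"
inductive_cases exec_SeqE: "exec (Seq c1 c2) s t s'"
inductive_cases exec_BranchE: "exec (Branch i A c1 c2) s t s'"
inductive_cases exec_LoopE: "exec (Loop i A c) s t s'"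

lemma exec_deterministic:
  "exec c s t s' \<Longrightarrow> exec c s u s'' \<Longrightarrow> u = t \<and> s'' = s'"
proof (induction arbitrary: u s'' rule: exec.induct)
  case (Skip s)
  then show ?case by (auto elim: exec_SkipE)
next
  case (Push i a s)
  then show ?case by (auto elim: exec_PushE)
next
  case (Pop i s)
  then show ?case by (auto elim: exec_PopE)
next
  case (Seq c1 s t1 s' c2 t2 s2)
  from Seq.prems show ?case by (rule exec_SeqE) (use Seq.IH in blast)
next
  case (BranchT s i A c1 t s' c2)
  from BranchT.prems show ?case by (rule exec_BranchE) (use BranchT in blast)+
next
  case (BranchF s i A c2 t s' c1)
  from BranchF.prems show ?case by (rule exec_BranchE) (use BranchF in blast)+
next
  case (LoopF s i A c)
  from LoopF.prems show ?case by (rule exec_LoopE) (use LoopF in auto)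
next
  case (LoopT s i A c t1 s' t2 s2)
  from LoopT.prems show ?case by (rule exec_LoopE) (use LoopT in blast)+
qed

text \<open>A list of bit strings is written on a stack with a separator after each string; the head of
  the list of symbols is the top of the stack. Input is on stack 0, output on stack 1.\<close>

definition encode :: "bool list list \<Rightarrow> symbol list" where
  "encode ws = concat (map (\<lambda>w. map Bit w @ [Sep]) ws)"

definition input_store :: "bool list list \<Rightarrow> store" where
  "input_store ws = (\<lambda>_. [])(0 := encode ws)"

text \<open>\<open>D n\<close> is the set of inputs for security parameter \<open>n\<close>. The program receives \<open>1\<^sup>n\<close> followed by
  the input, and its running time is measured in \<open>n\<close>.\<close>

definition poly_time ::
  "(nat \<Rightarrow> bool list list set) \<Rightarrow> (nat \<Rightarrow> bool list list \<Rightarrow> bool list list) \<Rightarrow> bool" where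
  "poly_time D F \<longleftrightarrow>
     (\<exists>c (p :: nat poly). \<forall>n. \<forall>ws \<in> D n. \<exists>t s.
        exec c (input_store (replicate n True # ws)) t s \<and> t \<le> poly p n \<and> s 1 = encode (F n ws))"

definition bitstrings :: "nat \<Rightarrow> bool list set" where
  "bitstrings n = {x. length x = n}"

definition uniform :: "nat \<Rightarrow> bool list pmf" where
  "uniform n = pmf_of_set (bitstrings n)"

text \<open>A randomised algorithm \<open>A\<close> with input \<open>(1\<^sup>n, y)\<close>, \<open>y\<close> of length \<open>n\<close>, is PPT if it is computed
  in polynomial time by one program that receives polynomially many uniform coins as an additional
  input.\<close>

definition ppt :: "(nat \<Rightarrow> bool list \<Rightarrow> bool list pmf) \<Rightarrow> bool" where
  "ppt A \<longleftrightarrow>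
     (\<exists>(q :: nat poly) (g :: nat \<Rightarrow> bool list list \<Rightarrow> bool list).
        poly_time (\<lambda>n. {[y, r] | y r. y \<in> bitstrings n \<and> r \<in> bitstrings (poly q n)})
                  (\<lambda>n ws. [g n ws]) \<and>
        (\<forall>n. \<forall>y \<in> bitstrings n. A n y = map_pmf (\<lambda>r. g n [y, r]) (uniform (poly q n))))"


section \<open>One-way functions\<close>

definition negligible :: "(nat \<Rightarrow> real) \<Rightarrow> bool" where
  "negligible \<mu> \<longleftrightarrow>
     (\<forall>p :: real poly. (\<forall>n > 0. poly p (real n) > 0) \<longrightarrow>
        (\<forall>\<^sub>F n in sequentially. \<mu> n < 1 / poly p (real n)))"

definition inversion_prob ::
  "(bool list \<Rightarrow> bool list) \<Rightarrow> (nat \<Rightarrow> bool list \<Rightarrow> bool list pmf) \<Rightarrow> nat \<Rightarrow> real" where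
  "inversion_prob f A n =
     measure_pmf.prob
       (do { y \<leftarrow> map_pmf f (uniform n); x' \<leftarrow> A n y; return_pmf (y, x') })
       {(y, x'). x' \<in> bitstrings n \<and> f x' = y}"

definition one_way :: "(bool list \<Rightarrow> bool list) \<Rightarrow> bool" where
  "one_way f \<longleftrightarrow>
     (\<forall>n. \<forall>x \<in> bitstrings n. f x \<in> bitstrings n) \<and>
     poly_time (\<lambda>n. {[x] | x. x \<in> bitstrings n}) (\<lambda>n ws. [f (hd ws)]) \<and>
     (\<forall>A. ppt A \<longrightarrow> negligible (inversion_prob f A))"


section \<open>Block-generators and accessible entropy\<close>

text \<open>Tuples of blocks are lists, indexed from 0; \<open>n\<close> is always the security parameter.\<close>

definition block_generator ::
  "(nat \<Rightarrow> nat) \<Rightarrow> (nat \<Rightarrow> nat) \<Rightarrow> (nat \<Rightarrow> bool list \<Rightarrow> bool list list) \<Rightarrow> bool" where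
  "block_generator s M G \<longleftrightarrow> (\<forall>n. \<forall>x \<in> bitstrings (s n). length (G n x) = M n)"

definition tuples :: "nat \<Rightarrow> nat \<Rightarrow> bool list list set" where
  "tuples v M = {rs. length rs = M \<and> set rs \<subseteq> bitstrings v}"

definition online_generator ::
  "(nat \<Rightarrow> nat) \<Rightarrow> (nat \<Rightarrow> nat) \<Rightarrow> (nat \<Rightarrow> bool list list \<Rightarrow> bool list list) \<Rightarrow> bool" where
  "online_generator v M H \<longleftrightarrow>
     (\<forall>n. (\<forall>rs \<in> tuples (v n) (M n). length (H n rs) = M n) \<and>
       (\<forall>i < M n. \<forall>rs \<in> tuples (v n) (M n). \<forall>rs' \<in> tuples (v n) (M n).
          take (Suc i) rs = take (Suc i) rs' \<longrightarrow> H n rs ! i = H n rs' ! i))"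

text \<open>The transcript \<open>(R\<^sub>1, Y\<^sub>1, \<dots>, R\<^sub>M, Y\<^sub>M)\<close> is stored as the pair of the lists of the \<open>R\<^sub>i\<close> and of the
  \<open>Y\<^sub>i\<close>.\<close>

definition transcript ::
  "(nat \<Rightarrow> nat) \<Rightarrow> (nat \<Rightarrow> nat) \<Rightarrow> (nat \<Rightarrow> bool list list \<Rightarrow> bool list list) \<Rightarrow> nat
     \<Rightarrow> (bool list list \<times> bool list list) pmf" where
  "transcript v M H n = map_pmf (\<lambda>rs. (rs, H n rs)) (pmf_of_set (tuples (v n) (M n)))"

definition AccH ::
  "(nat \<Rightarrow> nat) \<Rightarrow> (nat \<Rightarrow> nat) \<Rightarrow> (nat \<Rightarrow> bool list list \<Rightarrow> bool list list) \<Rightarrow> nat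
     \<Rightarrow> bool list list \<times> bool list list \<Rightarrow> real" where
  "AccH v M H n = (\<lambda>(r, y). \<Sum>i<M n.
     log 2 (1 / \<P>((R, Y) in measure_pmf (transcript v M H n). Y ! i = y ! i \<bar> take i R = take i r)))"

definition consistent ::
  "(nat \<Rightarrow> nat) \<Rightarrow> (nat \<Rightarrow> nat) \<Rightarrow> (nat \<Rightarrow> bool list \<Rightarrow> bool list list)
     \<Rightarrow> (nat \<Rightarrow> nat) \<Rightarrow> (nat \<Rightarrow> bool list list \<Rightarrow> bool list list) \<Rightarrow> bool" where
  "consistent s M G v H \<longleftrightarrow>
     (\<forall>n. set_pmf (map_pmf (H n) (pmf_of_set (tuples (v n) (M n))))
          \<subseteq> set_pmf (map_pmf (G n) (uniform (s n))))"

text \<open>The block length \<open>v\<close> of the online generator is not restricted, in particular it need not be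
  computable. Only the running time is bounded.\<close>

definition accessible_entropy_at_most ::
  "(nat \<Rightarrow> nat) \<Rightarrow> (nat \<Rightarrow> nat) \<Rightarrow> (nat \<Rightarrow> bool list \<Rightarrow> bool list list) \<Rightarrow> (nat \<Rightarrow> real) \<Rightarrow> bool"
  where
  "accessible_entropy_at_most s M G k \<longleftrightarrow>
     (\<forall>v H. online_generator v M H \<and> poly_time (\<lambda>n. tuples (v n) (M n)) H \<and> consistent s M G v H \<longrightarrow>
        (\<forall>\<^sub>F n in sequentially.
           measure_pmf.expectation (transcript v M H n) (AccH v M H n) \<le> k n))"


section \<open>The generator of a one-way function\<close>

text \<open>For \<open>n \<ge> 2\<close> this is \<open>\<lceil>log n\<rceil>\<close>; the maximum only avoids blocks of length 0 for \<open>n \<le> 1\<close>.\<close>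

definition block_length :: "nat \<Rightarrow> nat" where
  "block_length n = max 1 (nat \<lceil>log 2 (real n)\<rceil>)"

definition num_pieces :: "nat \<Rightarrow> nat" where
  "num_pieces n = nat \<lceil>real n / real (block_length n)\<rceil>"

definition pad :: "nat \<Rightarrow> bool list \<Rightarrow> bool list" where
  "pad l w = w @ replicate (l - length w) False"

definition Gf :: "(bool list \<Rightarrow> bool list) \<Rightarrow> nat \<Rightarrow> bool list \<Rightarrow> bool list list" where
  "Gf f n x =
     (let l = block_length n; m = num_pieces n; w = pad (m * l) (f x)
      in map (\<lambda>j. take l (drop (j * l) w)) [0..<m] @ [x])"

lemma block_generator_Gf: "block_generator (\<lambda>n. n) (\<lambda>n. num_pieces n + 1) (Gf f)"
  by (simp add: block_generator_def Gf_def Let_def)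

lemma le_num_pieces_times_block_length: "n \<le> num_pieces n * block_length n"
proof -
  have l: "real (block_length n) > 0"
    by (simp add: block_length_def)
  have "real n / real (block_length n) \<le> real (num_pieces n)"
    unfolding num_pieces_def by (rule real_nat_ceiling_ge)
  then have "real n \<le> real (num_pieces n * block_length n)"
    using l by (simp add: pos_divide_le_eq)
  then show ?thesis
    by (simp only: of_nat_le_iff)
qed

end

theory Submission
  imports Defs "HOL-Real_Asymp.Real_Asymp"
begin

text \<open>
  Suppose a consistent online generator has accessible entropy above \<open>n - c log n\<close> infinitely often.
  To invert \<open>y\<close>, choose its input blocks one after the other, resampling the current block until the
  output block agrees with \<open>y\<close>; a budget of \<open>m K\<close> samples with \<open>K = n\<^sup>2\<close> suffices. Once all \<open>m\<close> pieces of
  \<open>y\<close> are matched, consistency makes the last output block a preimage. Let \<open>p\<^sub>i\<close> be the conditional probability of the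
  \<open>i\<close>-th output block in a random transcript. Averaged over \<open>y = f(U\<^sub>n)\<close>, the inverter succeeds with
  probability at least
  \<open>E[Pr[f(U\<^sub>n) = y] * \<Prod>\<^sub>i (1 - (1 - p\<^sub>i)\<^sup>K) / p\<^sub>i]\<close> over transcripts of the generator. By Jensen its
  logarithm is at least \<open>E[log |f\<^sup>-\<^sup>1(y)|] - n + E[\<Sum>\<^sub>i log (1 / p\<^sub>i)] - O(1)\<close>: the loss against an
  unlimited number of tries is controlled by \<open>E[1 / p\<^sub>i] \<le> 2 n\<close>, the number of values of a block. As the
  last block lies in \<open>f\<^sup>-\<^sup>1(y)\<close>, it contributes at most \<open>E[log |f\<^sup>-\<^sup>1(y)|]\<close> to the accessible entropy, so
  the success probability is at least a constant times \<open>n\<^sup>-\<^sup>c\<close>.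

  The input block length \<open>v(n)\<close> need not be computable, so the inverter guesses it from its coins,
  together with \<open>m\<close>. Wrong guesses may run the generator outside its domain, where it need not halt;
  therefore the whole inverter runs against a clock. If \<open>v(n)\<close> exceeds the running time of the
  generator, only the first input block is read and the accessible entropy is at most \<open>\<lceil>log n\<rceil>\<close>.
\<close>

section \<open>Programs and running times\<close>

text \<open>Accessible entropy is a mean of logarithms and the success of the search is a mean of
  products, so concavity of the logarithm links the two without a concentration argument and without
  discarding unlikely transcripts. A finite budget costs only \<open>1 / (K p ln 2)\<close> in each
  logarithm. This is linear in \<open>1 / p\<close>, whose mean is exactly a number of block values.
  Blocks of logarithmic length keep that number linear in \<open>n\<close>, and with at most
  \<open>n\<close> pieces and \<open>K = n\<^sup>2\<close> the whole loss is at most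
  \<open>2 / ln 2 < 3\<close> bits. Guessing \<open>v\<close> and \<open>m\<close> is affordable
  because in the relevant case \<open>v\<close> is at most the running time, so that the code of the
  guess is hit with inverse polynomial probability. Coins serve twice: as randomness and, by their
  number, as the clock. For this reason far more of them are requested than the search ever
  reads.\<close>

declare One_nat_def [simp del]

text \<open>Upper bounds suffice for \<open>poly_time\<close>. Unlike exact step counts, they add up
  under sequencing and absorb case distinctions.\<close>

definition runs :: "program \<Rightarrow> store \<Rightarrow> nat \<Rightarrow> store \<Rightarrow> bool" where
  "runs c s T s' \<longleftrightarrow> (\<exists>t \<le> T. exec c s t s')"

lemma runs_mono: "runs c s T s' \<Longrightarrow> T \<le> T' \<Longrightarrow> runs c s T' s'"
  unfolding runs_def by (meson order_trans)

lemma runs_Skip: "runs Skip s 1 s"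
  unfolding runs_def by (meson exec.Skip order_refl)

lemma runs_Push: "runs (Push i a) s 1 (s(i := a # s i))"
  unfolding runs_def by (meson exec.Push order_refl)

lemma runs_Pop: "runs (Pop i) s 1 (s(i := tl (s i)))"
  unfolding runs_def by (meson exec.Pop order_refl)

lemma runs_Seq: "runs c1 s T1 s' \<Longrightarrow> runs c2 s' T2 s'' \<Longrightarrow> runs (Seq c1 c2) s (T1 + T2) s''"
  unfolding runs_def by (meson exec.Seq add_mono)

lemma runs_BranchT: "top_symbol (s i) \<in> A \<Longrightarrow> runs c1 s T s' \<Longrightarrow> runs (Branch i A c1 c2) s (Suc T) s'"
  unfolding runs_def by (meson exec.BranchT Suc_le_mono)

lemma runs_BranchF: "top_symbol (s i) \<notin> A \<Longrightarrow> runs c2 s T s' \<Longrightarrow> runs (Branch i A c1 c2) s (Suc T) s'"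
  unfolding runs_def by (meson exec.BranchF Suc_le_mono)

lemma runs_LoopF: "top_symbol (s i) \<notin> A \<Longrightarrow> runs (Loop i A c) s 1 s"
  unfolding runs_def by (meson exec.LoopF order_refl)

lemma runs_LoopT:
  "top_symbol (s i) \<in> A \<Longrightarrow> runs c s T1 s' \<Longrightarrow> runs (Loop i A c) s' T2 s''
    \<Longrightarrow> runs (Loop i A c) s (Suc (T1 + T2)) s''"
  unfolding runs_def by (meson exec.LoopT Suc_le_mono add_mono)

lemma top_symbol_simps [simp]: "top_symbol [] = None" "top_symbol (a # w) = Some a"
  by (simp_all add: top_symbol_def)

lemma top_symbol_eq_None [simp]: "top_symbol w = None \<longleftrightarrow> w = []"
  by (cases w) simp_all

lemma encode_Nil [simp]: "encode [] = []"
  and encode_Cons [simp]: "encode (w # ws) = map Bit w @ Sep # encode ws"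
  and encode_append [simp]: "encode (ws @ ws') = encode ws @ encode ws'"
  by (simp_all add: encode_def)

subsection \<open>Store size and dependence on the input\<close>

text \<open>A step adds at most one symbol, so the running time also bounds the output and the
  debris left on every stack.\<close>

lemma exec_length: "exec c s t s' \<Longrightarrow> length (s' i) \<le> length (s i) + t"
proof (induction arbitrary: i rule: exec.induct)
  case (Seq c1 s t1 s' c2 t2 s'')
  show ?case using Seq.IH(1)[of i] Seq.IH(2)[of i] by simp
next
  case (BranchT s i' A c1 t s' c2)
  show ?case using BranchT.IH[of i] by simp
next
  case (BranchF s i' A c2 t s' c1)
  show ?case using BranchF.IH[of i] by simp
next
  case (LoopT s i' A c t1 s' t2 s'')
  show ?case using LoopT.IH(1)[of i] LoopT.IH(2)[of i] by simp
qed (auto simp: One_nat_def)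

text \<open>A step removes at most one symbol from the input stack, so \<open>t\<close> steps cannot
  notice what lies below the top \<open>t\<close> symbols. The induction keeps the part above the
  exchanged bottom at least as long as the time that remains.\<close>

lemma exec_input_prefix:
  assumes "exec c s t s'" "s 0 = u @ w" "t \<le> length u"
  shows "\<exists>u'. s' 0 = u' @ w \<and> length u \<le> length u' + t \<and> exec c (s(0 := u @ w')) t (s'(0 := u' @ w'))"
  using assms
proof (induction arbitrary: u rule: exec.induct)
  case (Skip s)
  then show ?case by (auto intro: exec.Skip)
next
  case (Push i a s)
  show ?case
  proof (cases "i = 0")
    case True
    have "exec (Push i a) (s(0 := u @ w')) 1 (s(i := a # s i, 0 := (a # u) @ w'))"
      using exec.Push[of 0 a "s(0 := u @ w')"] True by (simp del: fun_upd_apply add: fun_upd_same)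
    moreover have "(s(i := a # s i)) 0 = (a # u) @ w" "length u \<le> length (a # u) + 1"
      using Push.prems True by simp_all
    ultimately show ?thesis by blast
  next
    case False
    then have "exec (Push i a) (s(0 := u @ w')) 1 (s(i := a # s i, 0 := u @ w'))"
      using exec.Push[of i a "s(0 := u @ w')"]
      by (simp del: fun_upd_apply add: fun_upd_other fun_upd_twist[of 0 i])
    moreover have "(s(i := a # s i)) 0 = u @ w" "length u \<le> length u + 1"
      using Push.prems False by simp_all
    ultimately show ?thesis by blast
  qed
next
  case (Pop i s)
  show ?case
  proof (cases "i = 0")
    case True
    then obtain b u1 where u: "u = b # u1" using Pop by (cases u) auto
    have "exec (Pop i) (s(0 := u @ w')) 1 (s(i := tl (s i), 0 := u1 @ w'))"
      using exec.Pop[of 0 "s(0 := u @ w')"] True u by (simp del: fun_upd_apply add: fun_upd_same)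
    moreover have "(s(i := tl (s i))) 0 = u1 @ w" "length u \<le> length u1 + 1"
      using Pop.prems True u by simp_all
    ultimately show ?thesis by blast
  next
    case False
    then have "exec (Pop i) (s(0 := u @ w')) 1 (s(i := tl (s i), 0 := u @ w'))"
      using exec.Pop[of i "s(0 := u @ w')"]
      by (simp del: fun_upd_apply add: fun_upd_other fun_upd_twist[of 0 i])
    moreover have "(s(i := tl (s i))) 0 = u @ w" "length u \<le> length u + 1"
      using Pop.prems False by simp_all
    ultimately show ?thesis by blast
  qed
next
  case (Seq c1 s t1 s' c2 t2 s'')
  then obtain u1 where u1: "s' 0 = u1 @ w" "length u \<le> length u1 + t1"
    "exec c1 (s(0 := u @ w')) t1 (s'(0 := u1 @ w'))"
    by (metis add_leD1)
  have le: "t2 \<le> length u1" using u1(2) Seq.prems by simp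
  obtain u2 where u2: "s'' 0 = u2 @ w" "length u1 \<le> length u2 + t2"
    "exec c2 (s'(0 := u1 @ w')) t2 (s''(0 := u2 @ w'))"
    using Seq.IH(2)[OF u1(1) le] by blast
  have "length u \<le> length u2 + (t1 + t2)" using u1(2) u2(2) by simp
  then show ?case using u2(1) exec.Seq[OF u1(3) u2(3)] by blast
next
  case (BranchT s i A c1 t s' c2)
  \<comment> \<open>The test takes a step of its own, so \<open>u\<close> is nonempty and the
    inspected symbol does not belong to the exchanged bottom.\<close>
  have "top_symbol ((s(0 := u @ w')) i) \<in> A"
    using BranchT.hyps(1) BranchT.prems by (cases u) (auto split: if_splits)
  moreover obtain u1 where "s' 0 = u1 @ w" "length u \<le> length u1 + t"
    "exec c1 (s(0 := u @ w')) t (s'(0 := u1 @ w'))"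
    using BranchT by (metis Suc_leD)
  moreover from this have "length u \<le> length u1 + Suc t" by simp
  ultimately show ?case using exec.BranchT by blast
next
  case (BranchF s i A c2 t s' c1)
  have "top_symbol ((s(0 := u @ w')) i) \<notin> A"
    using BranchF.hyps(1) BranchF.prems by (cases u) (auto split: if_splits)
  moreover obtain u1 where "s' 0 = u1 @ w" "length u \<le> length u1 + t"
    "exec c2 (s(0 := u @ w')) t (s'(0 := u1 @ w'))"
    using BranchF by (metis Suc_leD)
  moreover from this have "length u \<le> length u1 + Suc t" by simp
  ultimately show ?case using exec.BranchF by blast
next
  case (LoopF s i A c)
  have "top_symbol ((s(0 := u @ w')) i) \<notin> A"
    using LoopF.hyps(1) LoopF.prems by (cases u) (auto split: if_splits)
  then show ?case using LoopF by (intro exI[of _ u]) (auto intro: exec.LoopF)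
next
  case (LoopT s i A c t1 s' t2 s'')
  have *: "top_symbol ((s(0 := u @ w')) i) \<in> A"
    using LoopT.hyps(1) LoopT.prems by (cases u) (auto split: if_splits)
  have "t1 \<le> length u" using LoopT.prems by simp
  from LoopT.IH(1)[OF LoopT.prems(1) this] obtain u1 where u1: "s' 0 = u1 @ w" "length u \<le> length u1 + t1"
    "exec c (s(0 := u @ w')) t1 (s'(0 := u1 @ w'))"
    by blast
  have le: "t2 \<le> length u1" using u1(2) LoopT.prems by simp
  obtain u2 where u2: "s'' 0 = u2 @ w" "length u1 \<le> length u2 + t2"
    "exec (Loop i A c) (s'(0 := u1 @ w')) t2 (s''(0 := u2 @ w'))"
    using LoopT.IH(2)[OF u1(1) le] by blast
  have "length u \<le> length u2 + Suc (t1 + t2)" using u1(2) u2(2) by simp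
  then show ?case using u2(1) exec.LoopT[OF * u1(3) u2(3)] by blast
qed

subsection \<open>Relocating the stacks of a program\<close>

primrec relocate :: "nat \<Rightarrow> program \<Rightarrow> program" where
  "relocate b Skip = Skip"
| "relocate b (Push i a) = Push (b + i) a"
| "relocate b (Pop i) = Pop (b + i)"
| "relocate b (Seq c1 c2) = Seq (relocate b c1) (relocate b c2)"
| "relocate b (Branch i A c1 c2) = Branch (b + i) A (relocate b c1) (relocate b c2)"
| "relocate b (Loop i A c) = Loop (b + i) A (relocate b c)"

definition join_stores :: "nat \<Rightarrow> store \<Rightarrow> store \<Rightarrow> store" where
  "join_stores b r h = (\<lambda>i. if i < b then r i else h (i - b))"

lemma join_stores_upd: "join_stores b r (h(i := w)) = (join_stores b r h)(b + i := w)"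
  by (auto simp: join_stores_def fun_eq_iff)

lemma join_stores_relocate [simp]: "join_stores b r h (b + i) = h i"
  by (simp add: join_stores_def)

lemma exec_relocate: "exec c h t h' \<Longrightarrow> exec (relocate b c) (join_stores b r h) t (join_stores b r h')"
proof (induction rule: exec.induct)
  case (Push i a s)
  show ?case using exec.Push[of "b + i" a "join_stores b r s"] by (simp add: join_stores_upd del: fun_upd_apply)
next
  case (Pop i s)
  show ?case using exec.Pop[of "b + i" "join_stores b r s"] by (simp add: join_stores_upd del: fun_upd_apply)
qed (auto intro: exec.intros)

text \<open>Stacks that are only inspected do not count: the bound tells which stacks a program may
  have changed and which therefore need clearing.\<close>

primrec stack_bound :: "program \<Rightarrow> nat" where
  "stack_bound Skip = 0"
| "stack_bound (Push i a) = Suc i"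
| "stack_bound (Pop i) = Suc i"
| "stack_bound (Seq c1 c2) = max (stack_bound c1) (stack_bound c2)"
| "stack_bound (Branch i A c1 c2) = max (stack_bound c1) (stack_bound c2)"
| "stack_bound (Loop i A c) = stack_bound c"

lemma exec_stack_bound: "exec c s t s' \<Longrightarrow> stack_bound c \<le> j \<Longrightarrow> s' j = s j"
  by (induction rule: exec.induct) auto

subsection \<open>Clocked execution\<close>

text \<open>Stack 0 is the clock, stack 1 a flag that is empty between instructions, and stack \<open>j\<close> of the
  original program is stack \<open>j + 2\<close>. Every round of a loop removes a symbol from the clock, and an
  empty clock stops all loops.\<close>

definition clock_test :: "nat \<Rightarrow> symbol option set \<Rightarrow> program" where
  "clock_test i A = Branch 0 {None} Skip (Branch (2 + i) A (Push 1 Sep) Skip)"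

text \<open>A loop can test a single stack, but a clocked loop has to check both the clock and the
  original condition. The conjunction is therefore computed into the flag, once before the loop and
  again at the end of each round.\<close>

primrec clocked :: "program \<Rightarrow> program" where
  "clocked Skip = Skip"
| "clocked (Push i a) = Push (2 + i) a"
| "clocked (Pop i) = Pop (2 + i)"
| "clocked (Seq c1 c2) = Seq (clocked c1) (clocked c2)"
| "clocked (Branch i A c1 c2) = Branch (2 + i) A (clocked c1) (clocked c2)"
| "clocked (Loop i A c) =
     Seq (clock_test i A)
       (Loop 1 {Some Sep} (Seq (Pop 1) (Seq (Pop 0) (Seq (clocked c) (clock_test i A)))))"

definition clock_store :: "symbol list \<Rightarrow> symbol list \<Rightarrow> store \<Rightarrow> store" where
  "clock_store k fl s = (\<lambda>i. if i = 0 then k else if i = 1 then fl else s (i - 2))"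

lemma clock_store_simps [simp]:
  "clock_store k fl s 0 = k" "clock_store k fl s 1 = fl" "clock_store k fl s (Suc (Suc i)) = s i"
  by (simp_all add: clock_store_def)

lemma clock_store_upd:
  "(clock_store k fl s)(0 := k') = clock_store k' fl s"
  "(clock_store k fl s)(1 := fl') = clock_store k fl' s"
  "(clock_store k fl s)(Suc (Suc i) := w) = clock_store k fl (s(i := w))"
  by (auto simp: clock_store_def fun_eq_iff)

lemma exec_clock_test:
  "\<exists>t\<le>4. exec (clock_test i A) (clock_store k [] s) t
     (clock_store k (if k \<noteq> [] \<and> top_symbol (s i) \<in> A then [Sep] else []) s)"
proof (cases "k = []")
  case True
  then have "exec (clock_test i A) (clock_store k [] s) (Suc 1) (clock_store k [] s)"
    unfolding clock_test_def by (intro exec.BranchT exec.Skip) simp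
  with True show ?thesis by (intro exI[of _ "Suc 1"]) simp
next
  case k: False
  show ?thesis
  proof (cases "top_symbol (s i) \<in> A")
    case True
    have "exec (clock_test i A) (clock_store k [] s) (Suc (Suc 1))
       ((clock_store k [] s)(1 := Sep # clock_store k [] s 1))"
      unfolding clock_test_def using k True by (intro exec.BranchF exec.BranchT exec.Push) simp_all
    with k True show ?thesis by (intro exI[of _ "Suc (Suc 1)"]) (simp add: clock_store_upd)
  next
    case False
    have "exec (clock_test i A) (clock_store k [] s) (Suc (Suc 1)) (clock_store k [] s)"
      unfolding clock_test_def using k False by (intro exec.BranchF exec.Skip) simp_all
    with k False show ?thesis by (intro exI[of _ "Suc (Suc 1)"]) simp
  qed
qed

text \<open>The 7 pays for the overhead of one round: the loop test, two pops and at most four steps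
  of \<open>clock_test\<close>.\<close>

primrec clock_const :: "program \<Rightarrow> nat" where
  "clock_const Skip = 1"
| "clock_const (Push i a) = 1"
| "clock_const (Pop i) = 1"
| "clock_const (Seq c1 c2) = clock_const c1 + clock_const c2"
| "clock_const (Branch i A c1 c2) = Suc (clock_const c1 + clock_const c2)"
| "clock_const (Loop i A c) = 7 + clock_const c"

text \<open>Time is charged to the clock symbols that disappear, plus one unit for code that
  consumes none. Symbols are never given back, so nested loops share one linear bound instead of
  multiplying their costs.\<close>

lemma clocked_total:
  "\<exists>t k' s'. exec (clocked c) (clock_store k [] s) t (clock_store k' [] s') \<and> length k' \<le> length k \<and>
     t \<le> clock_const c * (1 + length k - length k')"
proof (induction c arbitrary: k s)
  case Skip
  have "exec (clocked Skip) (clock_store k [] s) 1 (clock_store k [] s)" by (simp add: exec.Skip)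
  then show ?case by fastforce
next
  case (Push i a)
  have "exec (clocked (Push i a)) (clock_store k [] s) 1 (clock_store k [] (s(i := a # s i)))"
    using exec.Push[of "2 + i" a "clock_store k [] s"] by (simp add: clock_store_upd)
  then show ?case by fastforce
next
  case (Pop i)
  have "exec (clocked (Pop i)) (clock_store k [] s) 1 (clock_store k [] (s(i := tl (s i))))"
    using exec.Pop[of "2 + i" "clock_store k [] s"] by (simp add: clock_store_upd)
  then show ?case by fastforce
next
  case (Seq c1 c2)
  obtain t1 k1 s1 where 1: "exec (clocked c1) (clock_store k [] s) t1 (clock_store k1 [] s1)"
    "length k1 \<le> length k" "t1 \<le> clock_const c1 * (1 + length k - length k1)"
    using Seq.IH(1) by blast
  obtain t2 k2 s2 where 2: "exec (clocked c2) (clock_store k1 [] s1) t2 (clock_store k2 [] s2)"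
    "length k2 \<le> length k1" "t2 \<le> clock_const c2 * (1 + length k1 - length k2)"
    using Seq.IH(2) by blast
  have "t1 + t2 \<le> clock_const c1 * (1 + length k - length k2) + clock_const c2 * (1 + length k - length k2)"
    using 1 2 by (intro add_mono) (erule order_trans, intro mult_left_mono, auto)+
  then show ?case using 1 2 exec.Seq[OF 1(1) 2(1)]
    by (intro exI[of _ "t1 + t2"] exI[of _ k2] exI[of _ s2]) (auto simp: add_mult_distrib)
next
  case (Branch i A c1 c2)
  show ?case
  proof (cases "top_symbol (s i) \<in> A")
    case True
    obtain t1 k1 s1 where 1: "exec (clocked c1) (clock_store k [] s) t1 (clock_store k1 [] s1)"
      "length k1 \<le> length k" "t1 \<le> clock_const c1 * (1 + length k - length k1)"
      using Branch.IH(1) by blast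
    have "exec (clocked (Branch i A c1 c2)) (clock_store k [] s) (Suc t1) (clock_store k1 [] s1)"
      using 1 True by (auto intro!: exec.BranchT)
    moreover have "Suc t1 \<le> clock_const (Branch i A c1 c2) * (1 + length k - length k1)"
    proof -
      obtain d where d: "length k = length k1 + d" using 1(2) le_iff_add by blast
      with 1(3) show ?thesis by (simp add: algebra_simps)
    qed
    ultimately show ?thesis using 1(2) by blast
  next
    case False
    obtain t1 k1 s1 where 1: "exec (clocked c2) (clock_store k [] s) t1 (clock_store k1 [] s1)"
      "length k1 \<le> length k" "t1 \<le> clock_const c2 * (1 + length k - length k1)"
      using Branch.IH(2) by blast
    have "exec (clocked (Branch i A c1 c2)) (clock_store k [] s) (Suc t1) (clock_store k1 [] s1)"
      using 1 False by (auto intro!: exec.BranchF)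
    moreover have "Suc t1 \<le> clock_const (Branch i A c1 c2) * (1 + length k - length k1)"
    proof -
      obtain d where d: "length k = length k1 + d" using 1(2) le_iff_add by blast
      with 1(3) show ?thesis by (simp add: algebra_simps)
    qed
    ultimately show ?thesis using 1(2) by blast
  qed
next
  case (Loop i A c)
  let ?body = "Seq (Pop 1) (Seq (Pop 0) (Seq (clocked c) (clock_test i A)))"
  let ?C = "7 + clock_const c"
  have loop: "\<exists>t k' s'. exec (Loop 1 {Some Sep} ?body) (clock_store k fl s) t (clock_store k' [] s') \<and>
      length k' \<le> length k \<and> t \<le> 1 + ?C * (length k - length k')"
    if "fl = (if k \<noteq> [] \<and> top_symbol (s i) \<in> A then [Sep] else [])" for k fl s
    using that
  proof (induction "length k" arbitrary: k fl s rule: less_induct)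
    case less
    show ?case
    proof (cases "k \<noteq> [] \<and> top_symbol (s i) \<in> A")
      case True
      then obtain b k0 where k: "k = b # k0" by (cases k) auto
      have fl: "fl = [Sep]" using True less.prems by simp
      obtain t1 k1 s1 where 1: "exec (clocked c) (clock_store k0 [] s) t1 (clock_store k1 [] s1)"
        "length k1 \<le> length k0" "t1 \<le> clock_const c * (1 + length k0 - length k1)"
        using Loop.IH by blast
      define fl1 where "fl1 = (if k1 \<noteq> [] \<and> top_symbol (s1 i) \<in> A then [Sep] else [])"
      obtain t2 where 2: "t2 \<le> 4" "exec (clock_test i A) (clock_store k1 [] s1) t2 (clock_store k1 fl1 s1)"
        unfolding fl1_def using exec_clock_test by blast
      have p1: "exec (Pop 1) (clock_store k fl s) 1 (clock_store k [] s)"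
        using exec.Pop[of 1 "clock_store k fl s"] fl by (simp add: clock_store_upd)
      have p0: "exec (Pop 0) (clock_store k [] s) 1 (clock_store k0 [] s)"
        using exec.Pop[of 0 "clock_store k [] s"] k by (simp add: clock_store_upd)
      have body: "exec ?body (clock_store k fl s) (1 + (1 + (t1 + t2))) (clock_store k1 fl1 s1)"
        by (intro exec.Seq[OF p1] exec.Seq[OF p0] exec.Seq[OF 1(1)] 2)
      obtain t3 k3 s3 where 3: "exec (Loop 1 {Some Sep} ?body) (clock_store k1 fl1 s1) t3 (clock_store k3 [] s3)"
        "length k3 \<le> length k1" "t3 \<le> 1 + ?C * (length k1 - length k3)"
        using less.hyps[of k1 fl1 s1] 1(2) k fl1_def by auto
      have top: "top_symbol (clock_store k fl s 1) \<in> {Some Sep}" using fl by simp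
      have ex: "exec (Loop 1 {Some Sep} ?body) (clock_store k fl s) (Suc (1 + (1 + (t1 + t2)) + t3)) (clock_store k3 [] s3)"
        by (rule exec.LoopT[OF top body 3(1)])
      obtain d where d: "length k = length k1 + Suc d" using 1(2) k
        by (metis le_imp_less_Suc length_Cons less_imp_Suc_add add_Suc_right)
      have "t1 \<le> clock_const c * Suc d" using 1(3) d k by (simp add: algebra_simps)
      then have "Suc (1 + (1 + (t1 + t2)) + t3) \<le> 1 + ?C * Suc d + ?C * (length k1 - length k3)"
        using 2(1) 3(3) by (simp add: algebra_simps)
      also have "\<dots> = 1 + ?C * (length k - length k3)"
      proof -
        have "length k - length k3 = Suc d + (length k1 - length k3)" using d 3(2) by simp
        then show ?thesis by (simp only: add_mult_distrib2 add.assoc)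
      qed
      finally show ?thesis using ex 3(2) 1(2) k
        by (intro exI[of _ "Suc (1 + (1 + (t1 + t2)) + t3)"] exI[of _ k3] exI[of _ s3]) auto
    next
      case False
      then have "exec (Loop 1 {Some Sep} ?body) (clock_store k fl s) 1 (clock_store k [] s)"
        using less.prems exec.LoopF[of "clock_store k fl s" 1 "{Some Sep}" ?body] by auto
      then show ?thesis by fastforce
    qed
  qed
  define fl where "fl = (if k \<noteq> [] \<and> top_symbol (s i) \<in> A then [Sep] else [])"
  obtain t1 where 1: "t1 \<le> 4" "exec (clock_test i A) (clock_store k [] s) t1 (clock_store k fl s)"
    unfolding fl_def using exec_clock_test by blast
  obtain t2 k' s' where 2: "exec (Loop 1 {Some Sep} ?body) (clock_store k fl s) t2 (clock_store k' [] s')"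
      "length k' \<le> length k" "t2 \<le> 1 + ?C * (length k - length k')"
    using loop[of fl k s, OF fl_def] by blast
  have "t1 + t2 \<le> clock_const (Loop i A c) * (1 + length k - length k')"
    using 1(1) 2 by (simp add: Suc_diff_le algebra_simps)
  moreover have "exec (clocked (Loop i A c)) (clock_store k [] s) (t1 + t2) (clock_store k' [] s')"
    unfolding clocked.simps by (rule exec.Seq[OF 1(2) 2(1)])
  ultimately show ?case using 2(2) by blast
qed

text \<open>A round takes one symbol from the clock and at least one step of the original run, so a
  clock of length \<open>t\<close> cannot stop a loop before the original program does.\<close>

lemma clocked_simulates:
  assumes "exec c s t s'" "t \<le> length k"
  shows "\<exists>u k'. exec (clocked c) (clock_store k [] s) u (clock_store k' [] s') \<and> length k \<le> length k' + t"
  using assms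
proof (induction arbitrary: k rule: exec.induct)
  case (Skip s)
  have "exec (clocked Skip) (clock_store k [] s) 1 (clock_store k [] s)" by (simp add: exec.Skip)
  moreover have "length k \<le> length k + 1" by simp
  ultimately show ?case by blast
next
  case (Push i a s)
  have "exec (clocked (Push i a)) (clock_store k [] s) 1 (clock_store k [] (s(i := a # s i)))"
    using exec.Push[of "2 + i" a "clock_store k [] s"] by (simp add: clock_store_upd)
  moreover have "length k \<le> length k + 1" by simp
  ultimately show ?case by blast
next
  case (Pop i s)
  have "exec (clocked (Pop i)) (clock_store k [] s) 1 (clock_store k [] (s(i := tl (s i))))"
    using exec.Pop[of "2 + i" "clock_store k [] s"] by (simp add: clock_store_upd)
  moreover have "length k \<le> length k + 1" by simp
  ultimately show ?case by blast
next
  case (Seq c1 s t1 s' c2 t2 s'')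
  obtain u1 k1 where 1: "exec (clocked c1) (clock_store k [] s) u1 (clock_store k1 [] s')"
     "length k \<le> length k1 + t1"
    using Seq.IH(1)[of k] Seq.prems by auto
  obtain u2 k2 where 2: "exec (clocked c2) (clock_store k1 [] s') u2 (clock_store k2 [] s'')"
     "length k1 \<le> length k2 + t2"
    using Seq.IH(2)[of k1] Seq.prems 1 by auto
  have "length k \<le> length k2 + (t1 + t2)" using 1(2) 2(2) by simp
  then show ?case using exec.Seq[OF 1(1) 2(1)] unfolding clocked.simps by blast
next
  case (BranchT s i A c1 t s' c2)
  obtain u1 k1 where 1: "exec (clocked c1) (clock_store k [] s) u1 (clock_store k1 [] s')"
     "length k \<le> length k1 + t"
    using BranchT.IH[of k] BranchT.prems by auto
  have "exec (clocked (Branch i A c1 c2)) (clock_store k [] s) (Suc u1) (clock_store k1 [] s')"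
    using 1 BranchT.hyps by (auto intro!: exec.BranchT)
  moreover have "length k \<le> length k1 + Suc t" using 1(2) by simp
  ultimately show ?case by blast
next
  case (BranchF s i A c2 t s' c1)
  obtain u1 k1 where 1: "exec (clocked c2) (clock_store k [] s) u1 (clock_store k1 [] s')"
     "length k \<le> length k1 + t"
    using BranchF.IH[of k] BranchF.prems by auto
  have "exec (clocked (Branch i A c1 c2)) (clock_store k [] s) (Suc u1) (clock_store k1 [] s')"
    using 1 BranchF.hyps by (auto intro!: exec.BranchF)
  moreover have "length k \<le> length k1 + Suc t" using 1(2) by simp
  ultimately show ?case by blast
next
  case (LoopF s i A c)
  let ?body = "Seq (Pop 1) (Seq (Pop 0) (Seq (clocked c) (clock_test i A)))"
  obtain t1 where 1: "exec (clock_test i A) (clock_store k [] s) t1 (clock_store k [] s)"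
    using exec_clock_test[of i A k s] LoopF.hyps by auto
  have 2: "exec (Loop 1 {Some Sep} ?body) (clock_store k [] s) 1 (clock_store k [] s)"
    by (intro exec.LoopF) simp
  have "length k \<le> length k + 1" by simp
  then show ?case using exec.Seq[OF 1 2] unfolding clocked.simps by blast
next
  case (LoopT s i A c t1 s' t2 s'')
  let ?body = "Seq (Pop 1) (Seq (Pop 0) (Seq (clocked c) (clock_test i A)))"
  obtain b k0 where k: "k = b # k0" using LoopT.prems by (cases k) auto
  obtain t0 where 0: "exec (clock_test i A) (clock_store k [] s) t0 (clock_store k [Sep] s)"
    using exec_clock_test[of i A k s] LoopT.hyps k by auto
  have p1: "exec (Pop 1) (clock_store k [Sep] s) 1 (clock_store k [] s)"
    using exec.Pop[of 1 "clock_store k [Sep] s"] by (simp add: clock_store_upd)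
  have p0: "exec (Pop 0) (clock_store k [] s) 1 (clock_store k0 [] s)"
    using exec.Pop[of 0 "clock_store k [] s"] k by (simp add: clock_store_upd)
  obtain u1 k1 where 1: "exec (clocked c) (clock_store k0 [] s) u1 (clock_store k1 [] s')"
     "length k0 \<le> length k1 + t1"
    using LoopT.IH(1)[of k0] LoopT.prems k by auto
  obtain u2 k2 where 2: "exec (clocked (Loop i A c)) (clock_store k1 [] s') u2 (clock_store k2 [] s'')"
     "length k1 \<le> length k2 + t2"
    using LoopT.IH(2)[of k1] LoopT.prems 1(2) k by auto
  \<comment> \<open>The clocked form of the remaining loop starts with the same test that ends the
    first round; splitting it off lets it be reassociated with that round.\<close>
  obtain v1 v2 \<sigma> where v: "exec (clock_test i A) (clock_store k1 [] s') v1 \<sigma>"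
     "exec (Loop 1 {Some Sep} ?body) \<sigma> v2 (clock_store k2 [] s'')"
    using 2(1) unfolding clocked.simps by (elim exec_SeqE) blast
  have body: "exec ?body (clock_store k [Sep] s) (1 + (1 + (u1 + v1))) \<sigma>"
    by (intro exec.Seq[OF p1] exec.Seq[OF p0] exec.Seq[OF 1(1)] v)
  have top: "top_symbol (clock_store k [Sep] s 1) \<in> {Some Sep}" by simp
  have "exec (clocked (Loop i A c)) (clock_store k [] s)
     (t0 + Suc (1 + (1 + (u1 + v1)) + v2)) (clock_store k2 [] s'')"
    unfolding clocked.simps by (rule exec.Seq[OF 0 exec.LoopT[OF top body v(2)]])
  moreover have "length k \<le> length k2 + Suc (t1 + t2)" using 1(2) 2(2) k by simp
  ultimately show ?case by blast
qed


subsection \<open>Basic programs\<close>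

text \<open>No instruction copies a symbol, hence the dispatch on all three. From an empty stack
  nothing is pushed; \<open>compare_step\<close> relies on this once the challenge is
  exhausted.\<close>

definition transfer :: "nat \<Rightarrow> nat \<Rightarrow> program" where
  "transfer i j =
     Seq (Branch i {Some (Bit True)} (Push j (Bit True))
           (Branch i {Some (Bit False)} (Push j (Bit False))
             (Branch i {Some Sep} (Push j Sep) Skip)))
       (Pop i)"

definition transfer2 :: "nat \<Rightarrow> nat \<Rightarrow> nat \<Rightarrow> program" where
  "transfer2 i j k =
     Seq (Branch i {Some (Bit True)} (Seq (Push j (Bit True)) (Push k (Bit True)))
           (Branch i {Some (Bit False)} (Seq (Push j (Bit False)) (Push k (Bit False)))
             (Seq (Push j Sep) (Push k Sep))))
       (Pop i)"

definition move_stack :: "nat \<Rightarrow> nat \<Rightarrow> program" where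
  "move_stack i j = Loop i (- {None}) (transfer i j)"

text \<open>Emptying a stack reverses it: stack \<open>k\<close> serves to restore the source, while
  the target receives the reversal. This is why the parts of the generator's input are kept
  reversed.\<close>

definition copy_stack :: "nat \<Rightarrow> nat \<Rightarrow> nat \<Rightarrow> program" where
  "copy_stack i j k = Seq (Loop i (- {None}) (transfer2 i j k)) (move_stack k i)"

definition clear_stack :: "nat \<Rightarrow> program" where
  "clear_stack i = Loop i (- {None}) (Pop i)"

definition move_bits :: "nat \<Rightarrow> nat \<Rightarrow> program" where
  "move_bits i j = Loop i {Some (Bit True), Some (Bit False)} (transfer i j)"

text \<open>On a reversed list the separator lies above its string, hence the initial pop.\<close>

definition drop_block :: "nat \<Rightarrow> program" where
  "drop_block i = Seq (Pop i) (Loop i {Some (Bit True), Some (Bit False)} (Pop i))"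

lemma runs_Seq_mono:
  "runs c1 s T1 s' \<Longrightarrow> runs c2 s' T2 s'' \<Longrightarrow> T1 + T2 \<le> T \<Longrightarrow> runs (Seq c1 c2) s T s''"
  using runs_Seq runs_mono by blast

lemma runs_Push_eq: "s' = s(i := a # s i) \<Longrightarrow> runs (Push i a) s 1 s'"
  using runs_Push by simp

lemma runs_Pop_eq: "s' = s(i := tl (s i)) \<Longrightarrow> runs (Pop i) s 1 s'"
  using runs_Pop by simp

lemma symbol_cases: "a = Bit True \<or> a = Bit False \<or> a = Sep"
  by (cases a) auto

lemma runs_transfer:
  assumes "i \<noteq> j" "s i = a # w"
  shows "runs (transfer i j) s 5 (s(i := w, j := a # s j))"
proof -
  have "runs (Branch i {Some (Bit True)} (Push j (Bit True))
           (Branch i {Some (Bit False)} (Push j (Bit False))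
             (Branch i {Some Sep} (Push j Sep) Skip))) s 4 (s(j := a # s j))"
    (is "runs ?B s 4 _")
  proof -
    consider "a = Bit True" | "a = Bit False" | "a = Sep" using symbol_cases by blast
    then have "runs ?B s (Suc (Suc (Suc 1))) (s(j := a # s j))"
    proof cases
      case 1
      then have "runs ?B s (Suc 1) (s(j := a # s j))"
        using assms by (intro runs_BranchT runs_Push_eq) simp_all
      then show ?thesis by (rule runs_mono) simp
    next
      case 2
      then have "runs ?B s (Suc (Suc 1)) (s(j := a # s j))"
        using assms by (intro runs_BranchF[OF _ runs_BranchT[OF _ runs_Push_eq]]) simp_all
      then show ?thesis by (rule runs_mono) simp
    next
      case 3
      then show ?thesis
        using assms by (intro runs_BranchF[OF _ runs_BranchF[OF _ runs_BranchT[OF _ runs_Push_eq]]]) simp_all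
    qed
    then show ?thesis by (simp add: eval_nat_numeral One_nat_def)
  qed
  moreover have "runs (Pop i) (s(j := a # s j)) 1 (s(i := w, j := a # s j))"
    using assms by (intro runs_Pop_eq) (auto simp: fun_eq_iff)
  ultimately show ?thesis
    unfolding transfer_def by (rule runs_Seq_mono) simp
qed

lemma runs_transfer_empty:
  assumes "s i = []"
  shows "runs (transfer i j) s 5 s"
proof -
  have "runs (Branch i {Some (Bit True)} (Push j (Bit True))
           (Branch i {Some (Bit False)} (Push j (Bit False))
             (Branch i {Some Sep} (Push j Sep) Skip))) s (Suc (Suc (Suc 1))) s"
    using assms by (intro runs_BranchF runs_Skip) simp_all
  moreover have "runs (Pop i) s 1 s"
    using assms by (intro runs_Pop_eq) (auto simp: fun_eq_iff)
  ultimately show ?thesis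
    unfolding transfer_def by (rule runs_Seq_mono) simp
qed

lemma runs_transfer2:
  assumes "i \<noteq> j" "i \<noteq> k" "j \<noteq> k" "s i = a # w"
  shows "runs (transfer2 i j k) s 6 (s(i := w, j := a # s j, k := a # s k))"
proof -
  let ?s = "s(j := a # s j, k := a # s k)"
  have push: "runs (Seq (Push j a) (Push k a)) s 2 ?s"
    by (rule runs_Seq_mono[OF runs_Push_eq[OF refl] runs_Push_eq[OF refl], THEN back_subst[where P = "runs _ _ _"]])
      (use assms in auto)
  have "runs (Branch i {Some (Bit True)} (Seq (Push j (Bit True)) (Push k (Bit True)))
           (Branch i {Some (Bit False)} (Seq (Push j (Bit False)) (Push k (Bit False)))
             (Seq (Push j Sep) (Push k Sep)))) s 4 ?s"
    (is "runs ?B s 4 _")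
  proof -
    consider "a = Bit True" | "a = Bit False" | "a = Sep" using symbol_cases by blast
    then have "runs ?B s (Suc (Suc 2)) ?s"
    proof cases
      case 1
      then have "runs ?B s (Suc 2) ?s"
        using assms push by (intro runs_BranchT) simp_all
      then show ?thesis by (rule runs_mono) simp
    next
      case 2
      then show ?thesis
        using assms push by (intro runs_BranchF[OF _ runs_BranchT]) simp_all
    next
      case 3
      then show ?thesis
        using assms push by (intro runs_BranchF[OF _ runs_BranchF]) simp_all
    qed
    then show ?thesis by simp
  qed
  moreover have "runs (Pop i) ?s 1 (s(i := w, j := a # s j, k := a # s k))"
    using assms by (intro runs_Pop_eq) (auto simp: fun_eq_iff)
  ultimately show ?thesis
    unfolding transfer2_def by (rule runs_Seq_mono) simp
qed

lemma runs_LoopT_mono: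
  "top_symbol (s i) \<in> A \<Longrightarrow> runs c s T1 s' \<Longrightarrow> runs (Loop i A c) s' T2 s''
    \<Longrightarrow> Suc (T1 + T2) \<le> T \<Longrightarrow> runs (Loop i A c) s T s''"
  using runs_LoopT runs_mono by blast

lemma runs_move_stack:
  assumes "i \<noteq> j"
  shows "runs (move_stack i j) s (6 * length (s i) + 1) (s(i := [], j := rev (s i) @ s j))"
proof (induction "s i" arbitrary: s)
  case Nil
  then have "s(i := [], j := rev (s i) @ s j) = s" by (auto simp: fun_eq_iff)
  with Nil show ?case
    using runs_LoopF[of s i "- {None}"] by (simp add: move_stack_def del: fun_upd_apply)
next
  case (Cons a w)
  let ?s = "s(i := w, j := a # s j)"
  have eq: "?s(i := [], j := rev (?s i) @ ?s j) = s(i := [], j := rev (s i) @ s j)"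
    using Cons.hyps(2)[symmetric] assms by (auto simp: fun_eq_iff)
  have "runs (move_stack i j) ?s (6 * length (?s i) + 1) (s(i := [], j := rev (s i) @ s j))"
    using Cons.hyps(1)[of ?s] assms unfolding eq by simp
  then show ?case unfolding move_stack_def
    by (rule runs_LoopT_mono[rotated 2, OF _ _ _ runs_transfer[of i j s a w, OF assms Cons.hyps(2)[symmetric]]])
      (use Cons.hyps(2)[symmetric] assms in auto)
qed

lemma runs_copy_stack:
  assumes "i \<noteq> j" "i \<noteq> k" "j \<noteq> k" "s k = []"
  shows "runs (copy_stack i j k) s (13 * length (s i) + 2) (s(j := rev (s i) @ s j))"
proof -
  have loop: "runs (Loop i (- {None}) (transfer2 i j k)) s (7 * length (s i) + 1)
      (s(i := [], j := rev (s i) @ s j, k := rev (s i) @ s k))" for s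
  proof (induction "s i" arbitrary: s)
    case Nil
    then have "s(i := [], j := rev (s i) @ s j, k := rev (s i) @ s k) = s" by (auto simp: fun_eq_iff)
    with Nil show ?case
      using runs_LoopF[of s i "- {None}"] by (simp del: fun_upd_apply)
  next
    case (Cons a w)
    let ?s = "s(i := w, j := a # s j, k := a # s k)"
    have eq: "?s(i := [], j := rev (?s i) @ ?s j, k := rev (?s i) @ ?s k)
        = s(i := [], j := rev (s i) @ s j, k := rev (s i) @ s k)"
      using Cons.hyps(2)[symmetric] assms by (auto simp: fun_eq_iff)
    have "runs (Loop i (- {None}) (transfer2 i j k)) ?s (7 * length (?s i) + 1)
        (s(i := [], j := rev (s i) @ s j, k := rev (s i) @ s k))"
      using Cons.hyps(1)[of ?s] assms unfolding eq by simp
    then show ?case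
      by (rule runs_LoopT_mono[rotated 2, OF _ _ _ runs_transfer2[of i j k s a w, OF assms(1-3) Cons.hyps(2)[symmetric]]])
        (use Cons.hyps(2)[symmetric] assms in auto)
  qed
  let ?s = "s(i := [], j := rev (s i) @ s j, k := rev (s i) @ s k)"
  have eq: "?s(k := [], i := rev (?s k) @ ?s i) = s(j := rev (s i) @ s j)"
    using assms by (auto simp: fun_eq_iff)
  show ?thesis unfolding copy_stack_def
    by (rule runs_Seq_mono[OF loop runs_move_stack[of k i ?s, unfolded eq]]) (use assms in auto)
qed

lemma runs_clear_stack: "runs (clear_stack i) s (2 * length (s i) + 1) (s(i := []))"
proof (induction "s i" arbitrary: s)
  case Nil
  then have "s(i := []) = s" by (auto simp: fun_eq_iff)
  with Nil show ?case
    using runs_LoopF[of s i "- {None}"] by (simp add: clear_stack_def del: fun_upd_apply)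
next
  case (Cons a w)
  have "runs (clear_stack i) (s(i := w)) (2 * length w + 1) (s(i := []))"
    using Cons.hyps(1)[of "s(i := w)"] by simp
  then show ?case unfolding clear_stack_def
    by (rule runs_LoopT_mono[rotated 2, OF _ _ _ runs_Pop_eq])
      (use Cons.hyps(2)[symmetric] in auto)
qed

lemma top_symbol_Bit [simp]: "top_symbol (Bit b # w) \<in> {Some (Bit True), Some (Bit False)}"
  by (cases b) auto

lemma runs_move_bits:
  assumes "i \<noteq> j" "s i = map Bit u @ w" "top_symbol w \<notin> {Some (Bit True), Some (Bit False)}"
  shows "runs (move_bits i j) s (6 * length u + 1) (s(i := w, j := rev (map Bit u) @ s j))"
  using assms(2)
proof (induction u arbitrary: s)
  case Nil
  then have "s(i := w, j := rev (map Bit []) @ s j) = s" by (auto simp: fun_eq_iff)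
  with Nil show ?case
    using runs_LoopF[of s i "{Some (Bit True), Some (Bit False)}"] assms(3)
    by (simp add: move_bits_def del: fun_upd_apply)
next
  case (Cons a u)
  let ?s = "s(i := map Bit u @ w, j := Bit a # s j)"
  have si: "s i = Bit a # map Bit u @ w" using Cons.prems by simp
  have eq: "?s(i := w, j := rev (map Bit u) @ ?s j) = s(i := w, j := rev (map Bit (a # u)) @ s j)"
    using assms(1) by (auto simp: fun_eq_iff)
  have "runs (move_bits i j) ?s (6 * length u + 1) (s(i := w, j := rev (map Bit (a # u)) @ s j))"
    using Cons.IH[of ?s] assms(1) unfolding eq by (simp del: fun_upd_apply add: fun_upd_other fun_upd_same)
  then show ?case unfolding move_bits_def
    by (rule runs_LoopT_mono[rotated 2, OF _ _ _ runs_transfer[of i j s, OF assms(1) si]])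
      (use si in auto)
qed

lemma runs_drop_block:
  assumes "s i = a # map Bit u @ w" "top_symbol w \<notin> {Some (Bit True), Some (Bit False)}"
  shows "runs (drop_block i) s (2 * length u + 2) (s(i := w))"
proof -
  have loop: "runs (Loop i {Some (Bit True), Some (Bit False)} (Pop i)) s (2 * length u + 1) (s(i := w))"
    if "s i = map Bit u @ w" for s u
    using that
  proof (induction u arbitrary: s)
    case Nil
    then have "s(i := w) = s" by (auto simp: fun_eq_iff)
    with Nil show ?case
      using runs_LoopF[of s i "{Some (Bit True), Some (Bit False)}"] assms(2)
      by (simp del: fun_upd_apply)
  next
    case (Cons a u)
    then have si: "s i = Bit a # map Bit u @ w" by simp
    have "runs (Loop i {Some (Bit True), Some (Bit False)} (Pop i)) (s(i := map Bit u @ w)) (2 * length u + 1) (s(i := w))"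
      using Cons.IH[of "s(i := map Bit u @ w)"] by (simp del: fun_upd_apply add: fun_upd_same)
    then show ?case
      by (rule runs_LoopT_mono[rotated 2, OF _ _ _ runs_Pop_eq]) (use si in auto)
  qed
  have "runs (Loop i {Some (Bit True), Some (Bit False)} (Pop i)) (s(i := map Bit u @ w)) (2 * length u + 1) (s(i := w))"
    using loop[of "s(i := map Bit u @ w)" u] by (simp del: fun_upd_apply add: fun_upd_same)
  then show ?thesis unfolding drop_block_def
    by (rule runs_Seq_mono[rotated, OF _ _ runs_Pop_eq]) (use assms in auto)
qed


subsection \<open>Total programs\<close>

text \<open>The length of the input serves as the clock, so only runs that are short compared with the
  input are simulated faithfully.\<close>

definition totalize :: "program \<Rightarrow> program" where
  "totalize c =
     Seq (move_stack 0 1)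
    (Seq (Loop 1 (- {None}) (Seq (Push 0 Sep) (transfer 1 2)))
    (Seq (clocked c)
    (Seq (clear_stack 0)
    (Seq (move_bits 3 0)
    (Seq (Push 1 Sep) (move_stack 0 1))))))"

lemma symbols_split_bits:
  "\<exists>u w. ss = map Bit u @ w \<and> top_symbol w \<notin> {Some (Bit True), Some (Bit False)}"
proof (induction ss)
  case Nil
  show ?case by (intro exI[of _ "[]"]) simp
next
  case (Cons a ss)
  then obtain u w where *: "ss = map Bit u @ w" "top_symbol w \<notin> {Some (Bit True), Some (Bit False)}"
    by blast
  show ?case
  proof (cases a)
    case (Bit b)
    with * show ?thesis by (intro exI[of _ "b # u"] exI[of _ w]) simp
  next
    case Sep
    then show ?thesis by (intro exI[of _ "[]"] exI[of _ "a # ss"]) simp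
  qed
qed

lemma bits_append_eq:
  assumes "map Bit u @ w = map Bit x @ Sep # w'"
    "top_symbol w \<notin> {Some (Bit True), Some (Bit False)}"
  shows "u = x"
  using assms(1)
proof (induction u arbitrary: x)
  case Nil
  then show ?case using assms(2) by (cases x) auto
next
  case (Cons a u)
  then show ?case by (cases x) auto
qed

lemma runs_start_clock:
  "runs (Loop 1 (- {None}) (Seq (Push 0 Sep) (transfer 1 2))) s (7 * length (s 1) + 1)
     (s(1 := [], 0 := replicate (length (s 1)) Sep @ s 0, 2 := rev (s 1) @ s 2))"
proof (induction "s 1" arbitrary: s)
  case Nil
  then have "s(1 := [], 0 := replicate (length (s 1)) Sep @ s 0, 2 := rev (s 1) @ s 2) = s"
    by (auto simp: fun_eq_iff)
  with Nil show ?case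
    using runs_LoopF[of s 1 "- {None}"] by (simp del: fun_upd_apply)
next
  case (Cons a w)
  note s1 = Cons.hyps(2)[symmetric]
  let ?t = "s(0 := Sep # s 0)"
  let ?s = "?t(1 := w, 2 := a # ?t 2)"
  have eq: "?s(1 := [], 0 := replicate (length (?s 1)) Sep @ ?s 0, 2 := rev (?s 1) @ ?s 2)
      = s(1 := [], 0 := replicate (length (s 1)) Sep @ s 0, 2 := rev (s 1) @ s 2)"
    using s1 by (auto simp: fun_eq_iff replicate_app_Cons_same)
  have body: "runs (Seq (Push 0 Sep) (transfer 1 2)) s 6 ?s"
    by (rule runs_Seq_mono[OF runs_Push runs_transfer[of 1 2 ?t a w]]) (use s1 in auto)
  have rest: "runs (Loop 1 (- {None}) (Seq (Push 0 Sep) (transfer 1 2))) ?s (7 * length (?s 1) + 1)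
      (s(1 := [], 0 := replicate (length (s 1)) Sep @ s 0, 2 := rev (s 1) @ s 2))"
    using Cons.hyps(1)[of ?s] unfolding eq by simp
  show ?case
    by (rule runs_LoopT_mono[OF _ body rest]) (use s1 in auto)
qed

text \<open>\<open>ppt\<close> demands a single program that always halts with one bit string as
  output. Whatever the clocked run leaves on the output stack is cut at the first separator; if the
  original program halts in time with output \<open>[x]\<close>, determinism forces the clocked run
  to leave the same and the cut yields \<open>x\<close>.\<close>

theorem totalize:
  obtains C :: nat and g where
    "\<And>ws. \<exists>s. runs (totalize c) (input_store ws) (C * (length (encode ws) + 1)) s \<and> s 1 = encode [g ws]"
    "\<And>ws t s x. exec c (input_store ws) t s \<Longrightarrow> t \<le> length (encode ws) \<Longrightarrow> s 1 = encode [x] \<Longrightarrow> g ws = x"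
proof -
  \<comment> \<open>The factor 13 is one clocked run of \<open>t\<close> steps and two passes of
    cost 6 per bit over an output of at most \<open>t\<close> bits.\<close>
  let ?C = "40 + 13 * clock_const c"
  let ?P = "\<lambda>ws x. (\<exists>s. runs (totalize c) (input_store ws) (?C * (length (encode ws) + 1)) s \<and> s 1 = encode [x]) \<and>
      (\<forall>t s y. exec c (input_store ws) t s \<longrightarrow> t \<le> length (encode ws) \<longrightarrow> s 1 = encode [y] \<longrightarrow> x = y)"
  have "\<exists>x. ?P ws x" for ws
  proof -
    define L where "L = length (encode ws)"
    define k where "k = replicate L Sep"
    define s0 where "s0 = input_store ws"
    have s0: "s0 0 = encode ws" "\<And>i. i \<noteq> 0 \<Longrightarrow> s0 i = []"
      by (simp_all add: s0_def input_store_def)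
    define s1 where "s1 = s0(0 := [], 1 := rev (encode ws))"
    have r1: "runs (move_stack 0 1) s0 (6 * L + 1) s1"
      using runs_move_stack[of 0 1 s0] s0 by (simp add: s1_def L_def)
    have r2: "runs (Loop 1 (- {None}) (Seq (Push 0 Sep) (transfer 1 2))) s1 (7 * L + 1) (clock_store k [] s0)"
    proof -
      have "s1(1 := [], 0 := replicate (length (s1 1)) Sep @ s1 0, 2 := rev (s1 1) @ s1 2) = clock_store k [] s0"
        using s0 by (auto simp: fun_eq_iff clock_store_def s1_def k_def L_def)
      then show ?thesis
        using runs_start_clock[of s1] by (simp add: s1_def L_def del: fun_upd_apply add: fun_upd_same)
    qed
    obtain t k' s' where r3: "exec (clocked c) (clock_store k [] s0) t (clock_store k' [] s')"
      "length k' \<le> length k" "t \<le> clock_const c * (1 + length k - length k')"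
      using clocked_total by blast
    have t: "t \<le> clock_const c * (L + 1)"
      by (rule order_trans[OF r3(3)], rule mult_le_mono2) (simp add: k_def)
    have len: "length (s' 1) \<le> t"
      using exec_length[OF r3(1), of "Suc (Suc 1)"] s0 by (simp add: clock_store_def One_nat_def)
    obtain u w where uw: "s' 1 = map Bit u @ w" "top_symbol w \<notin> {Some (Bit True), Some (Bit False)}"
      using symbols_split_bits by blast
    define s3 where "s3 = clock_store k' [] s'"
    have s3: "s3 0 = k'" "s3 1 = []" "s3 3 = map Bit u @ w"
      using uw(1) by (simp_all add: s3_def clock_store_def One_nat_def)
    define s4 where "s4 = s3(0 := [])"
    have r4: "runs (clear_stack 0) s3 (2 * L + 1) s4"
      unfolding s4_def by (rule runs_mono[OF runs_clear_stack]) (use r3(2) s3 in \<open>simp add: k_def\<close>)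
    define s5 where "s5 = s4(3 := w, 0 := rev (map Bit u) @ s4 0)"
    have r5: "runs (move_bits 3 0) s4 (6 * length u + 1) s5"
      unfolding s5_def by (rule runs_move_bits[OF _ _ uw(2)]) (simp_all add: s4_def s3)
    define s6 where "s6 = s5(1 := Sep # s5 1)"
    have r6: "runs (Push 1 Sep) s5 1 s6"
      unfolding s6_def by (rule runs_Push)
    have s60: "s6 0 = rev (map Bit u)" "s6 1 = [Sep]"
      by (simp_all add: s6_def s5_def s4_def s3)
    define s7 where "s7 = s6(0 := [], 1 := rev (s6 0) @ s6 1)"
    have r7: "runs (move_stack 0 1) s6 (6 * length u + 1) s7"
      unfolding s7_def by (rule runs_mono[OF runs_move_stack]) (simp_all add: s60)
    have s7: "s7 1 = encode [u]"
      by (simp add: s7_def s60 rev_map)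
    have lu: "length u \<le> t" using len uw by simp
    have "runs (totalize c) s0 (6 * L + 1 + (7 * L + 1 + (t + (2 * L + 1 + (6 * length u + 1 + (1 + (6 * length u + 1))))))) s7"
      unfolding totalize_def
      by (intro runs_Seq[OF r1] runs_Seq[OF r2] runs_Seq[OF _ runs_Seq[OF r4 runs_Seq[OF r5 runs_Seq[OF r6 r7]]]])
        (use r3(1) in \<open>auto simp: runs_def s3_def\<close>)
    moreover have "6 * L + 1 + (7 * L + 1 + (t + (2 * L + 1 + (6 * length u + 1 + (1 + (6 * length u + 1)))))) \<le> ?C * (L + 1)"
      using lu t by (simp add: algebra_simps)
    ultimately have "\<exists>s. runs (totalize c) (input_store ws) (?C * (length (encode ws) + 1)) s \<and> s 1 = encode [u]"
      using s7 runs_mono unfolding s0_def L_def by blast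
    moreover have "u = y" if y: "exec c (input_store ws) t2 s" "t2 \<le> length (encode ws)" "s 1 = encode [y]" for t2 s y
    proof -
      obtain u2 k2 where "exec (clocked c) (clock_store k [] s0) u2 (clock_store k2 [] s)"
        using clocked_simulates[OF y(1), of k] y(2) by (auto simp: k_def L_def s0_def)
      then have "clock_store k2 [] s = clock_store k' [] s'"
        using exec_deterministic[OF r3(1)] by blast
      then have "clock_store k2 [] s (Suc (Suc 1)) = clock_store k' [] s' (Suc (Suc 1))"
        by simp
      then have "map Bit u @ w = map Bit y @ Sep # []"
        using uw(1) y(3) by (simp add: clock_store_def One_nat_def)
      then show ?thesis using bits_append_eq uw(2) by blast
    qed
    ultimately show ?thesis by blast
  qed
  then have "\<exists>g. \<forall>ws. ?P ws (g ws)" by (rule choice[OF allI])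
  then obtain g where "\<forall>ws. ?P ws (g ws)" ..
  then show ?thesis by (intro that[of ?C g]) blast+
qed

section \<open>Averages and block-by-block search\<close>

subsection \<open>Averages over tuples\<close>

lemma finite_bitstrings [simp]: "finite (bitstrings n)"
  and card_bitstrings [simp]: "card (bitstrings n) = 2 ^ n"
proof -
  have *: "bitstrings n = {xs. set xs \<subseteq> UNIV \<and> length xs = n}"
    by (auto simp: bitstrings_def)
  show "finite (bitstrings n)"
    unfolding * by (rule finite_lists_length_eq) simp
  show "card (bitstrings n) = 2 ^ n"
    unfolding * by (subst card_lists_length_eq) simp_all
qed

lemma bitstrings_nonempty [simp]: "bitstrings n \<noteq> {}"
  by (metis card.empty card_bitstrings power_not_zero zero_neq_numeral)

lemma tuples_0 [simp]: "tuples v 0 = {[]}"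
  by (auto simp: tuples_def)

lemma tuples_Suc: "tuples v (Suc k) = (\<lambda>(x, rs). x # rs) ` (bitstrings v \<times> tuples v k)"
proof -
  have "rs \<in> (\<lambda>(x, rs). x # rs) ` (bitstrings v \<times> tuples v k)" if "rs \<in> tuples v (Suc k)" for rs
    using that by (cases rs) (auto simp: tuples_def)
  then show ?thesis by (auto simp: tuples_def)
qed

lemma finite_tuples [simp]: "finite (tuples v k)"
  by (induction k) (auto simp: tuples_Suc)

lemma tuples_append: "a \<in> tuples v j \<Longrightarrow> b \<in> tuples v k \<Longrightarrow> a @ b \<in> tuples v (j + k)"
  by (auto simp: tuples_def)

lemma tuples_singleton: "x \<in> bitstrings v \<Longrightarrow> [x] \<in> tuples v (Suc 0)"
  by (auto simp: tuples_def)

lemma tuples_take: "rs \<in> tuples v k \<Longrightarrow> j \<le> k \<Longrightarrow> take j rs \<in> tuples v j"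
  by (auto simp: tuples_def dest: in_set_takeD)

lemma tuples_replicate: "replicate k (replicate v b) \<in> tuples v k"
  by (auto simp: tuples_def bitstrings_def)

lemma length_tuples: "rs \<in> tuples v k \<Longrightarrow> length rs = k"
  by (simp add: tuples_def)

lemma inj_on_Cons_pair: "inj_on (\<lambda>(x, xs). x # xs) A"
  by (auto simp: inj_on_def)

lemma card_tuples: "card (tuples v k) = 2 ^ (v * k)"
  by (induction k) (auto simp: tuples_Suc card_image[OF inj_on_Cons_pair] card_cartesian_product power_add)

text \<open>Uniform expectation as a finite sum, which can be split blockwise without measure
  theory.\<close>

definition avg :: "nat \<Rightarrow> nat \<Rightarrow> (bool list list \<Rightarrow> real) \<Rightarrow> real" where
  "avg v k F = (\<Sum>rs\<in>tuples v k. F rs) / 2 ^ (v * k)"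

lemma avg_0 [simp]: "avg v 0 F = F []"
  by (simp add: avg_def)

lemma avg_Suc: "avg v (Suc k) F = (\<Sum>x\<in>bitstrings v. avg v k (\<lambda>rs. F (x # rs))) / 2 ^ v"
proof -
  have "(\<Sum>rs\<in>tuples v (Suc k). F rs) = (\<Sum>x\<in>bitstrings v. \<Sum>rs\<in>tuples v k. F (x # rs))"
    unfolding tuples_Suc by (subst sum.reindex[OF inj_on_Cons_pair]) (simp add: sum.cartesian_product case_prod_beta)
  then show ?thesis
    by (simp add: avg_def power_add sum_divide_distrib mult.commute)
qed

lemma avg_cong: "(\<And>rs. rs \<in> tuples v k \<Longrightarrow> F rs = G rs) \<Longrightarrow> avg v k F = avg v k G"
  by (simp add: avg_def)

lemma avg_mono: "(\<And>rs. rs \<in> tuples v k \<Longrightarrow> F rs \<le> G rs) \<Longrightarrow> avg v k F \<le> avg v k G"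
  by (simp add: avg_def sum_mono divide_right_mono)

lemma avg_const [simp]: "avg v k (\<lambda>_. c) = c"
  by (simp add: avg_def card_tuples)

lemma avg_plus: "avg v k (\<lambda>rs. F rs + G rs) = avg v k F + avg v k G"
  by (simp add: avg_def sum.distrib add_divide_distrib)

lemma avg_minus: "avg v k (\<lambda>rs. F rs - G rs) = avg v k F - avg v k G"
  by (simp add: avg_def sum_subtractf diff_divide_distrib)

lemma avg_cmult: "avg v k (\<lambda>rs. c * F rs) = c * avg v k F"
  by (simp add: avg_def flip: sum_distrib_left)

lemma avg_divide: "avg v k (\<lambda>rs. F rs / c) = avg v k F / c"
  by (simp add: avg_def flip: sum_divide_distrib)

lemma avg_sum: "avg v k (\<lambda>rs. \<Sum>i\<in>I. F i rs) = (\<Sum>i\<in>I. avg v k (F i))"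
  unfolding avg_def by (subst sum.swap) (simp add: sum_divide_distrib)

lemma avg_append: "avg v (j + k) F = avg v j (\<lambda>a. avg v k (\<lambda>b. F (a @ b)))"
  by (induction j arbitrary: F) (simp_all add: avg_Suc)

lemma avg_take:
  assumes "j \<le> k"
  shows "avg v k (\<lambda>rs. F (take j rs)) = avg v j F"
proof -
  have "avg v (j + (k - j)) (\<lambda>rs. F (take j rs)) = avg v j F"
    unfolding avg_append by (rule avg_cong) (simp add: length_tuples)
  with assms show ?thesis by simp
qed

lemma avg_1: "avg v (Suc 0) F = (\<Sum>x\<in>bitstrings v. F [x]) / 2 ^ v"
  by (simp add: avg_Suc)

lemma avg_pos:
  assumes "\<And>rs. rs \<in> tuples v k \<Longrightarrow> 0 < F rs"
  shows "0 < avg v k F"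
  using assms tuples_replicate[of k v True] by (auto simp: avg_def intro!: divide_pos_pos sum_pos)

text \<open>Jensen's inequality for the logarithm. The tangent bound \<open>ln z \<le> z - 1\<close>
  is used at \<open>z = F rs / ?A\<close>, where its right-hand side averages to 0.\<close>

lemma avg_log_le:
  assumes "\<And>rs. rs \<in> tuples v k \<Longrightarrow> 0 < F rs"
  shows "avg v k (\<lambda>rs. log 2 (F rs)) \<le> log 2 (avg v k F)"
proof -
  let ?A = "avg v k F"
  have A: "0 < ?A" using assms by (rule avg_pos)
  have "ln (F rs) \<le> ln ?A + (F rs / ?A - 1)" if "rs \<in> tuples v k" for rs
    using ln_le_minus_one[of "F rs / ?A"] assms[OF that] A by (simp add: ln_div)
  then have "avg v k (\<lambda>rs. ln (F rs)) \<le> avg v k (\<lambda>rs. ln ?A + (F rs / ?A - 1))"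
    by (rule avg_mono)
  also have "\<dots> = ln ?A"
    using A by (simp add: avg_plus avg_minus avg_divide)
  finally show ?thesis
    by (simp add: log_def avg_divide divide_right_mono)
qed

subsection \<open>Hitting probabilities\<close>

text \<open>\<open>Z a\<close> stands for the last of the output blocks produced from the input blocks \<open>a\<close>.\<close>

definition hit :: "nat \<Rightarrow> (bool list list \<Rightarrow> 'b) \<Rightarrow> bool list list \<Rightarrow> 'b \<Rightarrow> real" where
  "hit v Z a b = real (card {x \<in> bitstrings v. Z (a @ [x]) = b}) / 2 ^ v"

lemma hit_le_1: "hit v Z a b \<le> 1"
proof -
  have "card {x \<in> bitstrings v. Z (a @ [x]) = b} \<le> 2 ^ v"
    using card_mono[of "bitstrings v" "{x \<in> bitstrings v. Z (a @ [x]) = b}"] by auto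
  then have "real (card {x \<in> bitstrings v. Z (a @ [x]) = b}) \<le> 2 ^ v"
    by (metis of_nat_le_iff of_nat_numeral of_nat_power)
  then show ?thesis by (simp add: hit_def)
qed

lemma hit_pos: "x \<in> bitstrings v \<Longrightarrow> 0 < hit v Z a (Z (a @ [x]))"
  unfolding hit_def by (intro divide_pos_pos) (auto simp: card_gt_0_iff)

text \<open>Each attained value occurs with its hitting probability and is weighted by the
  reciprocal, so it contributes exactly 1.\<close>

lemma avg_inverse_hit:
  "avg v (Suc 0) (\<lambda>r. 1 / hit v Z a (Z (a @ r))) = card ((\<lambda>x. Z (a @ [x])) ` bitstrings v)"
proof -
  let ?B = "bitstrings v" and ?g = "\<lambda>x. Z (a @ [x])"
  have "(\<Sum>x\<in>?B. 1 / hit v Z a (?g x)) = (\<Sum>b\<in>?g ` ?B. \<Sum>x\<in>{x\<in>?B. ?g x = b}. 1 / hit v Z a (?g x))"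
    by (rule sum.image_gen) simp
  also have "\<dots> = (\<Sum>b\<in>?g ` ?B. 2 ^ v)"
  proof (rule sum.cong[OF refl])
    fix b assume b: "b \<in> ?g ` ?B"
    then have "card {x\<in>?B. ?g x = b} \<noteq> 0" by (auto simp: card_eq_0_iff)
    then show "(\<Sum>x\<in>{x\<in>?B. ?g x = b}. 1 / hit v Z a (?g x)) = 2 ^ v"
      by (simp add: hit_def)
  qed
  finally show ?thesis by (simp add: avg_1)
qed

text \<open>The left-hand side is a Shannon entropy; the bound is the logarithm of the size of the
  support.\<close>

lemma avg_log_inverse_hit:
  "avg v (Suc 0) (\<lambda>r. log 2 (1 / hit v Z a (Z (a @ r)))) \<le> log 2 (card ((\<lambda>x. Z (a @ [x])) ` bitstrings v))"
proof -
  have "0 < 1 / hit v Z a (Z (a @ r))" if "r \<in> tuples v (Suc 0)" for r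
    using that hit_pos by (auto simp: tuples_Suc)
  then have "avg v (Suc 0) (\<lambda>r. log 2 (1 / hit v Z a (Z (a @ r)))) \<le> log 2 (avg v (Suc 0) (\<lambda>r. 1 / hit v Z a (Z (a @ r))))"
    by (rule avg_log_le)
  then show ?thesis by (simp only: avg_inverse_hit)
qed

subsection \<open>Block-by-block search\<close>

text \<open>All positions draw on one common list of tries, just as the program reads its coins; no
  position has a quota of its own.\<close>

primrec climb ::
  "nat \<Rightarrow> (bool list list \<Rightarrow> 'b) \<Rightarrow> (nat \<Rightarrow> 'b) \<Rightarrow> bool list list \<Rightarrow> bool list list \<Rightarrow> bool list list"
where
  "climb m Z w a [] = a"
| "climb m Z w a (r # rs) =
     climb m Z w (if length a < m \<and> Z (a @ [r]) = w (length a) then a @ [r] else a) rs"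

definition climb_prob ::
  "nat \<Rightarrow> nat \<Rightarrow> (bool list list \<Rightarrow> 'b) \<Rightarrow> (nat \<Rightarrow> 'b) \<Rightarrow> nat \<Rightarrow> bool list list \<Rightarrow> real" where
  "climb_prob v m Z w N a = avg v N (\<lambda>rs. of_bool (length (climb m Z w a rs) = m))"

text \<open>\<open>p * geom K p\<close> is the probability of a hit within \<open>K\<close> tries, so \<open>geom K p\<close> is the factor by which
  \<open>K\<close> tries raise the probability of every single hitting block.\<close>

definition geom :: "nat \<Rightarrow> real \<Rightarrow> real" where
  "geom K p = (\<Sum>j<K. (1 - p) ^ j)"

lemma climb_full: "length a = m \<Longrightarrow> climb m Z w a rs = a"
  by (induction rs) auto

lemma climb_append: "climb m Z w a (rs @ rs') = climb m Z w (climb m Z w a rs) rs'"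
  by (induction rs arbitrary: a) auto

text \<open>Further tries do no harm, since a complete tuple is never changed again.\<close>

lemma climb_prob_mono: "climb_prob v m Z w N a \<le> climb_prob v m Z w (N + K) a"
  unfolding climb_prob_def avg_append
proof (rule avg_mono)
  fix rs
  have "of_bool (length (climb m Z w a rs) = m) = avg v K (\<lambda>_. of_bool (length (climb m Z w a rs) = m))"
    by simp
  also have "\<dots> \<le> avg v K (\<lambda>b. of_bool (length (climb m Z w a (rs @ b)) = m))"
    by (rule avg_mono) (auto simp: climb_append climb_full)
  finally show "of_bool (length (climb m Z w a rs) = m) \<le> avg v K (\<lambda>b. of_bool (length (climb m Z w a (rs @ b)) = m))" .
qed

lemma climb_prob_nonneg: "0 \<le> climb_prob v m Z w N a"
  unfolding climb_prob_def by (simp add: avg_def sum_nonneg)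

lemma climb_prob_Suc:
  assumes "length a < m"
  shows "climb_prob v m Z w (Suc N) a =
    (\<Sum>x\<in>bitstrings v. of_bool (Z (a @ [x]) = w (length a)) * climb_prob v m Z w N (a @ [x])) / 2 ^ v
    + (1 - hit v Z a (w (length a))) * climb_prob v m Z w N a"
proof -
  let ?P = "\<lambda>x. Z (a @ [x]) = w (length a)"
  have "(\<Sum>x\<in>bitstrings v. of_bool (\<not> ?P x)) = (2 ^ v :: real) - card {x \<in> bitstrings v. ?P x}"
  proof -
    have "(\<Sum>x\<in>bitstrings v. of_bool (\<not> ?P x)) = (\<Sum>x\<in>bitstrings v. 1 - of_bool (?P x) :: real)"
      by (rule sum.cong) auto
    also have "\<dots> = 2 ^ v - (\<Sum>x\<in>bitstrings v. of_bool (?P x))"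
      by (simp add: sum_subtractf)
    also have "(\<Sum>x\<in>bitstrings v. of_bool (?P x)) = (card {x \<in> bitstrings v. ?P x} :: real)"
      by (subst sum_of_bool_eq) (auto intro!: arg_cong[where f = card])
    finally show ?thesis .
  qed
  then have neg: "(\<Sum>x\<in>bitstrings v. of_bool (\<not> ?P x)) / 2 ^ v = 1 - hit v Z a (w (length a))"
    by (simp add: hit_def diff_divide_distrib)
  have "climb_prob v m Z w (Suc N) a = (\<Sum>x\<in>bitstrings v. if ?P x then climb_prob v m Z w N (a @ [x]) else climb_prob v m Z w N a) / 2 ^ v"
    using assms by (auto simp: climb_prob_def avg_Suc intro!: sum.cong arg_cong2[where f = divide])
  also have "(\<Sum>x\<in>bitstrings v. if ?P x then climb_prob v m Z w N (a @ [x]) else climb_prob v m Z w N a)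
     = (\<Sum>x\<in>bitstrings v. of_bool (?P x) * climb_prob v m Z w N (a @ [x])) + (\<Sum>x\<in>bitstrings v. of_bool (\<not> ?P x) * climb_prob v m Z w N a)"
    unfolding sum.distrib[symmetric] by (rule sum.cong) auto
  also have "(\<Sum>x\<in>bitstrings v. of_bool (\<not> ?P x) * climb_prob v m Z w N a) = (\<Sum>x\<in>bitstrings v. of_bool (\<not> ?P x)) * climb_prob v m Z w N a"
    by (simp add: sum_distrib_right)
  finally show ?thesis
    using neg by (simp add: add_divide_distrib flip: times_divide_eq_left)
qed

lemma geom_Suc: "geom (Suc K) p = 1 + (1 - p) * geom K p"
  unfolding geom_def sum.lessThan_Suc_shift sum_distrib_left by simp

lemma geom_nonneg: "p \<le> 1 \<Longrightarrow> 0 \<le> geom K p"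
  by (simp add: geom_def sum_nonneg)

text \<open>Condition on the first of the tries. A hit moves on with at least \<open>N\<close> tries
  left, by monotonicity; a miss leaves the induction hypothesis. The two cases add up to the
  recursion \<open>geom_Suc\<close>.\<close>

lemma climb_prob_step:
  assumes "length a < m"
  shows "(\<Sum>x\<in>bitstrings v. of_bool (Z (a @ [x]) = w (length a)) * geom K (hit v Z a (w (length a)))
      * climb_prob v m Z w N (a @ [x])) / 2 ^ v \<le> climb_prob v m Z w (K + N) a"
proof (induction K)
  case 0
  show ?case by (simp add: geom_def climb_prob_nonneg)
next
  case (Suc K)
  let ?P = "\<lambda>x. of_bool (Z (a @ [x]) = w (length a))" and ?p = "hit v Z a (w (length a))"
  let ?S = "\<lambda>N. (\<Sum>x\<in>bitstrings v. ?P x * climb_prob v m Z w N (a @ [x])) / 2 ^ v"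
  have eq: "(\<Sum>x\<in>bitstrings v. ?P x * geom K ?p * climb_prob v m Z w N (a @ [x])) / 2 ^ v = geom K ?p * ?S N" for K
    by (simp only: sum_distrib_left times_divide_eq_right mult_ac)
  have "?S N \<le> ?S (K + N)"
    using climb_prob_mono[of v m Z w N _ K] by (intro divide_right_mono sum_mono mult_left_mono) (auto simp: add.commute)
  moreover have "(1 - ?p) * (geom K ?p * ?S N) \<le> (1 - ?p) * climb_prob v m Z w (K + N) a"
    using Suc.IH hit_le_1[of v Z a] unfolding eq by (intro mult_left_mono) auto
  ultimately have "?S N + (1 - ?p) * (geom K ?p * ?S N) \<le> ?S (K + N) + (1 - ?p) * climb_prob v m Z w (K + N) a"
    by (rule add_mono)
  also have "?S N + (1 - ?p) * (geom K ?p * ?S N) = geom (Suc K) ?p * ?S N"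
    by (simp only: geom_Suc distrib_right mult_1_left mult.assoc)
  finally show ?case
    unfolding eq add_Suc climb_prob_Suc[OF assms] .
qed

text \<open>Reserving \<open>K\<close> tries for each position gives a lower bound on the pooled
  search. It is written as a change of measure: an average over random tuples, where a tuple that
  hits all targets is reweighted by its \<open>geom\<close> factors.\<close>

lemma climb_prob_ge:
  assumes "length a + k = m"
  shows "avg v k (\<lambda>r. \<Prod>i<k. of_bool (Z (a @ take (Suc i) r) = w (length a + i)) *
      geom K (hit v Z (a @ take i r) (w (length a + i)))) \<le> climb_prob v m Z w (k * K) a"
  using assms
proof (induction k arbitrary: a)
  case 0
  then show ?case by (simp add: climb_prob_def)
next
  case (Suc k)
  let ?p = "hit v Z a (w (length a))"
  let ?F = "\<lambda>a r. \<Prod>i<k. of_bool (Z (a @ take (Suc i) r) = w (length a + i)) *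
      geom K (hit v Z (a @ take i r) (w (length a + i)))"
  have "avg v (Suc k) (\<lambda>r. \<Prod>i<Suc k. of_bool (Z (a @ take (Suc i) r) = w (length a + i)) *
      geom K (hit v Z (a @ take i r) (w (length a + i))))
    = (\<Sum>x\<in>bitstrings v. of_bool (Z (a @ [x]) = w (length a)) * geom K ?p * avg v k (?F (a @ [x]))) / 2 ^ v"
    unfolding avg_Suc prod.lessThan_Suc_shift avg_cmult[symmetric] by simp
  also have "\<dots> \<le> (\<Sum>x\<in>bitstrings v. of_bool (Z (a @ [x]) = w (length a)) * geom K ?p
      * climb_prob v m Z w (k * K) (a @ [x])) / 2 ^ v"
    using Suc.IH[of "a @ [_]"] Suc.prems geom_nonneg[OF hit_le_1]
    by (intro divide_right_mono sum_mono mult_left_mono) auto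
  also have "\<dots> \<le> climb_prob v m Z w (K + k * K) a"
    using Suc.prems by (intro climb_prob_step) simp
  finally show ?case by simp
qed

lemma geom_times: "geom K p * p = 1 - (1 - p) ^ K"
  by (induction K) (simp_all add: geom_def algebra_simps)

text \<open>Bernoulli's inequality yields \<open>(1 - p) ^ K \<le> 1 / (1 + K * p)\<close>, hence at
  least \<open>K * p / (1 + K * p)\<close> for a hit within \<open>K\<close> tries, good for small
  and large \<open>K * p\<close> alike.\<close>

lemma geom_ge:
  assumes "0 < p" "p \<le> 1"
  shows "K / (1 + K * p) \<le> geom K p"
proof -
  have "(1 - p) ^ K * (1 + K * p) \<le> (1 - p) ^ K * (1 + p) ^ K"
    using assms Bernoulli_inequality[of p K] by (intro mult_left_mono) auto
  also have "\<dots> = (1 - p\<^sup>2) ^ K"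
    by (simp add: power_mult_distrib[symmetric] algebra_simps power2_eq_square)
  also have "\<dots> \<le> 1"
    using assms by (intro power_le_one) (auto simp: power_le_one)
  finally have "K * p \<le> (1 - (1 - p) ^ K) * (1 + K * p)"
    by (simp add: algebra_simps)
  then have "K * p \<le> (geom K p * (1 + K * p)) * p"
    by (simp add: geom_times[symmetric] mult_ac)
  then have "K \<le> geom K p * (1 + K * p)"
    using assms by simp
  moreover have "0 < 1 + K * p" using assms by (simp add: add_pos_nonneg)
  ultimately show ?thesis by (simp add: pos_divide_le_eq)
qed

text \<open>Unlimited tries would give the factor \<open>1 / p\<close>. The deficit is stated as a
  multiple of \<open>1 / p\<close> because \<open>avg_inverse_hit\<close> evaluates its
  mean.\<close>

lemma log_geom_ge:
  assumes "0 < p" "p \<le> 1" "0 < K"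
  shows "log 2 (1 / p) - 1 / p / (K * ln 2) \<le> log 2 (geom K p)"
proof -
  have K: "0 < K * p" using assms by simp
  have "ln (1 + 1 / (K * p)) \<le> 1 / (K * p)"
    using K by (intro ln_add_one_self_le_self) simp
  moreover have "K / (1 + K * p) = (1 / p) / (1 + 1 / (K * p))"
    using assms K by (simp add: field_simps)
  moreover have "0 < 1 + 1 / (K * p)" using K by (intro add_pos_pos) auto
  ultimately have "ln (1 / p) - 1 / (K * p) \<le> ln (K / (1 + K * p))"
    using assms(1) by (simp only: ln_divide_pos[of "1 / p"] zero_less_divide_1_iff)
  also have "\<dots> \<le> ln (geom K p)"
  proof -
    have "0 < K / (1 + K * p)"
      using assms K by (intro divide_pos_pos add_pos_pos) auto
    then show ?thesis
      using geom_ge[OF assms(1,2), of K] by (subst ln_le_cancel_iff) auto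
  qed
  finally have "(ln (1 / p) - 1 / (K * p)) / ln 2 \<le> ln (geom K p) / ln 2"
    by (rule divide_right_mono) simp
  then show ?thesis by (simp add: log_def diff_divide_distrib mult_ac)
qed


text \<open>Exchange the sum over the secrets \<open>x\<close> with the average over transcripts: a
  transcript \<open>r\<close> counts for precisely the \<open>x\<close> whose target blocks it
  produces, always with the same factor. This bounds the success below by the mean of
  \<open>card (pre r) / 2 ^ n\<close> times a product of \<open>geom\<close> factors, and Jensen's
  inequality turns the logarithm of the mean into a mean of sums.\<close>

theorem log_climb_prob_ge:
  fixes Z :: "bool list list \<Rightarrow> bool list" and w :: "bool list \<Rightarrow> nat \<Rightarrow> bool list"
  assumes consistent: "\<And>rs i. rs \<in> tuples v (Suc m) \<Longrightarrow> i < m \<Longrightarrow> w (Z rs) i = Z (take (Suc i) rs)"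
    and last: "\<And>rs. rs \<in> tuples v (Suc m) \<Longrightarrow> Z rs \<in> bitstrings n"
    and blocks: "\<And>x i. x \<in> bitstrings n \<Longrightarrow> i < m \<Longrightarrow> w x i \<in> bitstrings l"
    and "0 < K"
  shows "0 < (\<Sum>x\<in>bitstrings n. climb_prob v m Z (w x) (m * K) []) / 2 ^ n" (is "0 < ?S")
    and "avg v (Suc m) (\<lambda>rs. \<Sum>i<Suc m. log 2 (1 / hit v Z (take i rs) (Z (take (Suc i) rs))))
      - n - m * 2 ^ l / (K * ln 2)
    \<le> log 2 ((\<Sum>x\<in>bitstrings n. climb_prob v m Z (w x) (m * K) []) / 2 ^ n)" (is "?lhs \<le> _")
proof -
  \<comment> \<open>For \<open>Gf\<close> this is the set of preimages of the value whose pieces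
    \<open>r\<close> produces.\<close>
  define pre where "pre r = {x \<in> bitstrings n. \<forall>i<m. Z (take (Suc i) r) = w x i}" for r
  define p where "p i r = hit v Z (take i r) (Z (take (Suc i) r))" for i r
  have fin: "finite (pre r)" for r
    by (simp add: pre_def)
  have Z_pre: "Z (r @ [x]) \<in> pre r" if "r \<in> tuples v m" "x \<in> bitstrings v" for r x
  proof -
    have rx: "r @ [x] \<in> tuples v (Suc m)"
      using tuples_append[OF that(1) tuples_singleton[OF that(2)]] by simp
    show ?thesis
      using last[OF rx] consistent[OF rx] length_tuples[OF that(1)] by (auto simp: pre_def)
  qed
  \<comment> \<open>Consistency puts the generator's own last block into the set, so its logarithm
    can be taken.\<close>
  have card_pre: "0 < card (pre r)" if "r \<in> tuples v m" for r
  proof -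
    obtain x where "x \<in> bitstrings v" using bitstrings_nonempty by blast
    then show ?thesis using Z_pre[OF that] fin by (auto simp: card_gt_0_iff)
  qed
  \<comment> \<open>Consistency speaks of complete tuples only, so the prefix is completed by zero
    blocks.\<close>
  have Z_block: "Z (a @ [x]) \<in> bitstrings l" if "a \<in> tuples v i" "i < m" "x \<in> bitstrings v" for a x i
  proof -
    have "(a @ [x]) @ replicate (m - i) (replicate v False) \<in> tuples v (i + Suc 0 + (m - i))"
      by (intro tuples_append that tuples_singleton tuples_replicate)
    then have *: "(a @ [x]) @ replicate (m - i) (replicate v False) \<in> tuples v (Suc m)"
      using that(2) by simp
    have "Z (a @ [x]) = w (Z ((a @ [x]) @ replicate (m - i) (replicate v False))) i"
      using consistent[OF * that(2)] length_tuples[OF that(1)] by simp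
    then show ?thesis using blocks[OF last[OF *] that(2)] by simp
  qed
  have p_snoc: "p i (a @ b) = hit v Z a (Z (a @ b))" if "a \<in> tuples v i" "b \<in> tuples v (Suc 0)" for i a b
    using length_tuples[OF that(1)] length_tuples[OF that(2)] by (simp add: p_def)
  have p: "0 < p i r" "p i r \<le> 1" if "r \<in> tuples v k" "i < k" for i r k
  proof -
    have "take (Suc i) r = take i r @ [r ! i]" "r ! i \<in> bitstrings v"
      using that by (auto simp: tuples_def take_Suc_conv_app_nth dest: nth_mem)
    then show "0 < p i r" by (simp add: p_def hit_pos)
  qed (simp add: p_def hit_le_1)
  \<comment> \<open>Given the earlier input blocks, block \<open>i\<close> takes at most
    \<open>2 ^ l\<close> values.\<close>
  have inv_p: "avg v m (\<lambda>r. 1 / p i r) \<le> 2 ^ l" if i: "i < m" for i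
  proof -
    have "avg v m (\<lambda>r. 1 / p i r) = avg v m (\<lambda>r. 1 / p i (take (Suc i) r))"
      by (simp add: p_def min_def)
    also have "\<dots> = avg v (i + Suc 0) (\<lambda>r. 1 / p i r)"
      using i by (subst avg_take) simp_all
    also have "\<dots> = avg v i (\<lambda>a. avg v (Suc 0) (\<lambda>b. 1 / hit v Z a (Z (a @ b))))"
      unfolding avg_append by (intro avg_cong) (simp add: p_snoc)
    also have "\<dots> \<le> avg v i (\<lambda>a. 2 ^ l)"
    proof (rule avg_mono)
      fix a assume a: "a \<in> tuples v i"
      have "card ((\<lambda>x. Z (a @ [x])) ` bitstrings v) \<le> card (bitstrings l)"
        using Z_block[OF a i] by (intro card_mono) auto
      then have "real (card ((\<lambda>x. Z (a @ [x])) ` bitstrings v)) \<le> real (2 ^ l)"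
        by (subst of_nat_le_iff) simp
      then show "avg v (Suc 0) (\<lambda>b. 1 / hit v Z a (Z (a @ b))) \<le> 2 ^ l"
        by (simp only: avg_inverse_hit) simp
    qed
    finally show ?thesis by simp
  qed
  let ?W = "\<lambda>x r. \<Prod>i<m. of_bool (Z (take (Suc i) r) = w x i) * geom K (hit v Z (take i r) (w x i))"
  let ?G = "\<lambda>r. real (card (pre r)) / 2 ^ n * (\<Prod>i<m. geom K (p i r))"
  \<comment> \<open>Outside \<open>pre r\<close> some indicator vanishes; inside, all targets equal
    the produced blocks and the factors no longer depend on \<open>x\<close>.\<close>
  have W: "?W x r = of_bool (x \<in> pre r) * (\<Prod>i<m. geom K (p i r))" if "x \<in> bitstrings n" for x r
  proof (cases "x \<in> pre r")
    case True
    then show ?thesis by (auto simp: pre_def p_def intro!: prod.cong)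
  next
    case False
    with that obtain i where "i < m" "Z (take (Suc i) r) \<noteq> w x i" by (auto simp: pre_def)
    then have "?W x r = 0" by (intro prod_zero) auto
    with False show ?thesis by simp
  qed
  have geom_pos: "0 < geom K (p i r)" if "r \<in> tuples v m" "i < m" for i r
    using p[OF that] \<open>0 < K\<close>
    by (intro less_le_trans[OF _ geom_ge] divide_pos_pos add_pos_pos) auto
  have G_pos: "0 < ?G r" if "r \<in> tuples v m" for r
    using geom_pos[OF that] card_pre[OF that] by (intro mult_pos_pos divide_pos_pos prod_pos) auto
  have "avg v m ?G = (\<Sum>x\<in>bitstrings n. avg v m (?W x)) / 2 ^ n"
  proof -
    have "(\<Sum>x\<in>bitstrings n. ?W x r) = real (card (pre r)) * (\<Prod>i<m. geom K (p i r))" for r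
    proof -
      have "(\<Sum>x\<in>bitstrings n. ?W x r) = (\<Sum>x\<in>bitstrings n. of_bool (x \<in> pre r) * (\<Prod>i<m. geom K (p i r)))"
        by (rule sum.cong[OF refl W])
      also have "\<dots> = (\<Sum>x\<in>bitstrings n. of_bool (x \<in> pre r)) * (\<Prod>i<m. geom K (p i r))"
        by (simp only: sum_distrib_right)
      also have "(\<Sum>x\<in>bitstrings n. of_bool (x \<in> pre r)) = real (card (pre r))"
        by (subst sum_of_bool_eq) (auto simp: pre_def intro!: arg_cong[where f = card])
      finally show ?thesis .
    qed
    then show ?thesis by (simp add: avg_sum[symmetric] avg_divide[symmetric] del: prod.lessThan_Suc)
  qed
  also have "\<dots> \<le> (\<Sum>x\<in>bitstrings n. climb_prob v m Z (w x) (m * K) []) / 2 ^ n"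
    using climb_prob_ge[of "[]" m m v Z _ K] by (intro divide_right_mono sum_mono) auto
  finally have le: "avg v m ?G \<le> ?S" .
  have G: "0 < avg v m ?G" using G_pos by (rule avg_pos)
  with le show S: "0 < ?S" by linarith
  have upper: "log 2 (avg v m ?G) \<le> log 2 ?S"
    using le G S by (subst log_le_cancel_iff) simp_all
  have "?lhs \<le> avg v m (\<lambda>r. log 2 (card (pre r)) - n + (\<Sum>i<m. log 2 (1 / p i r) - 1 / p i r / (K * ln 2)))"
  proof -
    have 1: "avg v (Suc m) (\<lambda>rs. \<Sum>i<m. log 2 (1 / p i rs)) = avg v m (\<lambda>r. \<Sum>i<m. log 2 (1 / p i r))"
    proof -
      have "(\<Sum>i<m. log 2 (1 / p i rs)) = (\<Sum>i<m. log 2 (1 / p i (take m rs)))" for rs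
        by (rule sum.cong) (auto simp: p_def min_def)
      then have "avg v (Suc m) (\<lambda>rs. \<Sum>i<m. log 2 (1 / p i rs)) = avg v (Suc m) (\<lambda>rs. \<Sum>i<m. log 2 (1 / p i (take m rs)))"
        by (rule avg_cong)
      also have "\<dots> = avg v m (\<lambda>r. \<Sum>i<m. log 2 (1 / p i r))"
        by (rule avg_take) simp
      finally show ?thesis .
    qed
    \<comment> \<open>The last block stays inside \<open>pre a\<close>, so its entropy is at most
      the logarithm of the size. The factor \<open>card (pre r)\<close> of the success bound pays
      for exactly this amount.\<close>
    have "avg v (m + Suc 0) (\<lambda>rs. log 2 (1 / p m rs))
        = avg v m (\<lambda>a. avg v (Suc 0) (\<lambda>b. log 2 (1 / hit v Z a (Z (a @ b)))))"
      unfolding avg_append by (intro avg_cong) (simp add: p_snoc)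
    also have "\<dots> \<le> avg v m (\<lambda>a. log 2 (card (pre a)))"
    proof (rule avg_mono)
      fix a assume a: "a \<in> tuples v m"
      have "card ((\<lambda>x. Z (a @ [x])) ` bitstrings v) \<le> card (pre a)"
        using Z_pre[OF a] fin by (intro card_mono) auto
      moreover have "0 < card ((\<lambda>x. Z (a @ [x])) ` bitstrings v)"
        by (simp add: card_gt_0_iff)
      ultimately have "log 2 (card ((\<lambda>x. Z (a @ [x])) ` bitstrings v)) \<le> log 2 (card (pre a))"
        by (subst log_le_cancel_iff) auto
      then show "avg v (Suc 0) (\<lambda>b. log 2 (1 / hit v Z a (Z (a @ b)))) \<le> log 2 (card (pre a))"
        using avg_log_inverse_hit order_trans by blast
    qed
    finally have 2: "avg v (Suc m) (\<lambda>rs. log 2 (1 / p m rs)) \<le> avg v m (\<lambda>a. log 2 (card (pre a)))"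
      by simp
    have 3: "avg v m (\<lambda>r. \<Sum>i<m. 1 / p i r / (K * ln 2)) \<le> real m * 2 ^ l / (K * ln 2)"
    proof -
      have "avg v m (\<lambda>r. \<Sum>i<m. 1 / p i r / (K * ln 2)) = (\<Sum>i<m. avg v m (\<lambda>r. 1 / p i r) / (K * ln 2))"
        by (simp only: avg_sum avg_divide)
      also have "\<dots> \<le> (\<Sum>i<m. 2 ^ l / (K * ln 2))"
        using inv_p by (intro sum_mono divide_right_mono) auto
      finally show ?thesis by simp
    qed
    have "?lhs = avg v m (\<lambda>r. \<Sum>i<m. log 2 (1 / p i r)) + avg v (Suc m) (\<lambda>rs. log 2 (1 / p m rs))
        - n - real m * 2 ^ l / (K * ln 2)"
      unfolding p_def[symmetric] sum.lessThan_Suc avg_plus 1 ..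
    also have "\<dots> \<le> avg v m (\<lambda>r. \<Sum>i<m. log 2 (1 / p i r)) + avg v m (\<lambda>a. log 2 (card (pre a)))
        - n - avg v m (\<lambda>r. \<Sum>i<m. 1 / p i r / (K * ln 2))"
      using 2 3 by linarith
    also have "\<dots> = avg v m (\<lambda>r. log 2 (card (pre r)) - n + (\<Sum>i<m. log 2 (1 / p i r) - 1 / p i r / (K * ln 2)))"
      by (simp only: sum_subtractf avg_plus avg_minus avg_const)
    finally show ?thesis .
  qed
  also have "\<dots> \<le> avg v m (\<lambda>r. log 2 (?G r))"
  proof (rule avg_mono)
    fix r assume r: "r \<in> tuples v m"
    have "(\<Sum>i<m. log 2 (1 / p i r) - 1 / p i r / (K * ln 2)) \<le> (\<Sum>i<m. log 2 (geom K (p i r)))"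
      using p[OF r] \<open>0 < K\<close> by (intro sum_mono log_geom_ge) auto
    also have "\<dots> = log 2 (\<Prod>i<m. geom K (p i r))"
      unfolding log_def by (subst ln_prod) (use geom_pos[OF r] in \<open>auto simp: sum_divide_distrib less_imp_neq[symmetric]\<close>)
    moreover have "log 2 (?G r) = log 2 (card (pre r)) - n + log 2 (\<Prod>i<m. geom K (p i r))"
    proof -
      have "0 < (\<Prod>i<m. geom K (p i r))" using geom_pos[OF r] by (intro prod_pos) auto
      moreover have "0 < real (card (pre r)) / 2 ^ n" using card_pre[OF r] by simp
      ultimately have "log 2 (?G r) = log 2 (real (card (pre r)) / 2 ^ n) + log 2 (\<Prod>i<m. geom K (p i r))"
        by (simp only: log_mult_pos)
      then show ?thesis using card_pre[OF r] by (simp add: log_divide_pos log_nat_power)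
    qed
    ultimately show "log 2 (card (pre r)) - n + (\<Sum>i<m. log 2 (1 / p i r) - 1 / p i r / (K * ln 2)) \<le> log 2 (?G r)"
      by linarith
  qed
  also have "\<dots> \<le> log 2 (avg v m ?G)"
    by (rule avg_log_le[OF G_pos])
  finally show "?lhs \<le> log 2 ?S" using upper by linarith
qed

section \<open>The inverter as a program\<close>

text \<open>Stack 0 holds the unread coins and stack 1 is the output. The other stacks of the inverter are:
  2 the string \<open>1\<^sup>n\<close>; 3 the challenge \<open>y\<close>; 4 the block length \<open>v\<close> in unary; 5 one more than the number
  of accepted blocks, in unary; 6 the accepted blocks, reversed; 7 all-zero blocks for the input
  positions after the current one, reversed; 8, 9, 10 scratch space; 11 one symbol per mismatch;
  12 nonempty until a preimage is found. The stacks of the generator start at 13, so its input is on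
  13 and its output on 14.\<close>

lemma replicate_1 [simp]: "replicate 1 a = [a]"
  by (simp add: One_nat_def)

section \<open>Decoding self-delimiting numbers into unary\<close>

definition read_number :: "nat \<Rightarrow> program" where
  "read_number i =
     Seq (Loop 0 {Some (Bit True)}
           (Seq (Pop 0)
           (Seq (move_stack i 8)
           (Seq (Loop 8 (- {None}) (Seq (Pop 8) (Seq (Push i (Bit False)) (Push i (Bit False)))))
           (Seq (Branch 0 {Some (Bit True)} (Push i (Bit False)) Skip)
                (Pop 0))))))
       (Pop 0)"

fun digit_code :: "nat \<Rightarrow> bool list" where
  "digit_code x = (if x = 0 then [] else digit_code (x div 2) @ [True, odd x])"

declare digit_code.simps [simp del]

text \<open>Binary digits, each preceded by a continuation flag: a self-delimiting code of logarithmic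
  length, so that uniform coins encode any given number with noticeable probability.\<close>

definition number_code :: "nat \<Rightarrow> bool list" where
  "number_code x = digit_code x @ [False]"

text \<open>Each binary digit takes two coins, hence the square.\<close>

lemma length_digit_code: "0 < x \<Longrightarrow> (2::nat) ^ length (digit_code x) \<le> 4 * x\<^sup>2"
proof (induction x rule: digit_code.induct)
  case (1 x)
  show ?case
  proof (cases "x div 2 = 0")
    case True
    then have "digit_code (x div 2) = []" by (simp add: digit_code.simps)
    then show ?thesis using 1(2) by (subst digit_code.simps) simp
  next
    case False
    then have "(2::nat) ^ length (digit_code (x div 2)) \<le> 4 * (x div 2)\<^sup>2" using 1 by simp
    moreover have "(2 * (x div 2))\<^sup>2 \<le> x\<^sup>2" by (intro power_mono) auto
    ultimately show ?thesis using 1(2) by (subst digit_code.simps) (simp add: power_mult_distrib)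
  qed
qed

lemma length_digit_code_le: "length (digit_code x) \<le> 2 * x"
proof (induction x rule: digit_code.induct)
  case (1 x)
  moreover have "2 * (x div 2) + 2 \<le> 2 * x" if "x \<noteq> 0" using that by presburger
  ultimately show ?case by (subst digit_code.simps) force
qed

lemma two_power_length_number_code: "(2::nat) ^ length (number_code x) \<le> 8 * (x + 1)\<^sup>2"
proof (cases "x = 0")
  case True
  then show ?thesis by (simp add: number_code_def digit_code.simps)
next
  case False
  have "x\<^sup>2 \<le> (x + 1)\<^sup>2" by (intro power_mono) auto
  moreover have "(2::nat) ^ length (number_code x) = 2 * 2 ^ length (digit_code x)"
    by (simp add: number_code_def)
  ultimately show ?thesis using False length_digit_code[of x] by linarith
qed

lemma runs_double:
  assumes "i \<noteq> 8"
  shows "runs (Loop 8 (- {None}) (Seq (Pop 8) (Seq (Push i a) (Push i a)))) s (4 * length (s 8) + 1)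
     (s(8 := [], i := replicate (2 * length (s 8)) a @ s i))"
proof (induction "s 8" arbitrary: s)
  case Nil
  then have "s(8 := [], i := replicate (2 * length (s 8)) a @ s i) = s" by (auto simp: fun_eq_iff)
  with Nil show ?case
    using runs_LoopF[of s 8 "- {None}"] by (simp del: fun_upd_apply)
next
  case (Cons b w)
  note s8 = Cons.hyps(2)[symmetric]
  let ?s = "s(8 := w, i := a # a # s i)"
  have eq: "?s(8 := [], i := replicate (2 * length (?s 8)) a @ ?s i)
      = s(8 := [], i := replicate (2 * length (s 8)) a @ s i)"
    using s8 assms by (auto simp: fun_eq_iff replicate_app_Cons_same)
  have "runs (Pop 8) s 1 (s(8 := w))"
    by (rule runs_Pop_eq) (use s8 in \<open>auto simp: fun_eq_iff\<close>)
  moreover have "runs (Push i a) (s(8 := w)) 1 (s(8 := w, i := a # s i))"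
    by (rule runs_Push_eq) (use assms in \<open>auto simp: fun_eq_iff\<close>)
  moreover have "runs (Push i a) (s(8 := w, i := a # s i)) 1 ?s"
    by (rule runs_Push_eq) (use assms in \<open>auto simp: fun_eq_iff\<close>)
  ultimately have "runs (Seq (Pop 8) (Seq (Push i a) (Push i a))) s (1 + (1 + 1)) ?s"
    by (intro runs_Seq)
  then have body: "runs (Seq (Pop 8) (Seq (Push i a) (Push i a))) s 3 ?s"
    by (rule runs_mono) simp
  have rest: "runs (Loop 8 (- {None}) (Seq (Pop 8) (Seq (Push i a) (Push i a)))) ?s (4 * length (?s 8) + 1)
      (s(8 := [], i := replicate (2 * length (s 8)) a @ s i))"
    using Cons.hyps(1)[of ?s] assms unfolding eq by simp
  show ?case
    by (rule runs_LoopT_mono[OF _ body rest]) (use s8 assms in auto)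
qed

text \<open>One step of Horner's scheme in unary: doubling through stack 8, then adding the
  digit.\<close>

lemma runs_read_number_body:
  assumes "i \<noteq> 0" "i \<noteq> 8" "s 8 = []" "s 0 = Bit True # Bit b # cs" "s i = replicate x (Bit False)"
  shows "runs (Seq (Pop 0)
           (Seq (move_stack i 8)
           (Seq (Loop 8 (- {None}) (Seq (Pop 8) (Seq (Push i (Bit False)) (Push i (Bit False)))))
           (Seq (Branch 0 {Some (Bit True)} (Push i (Bit False)) Skip)
                (Pop 0))))) s (10 * x + 6) (s(0 := cs, i := replicate (2 * x + of_bool b) (Bit False)))"
proof -
  define s1 where "s1 = s(0 := Bit b # cs)"
  have 1: "runs (Pop 0) s 1 s1"
    by (rule runs_Pop_eq) (use assms in \<open>auto simp: s1_def fun_eq_iff\<close>)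
  define s2 where "s2 = s1(i := [], 8 := replicate x (Bit False))"
  have "s1(i := [], 8 := rev (s1 i) @ s1 8) = s2" using assms by (auto simp: s2_def s1_def fun_eq_iff)
  then have 2: "runs (move_stack i 8) s1 (6 * x + 1) s2"
    using runs_move_stack[of i 8 s1] assms by (simp add: s1_def del: fun_upd_apply add: fun_upd_other)
  define s3 where "s3 = s2(8 := [], i := replicate (2 * x) (Bit False))"
  have "s2(8 := [], i := replicate (2 * length (s2 8)) (Bit False) @ s2 i) = s3"
    using assms by (auto simp: s2_def s3_def fun_eq_iff)
  then have 3: "runs (Loop 8 (- {None}) (Seq (Pop 8) (Seq (Push i (Bit False)) (Push i (Bit False))))) s2 (4 * x + 1) s3"
    using runs_double[of i "Bit False" s2] assms by (simp add: s2_def del: fun_upd_apply add: fun_upd_same)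
  define s4 where "s4 = s3(i := replicate (2 * x + of_bool b) (Bit False))"
  have rep: "replicate (2 * x + 1) (Bit False) = Bit False # replicate (2 * x) (Bit False)"
    by (metis Suc_eq_plus1 replicate_Suc)
  have 4: "runs (Branch 0 {Some (Bit True)} (Push i (Bit False)) Skip) s3 (Suc 1) s4"
  proof (cases b)
    case True
    then show ?thesis using assms
      by (intro runs_BranchT runs_Push_eq) (auto simp: s4_def s3_def s2_def s1_def fun_eq_iff rep)
  next
    case False
    then have "s4 = s3" using assms by (auto simp: s4_def s3_def fun_eq_iff)
    moreover have "top_symbol (s3 0) \<notin> {Some (Bit True)}"
      using assms False by (simp add: s3_def s2_def s1_def)
    ultimately show ?thesis using runs_BranchF runs_Skip by metis
  qed
  have 5: "runs (Pop 0) s4 1 (s(0 := cs, i := replicate (2 * x + of_bool b) (Bit False)))"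
    by (rule runs_Pop_eq) (use assms in \<open>auto simp: s4_def s3_def s2_def s1_def fun_eq_iff\<close>)
  show ?thesis
    by (rule runs_mono[OF runs_Seq[OF 1 runs_Seq[OF 2 runs_Seq[OF 3 runs_Seq[OF 4 5]]]]]) simp
qed

text \<open>\<open>digit_code\<close> recurses on the leading digits, while the program reads them
  first. The run that continues with \<open>x\<close> already decoded is therefore a premise, and
  the induction puts digits in front of it.\<close>

lemma runs_read_digits:
  assumes "i \<noteq> 0" "i \<noteq> 8" "s 8 = []" "x \<le> X"
    and "runs (Loop 0 {Some (Bit True)} c) (s(0 := cs, i := replicate x (Bit False))) T s'"
    and "c = Seq (Pop 0)
           (Seq (move_stack i 8)
           (Seq (Loop 8 (- {None}) (Seq (Pop 8) (Seq (Push i (Bit False)) (Push i (Bit False)))))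
           (Seq (Branch 0 {Some (Bit True)} (Push i (Bit False)) Skip)
                (Pop 0))))"
  shows "runs (Loop 0 {Some (Bit True)} c) (s(0 := map Bit (digit_code x) @ cs, i := []))
     (x * (10 * X + 7) + T) s'"
  using assms(4,5)
proof (induction x arbitrary: cs T rule: digit_code.induct)
  case (1 x)
  show ?case
  proof (cases "x = 0")
    case True
    then show ?thesis using 1(3) by (simp add: digit_code.simps del: fun_upd_apply)
  next
    case False
    let ?s = "s(0 := Bit True # Bit (odd x) # cs, i := replicate (x div 2) (Bit False))"
    have "2 * (x div 2) + of_bool (odd x) = x"
      using mult_div_mod_eq[of 2 x] by (simp add: mod_2_eq_odd)
    then have eq: "?s(0 := cs, i := replicate (2 * (x div 2) + of_bool (odd x)) (Bit False))
        = s(0 := cs, i := replicate x (Bit False))"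
      using assms(1,2) by (auto simp: fun_eq_iff)
    have body: "runs c ?s (10 * (x div 2) + 6) (s(0 := cs, i := replicate x (Bit False)))"
      unfolding assms(6) eq[symmetric]
      by (rule runs_read_number_body) (use assms in auto)
    have "runs (Loop 0 {Some (Bit True)} c) ?s (10 * X + 7 + T) s'"
      by (rule runs_LoopT_mono[OF _ body 1(3)]) (use assms 1(2) in auto)
    from 1(1)[OF False _ this]
    have r: "runs (Loop 0 {Some (Bit True)} c) (s(0 := map Bit (digit_code (x div 2)) @ Bit True # Bit (odd x) # cs, i := []))
        (x div 2 * (10 * X + 7) + (10 * X + 7 + T)) s'"
      using 1(2) by (simp del: fun_upd_apply)
    have code: "map Bit (digit_code x) @ cs = map Bit (digit_code (x div 2)) @ Bit True # Bit (odd x) # cs"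
      using False by (subst digit_code.simps) simp
    have "x div 2 * (10 * X + 7) + (10 * X + 7 + T) \<le> x * (10 * X + 7) + T"
    proof -
      have "(x div 2 + 1) * (10 * X + 7) \<le> x * (10 * X + 7)"
        using False by (intro mult_le_mono1) linarith
      then show ?thesis unfolding add_mult_distrib mult_1 by linarith
    qed
    then show ?thesis unfolding code by (rule runs_mono[OF r])
  qed
qed

lemma runs_read_number:
  assumes "i \<noteq> 0" "i \<noteq> 8" "s 8 = []" "s i = []" "s 0 = map Bit (number_code x) @ cs"
  shows "runs (read_number i) s (x * (10 * x + 7) + 2) (s(0 := cs, i := replicate x (Bit False)))"
proof -
  let ?c = "Seq (Pop 0)
           (Seq (move_stack i 8)
           (Seq (Loop 8 (- {None}) (Seq (Pop 8) (Seq (Push i (Bit False)) (Push i (Bit False)))))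
           (Seq (Branch 0 {Some (Bit True)} (Push i (Bit False)) Skip)
                (Pop 0))))"
  let ?s = "s(0 := Bit False # cs, i := replicate x (Bit False))"
  have s: "s(0 := map Bit (digit_code x) @ Bit False # cs, i := []) = s"
    using assms by (auto simp: fun_eq_iff number_code_def)
  have "runs (Loop 0 {Some (Bit True)} ?c) ?s 1 ?s"
    by (rule runs_LoopF) (use assms in simp)
  from runs_read_digits[OF assms(1-3) order_refl this refl]
  have 1: "runs (Loop 0 {Some (Bit True)} ?c) s (x * (10 * x + 7) + 1) ?s"
    unfolding s .
  have 2: "runs (Pop 0) ?s 1 (s(0 := cs, i := replicate x (Bit False)))"
    by (rule runs_Pop_eq) (use assms in \<open>auto simp: fun_eq_iff\<close>)
  show ?thesis unfolding read_number_def
    by (rule runs_Seq_mono[OF 1 2]) simp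
qed

section \<open>Clearing stacks and comparing output with the challenge\<close>

primrec clear_stacks :: "nat \<Rightarrow> nat \<Rightarrow> program" where
  "clear_stacks i 0 = Skip"
| "clear_stacks i (Suc k) = Seq (clear_stack (i + k)) (clear_stacks i k)"

lemma runs_clear_stacks:
  assumes "\<And>j. i \<le> j \<Longrightarrow> length (s j) \<le> L"
  shows "runs (clear_stacks i k) s (k * (2 * L + 1) + 1) (\<lambda>j. if i \<le> j \<and> j < i + k then [] else s j)"
  using assms
proof (induction k arbitrary: s)
  case 0
  have "(\<lambda>j. if i \<le> j \<and> j < i + 0 then [] else s j) = s" by (auto simp: fun_eq_iff)
  then show ?case using runs_Skip by simp
next
  case (Suc k)
  have 1: "runs (clear_stack (i + k)) s (2 * L + 1) (s(i + k := []))"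
    by (rule runs_mono[OF runs_clear_stack]) (use Suc.prems[of "i + k"] in simp)
  have "(\<lambda>j. if i \<le> j \<and> j < i + k then [] else (s(i + k := [])) j) = (\<lambda>j. if i \<le> j \<and> j < i + Suc k then [] else s j)"
    by (auto simp: fun_eq_iff less_Suc_eq)
  moreover have "length ((s(i + k := [])) j) \<le> L" if "i \<le> j" for j
    using Suc.prems that by simp
  note Suc.IH[of "s(i + k := [])", OF this]
  ultimately have 2: "runs (clear_stacks i k) (s(i + k := [])) (k * (2 * L + 1) + 1) (\<lambda>j. if i \<le> j \<and> j < i + Suc k then [] else s j)"
    by (simp only:)
  show ?case
    unfolding clear_stacks.simps by (rule runs_Seq_mono[OF 1 2]) simp
qed

text \<open>Comparing concatenated bits makes it unnecessary to compute the block length; stack 9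
  only counts the separators still to come. Output beyond the end of the challenge is padding and
  never raises a mismatch. Compared bits of the challenge wait on stack 10 to be restored.\<close>

definition compare_step :: program where
  "compare_step =
     Branch 14 {Some Sep} (Seq (Pop 14) (Pop 9))
       (Seq (Branch 14 {Some (Bit True)}
              (Branch 3 {Some (Bit False)} (Push 11 Sep) Skip)
              (Branch 3 {Some (Bit True)} (Push 11 Sep) Skip))
       (Seq (Pop 14) (transfer 3 10)))"

definition mismatches :: "bool list \<Rightarrow> bool list \<Rightarrow> nat" where
  "mismatches u y = length (filter (\<lambda>(a, b). a \<noteq> b) (zip u y))"

lemma mismatches_simps [simp]:
  "mismatches [] y = 0" "mismatches u [] = 0"
  "mismatches (a # u) (b # y) = of_bool (a \<noteq> b) + mismatches u y"
  by (simp_all add: mismatches_def)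

definition compared :: "store \<Rightarrow> symbol list \<Rightarrow> symbol list \<Rightarrow> bool list \<Rightarrow> bool list \<Rightarrow> store" where
  "compared s rest k u y = s(14 := rest, 9 := k, 3 := map Bit (drop (length u) y),
     10 := rev (map Bit (take (length u) y)) @ s 10, 11 := replicate (mismatches u y) Sep @ s 11)"

lemma compared_simps [simp]:
  "compared s rest k u y 14 = rest" "compared s rest k u y 9 = k"
  "compared s rest k u y 3 = map Bit (drop (length u) y)"
  by (simp_all add: compared_def)

lemma runs_compare_bit:
  assumes "s 14 = Bit b # out" "s 3 = map Bit y"
  shows "runs compare_step s 11 (compared s out (s 9) [b] y)"
proof -
  define s1 where "s1 = s(11 := replicate (mismatches [b] y) Sep @ s 11)"
  have s1: "s1 = (if \<exists>y'. y = (\<not> b) # y' then s(11 := Sep # s 11) else s)"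
    by (cases y) (auto simp: s1_def fun_eq_iff)
  have "runs (Branch 14 {Some (Bit True)}
              (Branch 3 {Some (Bit False)} (Push 11 Sep) Skip)
              (Branch 3 {Some (Bit True)} (Push 11 Sep) Skip)) s (Suc (Suc 1)) s1"
  proof (cases b)
    case True
    have "runs (Branch 3 {Some (Bit False)} (Push 11 Sep) Skip) s (Suc 1) s1"
    proof (cases "\<exists>y'. y = (\<not> b) # y'")
      case True
      then show ?thesis using assms \<open>b\<close> runs_Push[of 11 Sep s] by (intro runs_BranchT) (auto simp: s1)
    next
      case False
      then show ?thesis using assms \<open>b\<close> runs_Skip[of s] by (cases y) (intro runs_BranchF; simp add: s1)+
    qed
    then show ?thesis by (rule runs_BranchT[rotated]) (use True assms in simp)
  next
    case b: False
    have "runs (Branch 3 {Some (Bit True)} (Push 11 Sep) Skip) s (Suc 1) s1"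
    proof (cases "\<exists>y'. y = (\<not> b) # y'")
      case True
      then show ?thesis using assms b runs_Push[of 11 Sep s] by (intro runs_BranchT) (auto simp: s1)
    next
      case False
      then show ?thesis using assms b runs_Skip[of s] by (cases y) (intro runs_BranchF; simp add: s1)+
    qed
    then show ?thesis by (rule runs_BranchF[rotated]) (use b assms in simp)
  qed
  moreover define s2 where "s2 = s1(14 := out)"
  have "runs (Pop 14) s1 1 s2"
    by (rule runs_Pop_eq) (use assms in \<open>auto simp: s2_def s1_def fun_eq_iff\<close>)
  moreover have "runs (transfer 3 10) s2 5 (compared s out (s 9) [b] y)"
  proof (cases y)
    case Nil
    then have "compared s out (s 9) [b] y = s2"
      using assms by (auto simp: s2_def s1_def compared_def fun_eq_iff)
    moreover have "s2 3 = []" using assms Nil by (simp add: s2_def s1_def)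
    ultimately show ?thesis using runs_transfer_empty by metis
  next
    case (Cons a y')
    have "compared s out (s 9) [b] y = s2(3 := map Bit y', 10 := Bit a # s2 10)"
      using assms Cons by (auto simp: s2_def s1_def compared_def fun_eq_iff)
    moreover have "s2 3 = Bit a # map Bit y'" using assms Cons by (simp add: s2_def s1_def)
    ultimately show ?thesis using runs_transfer[of 3 10 s2 "Bit a" "map Bit y'"] by simp
  qed
  ultimately have "runs (Seq (Branch 14 {Some (Bit True)}
              (Branch 3 {Some (Bit False)} (Push 11 Sep) Skip)
              (Branch 3 {Some (Bit True)} (Push 11 Sep) Skip))
       (Seq (Pop 14) (transfer 3 10))) s (Suc (Suc 1) + (1 + 5)) (compared s out (s 9) [b] y)"
    by (intro runs_Seq)
  then have "runs compare_step s (Suc (Suc (Suc 1) + (1 + 5))) (compared s out (s 9) [b] y)"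
    unfolding compare_step_def using assms by (intro runs_BranchF) auto
  then show ?thesis by (rule runs_mono) simp
qed

lemma runs_compare_Sep:
  assumes "s 14 = Sep # out" "s 9 = d # k" "s 3 = map Bit y"
  shows "runs compare_step s 3 (compared s out k [] y)"
proof -
  have 1: "runs (Pop 14) s 1 (s(14 := out))"
    by (rule runs_Pop_eq) (use assms in \<open>auto simp: fun_eq_iff\<close>)
  have 2: "runs (Pop 9) (s(14 := out)) 1 (compared s out k [] y)"
    by (rule runs_Pop_eq) (use assms in \<open>auto simp: fun_eq_iff compared_def\<close>)
  have "runs compare_step s (Suc (1 + 1)) (compared s out k [] y)"
    unfolding compare_step_def using assms by (intro runs_BranchT runs_Seq[OF 1 2]) auto
  then show ?thesis by (rule runs_mono) simp
qed

lemma mismatches_append: "mismatches (u @ u') y = mismatches u y + mismatches u' (drop (length u) y)"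
proof (induction u arbitrary: y)
  case (Cons a u)
  then show ?case by (cases y) auto
qed simp

lemma compared_compared:
  "compared (compared s out k u y) out' k' u' (drop (length u) y) = compared s out' k' (u @ u') y"
  by (auto simp: compared_def fun_eq_iff mismatches_append take_add add.commute
      simp flip: map_append rev_append replicate_add append_assoc)

lemma runs_compare_word:
  assumes "s 14 = map Bit u @ Sep # rest" "s 9 = d # k" "s 3 = map Bit y"
    and "runs (Loop 9 (- {None}) compare_step) (compared s rest k u y) T s'"
  shows "runs (Loop 9 (- {None}) compare_step) s (12 * (length u + 1) + T) s'"
  using assms
proof (induction u arbitrary: s y)
  case Nil
  have "runs (Loop 9 (- {None}) compare_step) s (Suc (3 + T)) s'"
    using Nil by (intro runs_LoopT[OF _ runs_compare_Sep]) auto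
  then show ?case by (rule runs_mono) simp
next
  case (Cons b u)
  let ?s = "compared s (map Bit u @ Sep # rest) (s 9) [b] y"
  have "compared ?s rest k u (drop (length [b]) y) = compared s rest k (b # u) y"
    unfolding compared_compared by simp
  then have "runs (Loop 9 (- {None}) compare_step) ?s (12 * (length u + 1) + T) s'"
    using Cons.IH[of ?s "drop (length [b]) y"] Cons.prems by simp
  then have "runs (Loop 9 (- {None}) compare_step) s (Suc (11 + (12 * (length u + 1) + T))) s'"
    using Cons.prems by (intro runs_LoopT[OF _ runs_compare_bit]) auto
  then show ?case by (rule runs_mono) simp
qed

lemma runs_compare:
  assumes "s 14 = encode bs @ rest" "length (s 9) = length bs" "s 3 = map Bit y"
  shows "runs (Loop 9 (- {None}) compare_step) s (12 * length (encode bs) + 1) (compared s rest [] (concat bs) y)"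
  using assms
proof (induction bs arbitrary: s y)
  case Nil
  then have "compared s rest [] (concat []) y = s" by (auto simp: compared_def fun_eq_iff)
  then show ?case using Nil runs_LoopF[of s 9 "- {None}"] by simp
next
  case (Cons u bs)
  obtain d k where k: "s 9 = d # k" using Cons.prems by (cases "s 9") auto
  let ?s = "compared s (encode bs @ rest) k u y"
  have "compared ?s rest [] (concat bs) (drop (length u) y) = compared s rest [] (concat (u # bs)) y"
    unfolding compared_compared by simp
  then have "runs (Loop 9 (- {None}) compare_step) ?s (12 * length (encode bs) + 1) (compared s rest [] (concat (u # bs)) y)"
    using Cons.IH[of ?s "drop (length u) y"] Cons.prems k by simp
  then have "runs (Loop 9 (- {None}) compare_step) s (12 * (length u + 1) + (12 * length (encode bs) + 1)) (compared s rest [] (concat (u # bs)) y)"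
    using Cons.prems k by (intro runs_compare_word) auto
  then show ?case by (rule runs_mono) simp
qed

section \<open>The search loop\<close>

lemma length_encode_tuples: "rs \<in> tuples v k \<Longrightarrow> length (encode rs) = k * (v + 1)"
proof (induction k arbitrary: rs)
  case (Suc k)
  then show ?case by (auto simp: tuples_Suc bitstrings_def)
qed (simp add: tuples_def)

lemma top_symbol_rev_encode: "top_symbol (rev (encode ws)) \<notin> {Some (Bit True), Some (Bit False)}"
  by (cases ws rule: rev_cases) auto

text \<open>Stack 7 becomes empty exactly when the last piece is accepted. What the comparison has
  left of this very output is then the final block, that is, the preimage.\<close>

definition accept_block :: program where
  "accept_block =
     Seq (Push 5 Sep)
    (Seq (drop_block 7)
         (Branch 7 {None} (Seq (Pop 12) (Seq (move_stack 14 8) (move_stack 8 1))) Skip))"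

text \<open>The generator's program expects a complete tuple and is rerun from the start for every
  try. Zero blocks fill the later positions; for an online generator they do not influence the
  blocks compared. The input is pushed back to front: filling, accepted blocks with the new one,
  then \<open>1\<^sup>n\<close>.\<close>

definition search_body :: "program \<Rightarrow> program" where
  "search_body c =
     Seq (copy_stack 4 9 8)
    (Seq (Loop 9 (- {None}) (Seq (Pop 9) (transfer 0 6)))
    (Seq (Push 6 Sep)
    (Seq (copy_stack 7 13 8)
    (Seq (copy_stack 6 13 8)
    (Seq (Push 13 Sep)
    (Seq (copy_stack 2 13 8)
    (Seq (relocate 13 c)
    (Seq (copy_stack 5 9 8)
    (Seq (Loop 9 (- {None}) compare_step)
    (Seq (move_stack 10 3)
    (Seq (Branch 11 {None} accept_block (Seq (clear_stack 11) (drop_block 6)))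
         (clear_stacks 13 (stack_bound c + 2)))))))))))))"

definition search_init :: program where
  "search_init =
     Seq (move_bits 0 2)
    (Seq (Pop 0)
    (Seq (move_bits 0 8)
    (Seq (Pop 0)
    (Seq (move_stack 8 3)
    (Seq (read_number 4)
    (Seq (read_number 9)
    (Seq (Loop 9 (- {None}) (Seq (Pop 9) (Seq (copy_stack 4 7 8) (Push 7 Sep))))
    (Seq (Push 5 Sep)
         (Push 12 Sep)))))))))"

definition inverter :: "program \<Rightarrow> program" where
  "inverter c = Seq search_init (Loop 12 (- {None}) (search_body c))"

text \<open>The invariant between two tries. Stack 5 holds the number of output blocks that the next
  try has to match. Of the \<open>m + 1\<close> input positions, \<open>length a\<close> are settled
  and one is being tried, which leaves \<open>m - length a\<close> to be filled.\<close>

definition search_store :: "nat \<Rightarrow> bool list \<Rightarrow> nat \<Rightarrow> nat \<Rightarrow> bool list list \<Rightarrow> bool list \<Rightarrow> store" where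
  "search_store n y v m a cs = (\<lambda>_. [])
     (0 := map Bit cs @ [Sep], 2 := replicate n (Bit True), 3 := map Bit y, 4 := replicate v (Bit False),
      5 := replicate (length a + 1) Sep, 6 := rev (encode a),
      7 := rev (encode (replicate (m - length a) (replicate v False))), 12 := [Sep])"

lemma search_store_simps:
  "search_store n y v m a cs 0 = map Bit cs @ [Sep]"
  "search_store n y v m a cs 1 = []"
  "search_store n y v m a cs 2 = replicate n (Bit True)"
  "search_store n y v m a cs 3 = map Bit y"
  "search_store n y v m a cs 4 = replicate v (Bit False)"
  "search_store n y v m a cs 5 = replicate (length a + 1) Sep"
  "search_store n y v m a cs 6 = rev (encode a)"
  "search_store n y v m a cs 7 = rev (encode (replicate (m - length a) (replicate v False)))"
  "search_store n y v m a cs 8 = []"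
  "search_store n y v m a cs 9 = []"
  "search_store n y v m a cs 10 = []"
  "search_store n y v m a cs 11 = []"
  "search_store n y v m a cs 12 = [Sep]"
  "13 \<le> j \<Longrightarrow> search_store n y v m a cs j = []"
  by (simp_all add: search_store_def)

lemma runs_draw:
  assumes "length (s 9) = length r" "s 0 = map Bit r @ w"
  shows "runs (Loop 9 (- {None}) (Seq (Pop 9) (transfer 0 6))) s (7 * length r + 1)
     (s(9 := [], 0 := w, 6 := rev (map Bit r) @ s 6))"
  using assms
proof (induction r arbitrary: s)
  case Nil
  then have "s(9 := [], 0 := w, 6 := rev (map Bit []) @ s 6) = s" by (auto simp: fun_eq_iff)
  then show ?case using Nil runs_LoopF[of s 9 "- {None}"] by (simp del: fun_upd_apply)
next
  case (Cons b r)
  obtain d k where k: "s 9 = d # k" using Cons.prems by (cases "s 9") auto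
  let ?t = "s(9 := k)"
  let ?s = "?t(0 := map Bit r @ w, 6 := Bit b # ?t 6)"
  have 1: "runs (Pop 9) s 1 ?t"
    by (rule runs_Pop_eq) (use k in \<open>auto simp: fun_eq_iff\<close>)
  have 2: "runs (transfer 0 6) ?t 5 ?s"
    by (rule runs_transfer) (use Cons.prems in auto)
  have body: "runs (Seq (Pop 9) (transfer 0 6)) s 6 ?s"
    by (rule runs_Seq_mono[OF 1 2]) simp
  have eq: "?s(9 := [], 0 := w, 6 := rev (map Bit r) @ ?s 6) = s(9 := [], 0 := w, 6 := rev (map Bit (b # r)) @ s 6)"
    by (auto simp: fun_eq_iff)
  have "length (?s 9) = length r" "?s 0 = map Bit r @ w"
    using Cons.prems k by simp_all
  from Cons.IH[OF this] have rest: "runs (Loop 9 (- {None}) (Seq (Pop 9) (transfer 0 6))) ?s (7 * length r + 1)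
     (s(9 := [], 0 := w, 6 := rev (map Bit (b # r)) @ s 6))"
    unfolding eq .
  show ?case
    by (rule runs_LoopT_mono[OF _ body rest]) (use k in auto)
qed

lemma runs_relocate:
  assumes "exec c h t h'" "\<And>j. s (b + j) = h j"
  shows "runs (relocate b c) s t (join_stores b s h')"
proof -
  have "join_stores b s h = s"
  proof
    fix j
    show "join_stores b s h j = s j"
      using assms(2)[of "j - b"] by (cases "j < b") (simp_all add: join_stores_def)
  qed
  then show ?thesis
    using exec_relocate[OF assms(1), of b s] by (auto simp: runs_def)
qed

text \<open>Each cleared stack has length at most \<open>2 * W\<close> and costs at most
  \<open>5 * W\<close>; the 200 generously covers the other passes.\<close>

definition search_cost :: "program \<Rightarrow> nat" where
  "search_cost c = 200 + 5 * (stack_bound c + 2)"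

lemma runs_search_body:
  fixes n v m i :: nat
  defines "full a \<equiv> a @ replicate (Suc m - length a) (replicate v False)"
  assumes a: "a \<in> tuples v i" "i < m" and r: "r \<in> bitstrings v" and y: "length y = n"
    and run: "exec c (input_store (replicate n True # full (a @ [r]))) t h'" "t \<le> P"
    and out: "h' 1 = encode (bs @ out)" "length bs = Suc i"
    and W: "n + (m + 1) * (v + 1) + P + 2 \<le> W"
  obtains s' where "runs (search_body c) (search_store n y v m a (r @ cs)) (search_cost c * W) s'"
    "mismatches (concat bs) y \<noteq> 0 \<Longrightarrow> s' = search_store n y v m a cs"
    "mismatches (concat bs) y = 0 \<Longrightarrow> Suc i < m \<Longrightarrow> s' = search_store n y v m (a @ [r]) cs"
    "mismatches (concat bs) y = 0 \<Longrightarrow> Suc i = m \<Longrightarrow> s' 12 = [] \<and> s' 1 = encode out"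
proof -
  define zs where "zs k = replicate k (replicate v False)" for k
  have la: "length a = i" using a by (simp add: length_tuples)
  have lr: "length r = v" using r by (simp add: bitstrings_def)
  have ar: "a @ [r] \<in> tuples v (Suc i)"
    using tuples_append[OF a(1) tuples_singleton[OF r]] by simp
  have full: "full (a @ [r]) = a @ [r] @ zs (m - i)"
    using a(2) la by (simp add: full_def zs_def)
  have len_ar: "length (encode (a @ [r])) = (i + 1) * (v + 1)"
    using length_encode_tuples[OF ar] unfolding Suc_eq_plus1 .
  have len_zs: "length (encode (zs k)) = k * (v + 1)" for k
    unfolding zs_def by (rule length_encode_tuples[OF tuples_replicate])
  have sum: "(i + 1) * (v + 1) + (m - i) * (v + 1) = (m + 1) * (v + 1)"
    using a(2) by (simp flip: add_mult_distrib)
  have v_le: "v + 1 \<le> (i + 1) * (v + 1)" "i + 1 \<le> (i + 1) * (v + 1)" by simp_all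
  have len_h: "length (h' j) \<le> length (input_store (replicate n True # full (a @ [r])) j) + P" for j
    using exec_length[OF run(1), of j] run(2) by linarith
  have len_in: "length (input_store (replicate n True # full (a @ [r])) j) \<le> W" for j
    using W sum len_ar len_zs[of "m - i"] by (simp add: input_store_def full)
  have len_out: "length (encode bs) + length (encode out) \<le> P"
    using len_h[of 1] out by (simp add: input_store_def)

  define s0 where "s0 = search_store n y v m a (r @ cs)"
  note s0 = search_store_simps[where n = n and y = y and v = v and m = m and a = a and cs = "r @ cs", folded s0_def]
  define s1 where "s1 = s0(9 := rev (s0 4) @ s0 9)"
  have r1: "runs (copy_stack 4 9 8) s0 (13 * v + 2) s1"
    unfolding s1_def by (rule runs_mono[OF runs_copy_stack]) (simp_all add: s0)
  define s2 where "s2 = s1(9 := [], 0 := map Bit cs @ [Sep], 6 := rev (map Bit r) @ s1 6)"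
  have r2: "runs (Loop 9 (- {None}) (Seq (Pop 9) (transfer 0 6))) s1 (7 * v + 1) s2"
    unfolding s2_def lr[symmetric] by (rule runs_draw) (simp_all add: s1_def s0 lr)
  define s3 where "s3 = s2(6 := Sep # s2 6)"
  have r3: "runs (Push 6 Sep) s2 1 s3"
    unfolding s3_def by (rule runs_Push)
  have s36: "s3 6 = rev (encode (a @ [r]))"
    by (simp add: s3_def s2_def s1_def s0)
  define s4 where "s4 = s3(13 := rev (s3 7) @ s3 13)"
  have r4: "runs (copy_stack 7 13 8) s3 (13 * ((m - i) * (v + 1)) + 2) s4"
    unfolding s4_def len_zs[symmetric]
    by (rule runs_mono[OF runs_copy_stack]) (simp_all add: s3_def s2_def s1_def s0 la zs_def)
  define s5 where "s5 = s4(13 := rev (s4 6) @ s4 13)"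
  have r5: "runs (copy_stack 6 13 8) s4 (13 * ((i + 1) * (v + 1)) + 2) s5"
    unfolding s5_def len_ar[symmetric]
    by (rule runs_mono[OF runs_copy_stack]) (simp_all add: s4_def s36, simp_all add: s3_def s2_def s1_def s0)
  define s6 where "s6 = s5(13 := Sep # s5 13)"
  have r6: "runs (Push 13 Sep) s5 1 s6"
    unfolding s6_def by (rule runs_Push)
  define s7 where "s7 = s6(13 := rev (s6 2) @ s6 13)"
  have r7: "runs (copy_stack 2 13 8) s6 (13 * n + 2) s7"
    unfolding s7_def
    by (rule runs_mono[OF runs_copy_stack]) (simp_all add: s6_def s5_def s4_def s3_def s2_def s1_def s0)
  have s7_in: "s7 (13 + j) = input_store (replicate n True # full (a @ [r])) j" for j
  proof (cases "j = 0")
    case True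
    have "s7 13 = map Bit (replicate n True) @ Sep # encode (a @ [r]) @ encode (zs (m - i))"
      by (simp add: s7_def s6_def s5_def s4_def s36) (simp add: s3_def s2_def s1_def s0 la zs_def)
    with True show ?thesis by (simp add: input_store_def full)
  qed (simp add: s7_def s6_def s5_def s4_def s3_def s2_def s1_def s0 input_store_def)
  define s8 where "s8 = join_stores 13 s7 h'"
  have r8: "runs (relocate 13 c) s7 P s8"
    unfolding s8_def by (rule runs_mono[OF runs_relocate[OF run(1) s7_in] run(2)])
  have s8: "s8 j = s7 j" if "j < 13" for j
    using that by (simp add: s8_def join_stores_def)
  have s8_14: "s8 14 = encode bs @ encode out"
    using out by (simp add: s8_def join_stores_def One_nat_def)
  have s7: "s7 0 = map Bit cs @ [Sep]" "s7 1 = []" "s7 2 = replicate n (Bit True)" "s7 3 = map Bit y"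
    "s7 4 = replicate v (Bit False)" "s7 5 = replicate (i + 1) Sep" "s7 6 = rev (encode (a @ [r]))"
    "s7 7 = rev (encode (zs (m - i)))" "s7 8 = []" "s7 9 = []" "s7 10 = []" "s7 11 = []" "s7 12 = [Sep]"
    by (simp_all add: s7_def s6_def s5_def s4_def s3_def s2_def s1_def s0 la zs_def)
  define s9 where "s9 = s8(9 := rev (s8 5) @ s8 9)"
  have r9: "runs (copy_stack 5 9 8) s8 (13 * (i + 1) + 2) s9"
    unfolding s9_def by (rule runs_mono[OF runs_copy_stack]) (simp_all add: s8 s7)
  define s10 where "s10 = compared s9 (encode out) [] (concat bs) y"
  have r10: "runs (Loop 9 (- {None}) compare_step) s9 (12 * length (encode bs) + 1) s10"
    unfolding s10_def by (rule runs_compare) (simp_all add: s9_def s8 s7 s8_14 out)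
  define s11 where "s11 = s10(10 := [], 3 := rev (s10 10) @ s10 3)"
  have r11: "runs (move_stack 10 3) s10 (6 * n + 1) s11"
    unfolding s11_def by (rule runs_mono[OF runs_move_stack]) (simp_all add: s10_def compared_def s9_def s8 s7 y)
  have s11: "s11 = s8(14 := encode out, 11 := replicate (mismatches (concat bs) y) Sep)"
    by (auto simp: s11_def s10_def compared_def s9_def s8 s7 fun_eq_iff simp flip: map_append)
  have bits_rev: "map Bit (rev u) = rev (map Bit u)" for u by (simp add: rev_map)
  obtain s12 where r12: "runs (Branch 11 {None} accept_block (Seq (clear_stack 11) (drop_block 6))) s11 (20 * W) s12"
    and reject: "mismatches (concat bs) y \<noteq> 0 \<Longrightarrow> s12 = s11(11 := [], 6 := rev (encode a))"
    and continue: "mismatches (concat bs) y = 0 \<Longrightarrow> Suc i < m \<Longrightarrow>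
       s12 = s11(5 := replicate (i + 2) Sep, 7 := rev (encode (zs (m - Suc i))))"
    and final: "mismatches (concat bs) y = 0 \<Longrightarrow> Suc i = m \<Longrightarrow>
       s12 = s11(5 := replicate (i + 2) Sep, 7 := [], 12 := [], 14 := [], 1 := encode out)"
  proof (cases "mismatches (concat bs) y = 0")
    case False
    have 1: "runs (clear_stack 11) s11 (2 * mismatches (concat bs) y + 1) (s11(11 := []))"
      by (rule runs_mono[OF runs_clear_stack]) (simp add: s11)
    have 2: "runs (drop_block 6) (s11(11 := [])) (2 * v + 2) (s11(11 := [], 6 := rev (encode a)))"
      using runs_drop_block[of "s11(11 := [])" 6 Sep "rev r" "rev (encode a)"] top_symbol_rev_encode[of a]
      by (simp add: s11 s8 s7 bits_rev lr del: fun_upd_apply add: fun_upd_other fun_upd_same)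
    have "mismatches (concat bs) y \<le> n"
      unfolding mismatches_def using y by (intro order_trans[OF length_filter_le]) simp
    then have "Suc (2 * mismatches (concat bs) y + 1 + (2 * v + 2)) \<le> 20 * W"
      using W v_le sum by linarith
    moreover have "runs (Branch 11 {None} accept_block (Seq (clear_stack 11) (drop_block 6))) s11
        (Suc (2 * mismatches (concat bs) y + 1 + (2 * v + 2))) (s11(11 := [], 6 := rev (encode a)))"
      by (rule runs_BranchF[OF _ runs_Seq[OF 1 2]]) (use False in \<open>simp add: s11\<close>)
    ultimately have "runs (Branch 11 {None} accept_block (Seq (clear_stack 11) (drop_block 6))) s11
        (20 * W) (s11(11 := [], 6 := rev (encode a)))"
      by (rule runs_mono[rotated])
    then show ?thesis by (rule that) (use False in simp_all)
  next
    case True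
    let ?s1 = "s11(5 := replicate (i + 2) Sep)"
    let ?s2 = "?s1(7 := rev (encode (zs (m - Suc i))))"
    have "replicate (i + 2) Sep = Sep # replicate (i + 1) Sep"
      by (simp add: numeral_2_eq_2 One_nat_def)
    then have 1: "runs (Push 5 Sep) s11 1 ?s1"
      by (intro runs_Push_eq) (simp add: s11 s8 s7)
    have "m - i = Suc (m - Suc i)" using a(2) by simp
    then have "zs (m - i) = zs (m - Suc i) @ [replicate v False]"
      by (simp add: zs_def replicate_append_same)
    then have "?s1 7 = Sep # map Bit (replicate v False) @ rev (encode (zs (m - Suc i)))"
      by (simp add: s11 s8 s7)
    from runs_drop_block[of ?s1 7 Sep "replicate v False" "rev (encode (zs (m - Suc i)))", OF this top_symbol_rev_encode]
    have 2: "runs (drop_block 7) ?s1 (2 * v + 2) ?s2" by simp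
    show ?thesis
    proof (cases "Suc i < m")
      case less: True
      then have "m - Suc i = Suc (m - Suc i - 1)" by simp
      then have "encode (zs (m - Suc i)) \<noteq> []"
        using len_zs[of "m - Suc i"] by (metis add_is_0 list.size(3) mult_is_0 nat.distinct(1) zero_neq_one)
      then have 3: "runs (Branch 7 {None} (Seq (Pop 12) (Seq (move_stack 14 8) (move_stack 8 1))) Skip) ?s2 (Suc 1) ?s2"
        by (intro runs_BranchF runs_Skip) simp
      have "runs (Branch 11 {None} accept_block (Seq (clear_stack 11) (drop_block 6))) s11
          (Suc (1 + (2 * v + 2 + Suc 1))) ?s2"
        unfolding accept_block_def
        by (rule runs_BranchT[OF _ runs_Seq[OF 1 runs_Seq[OF 2 3]]]) (use True in \<open>simp add: s11\<close>)
      moreover have "Suc (1 + (2 * v + 2 + Suc 1)) \<le> 20 * W"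
        using W v_le sum by linarith
      ultimately have "runs (Branch 11 {None} accept_block (Seq (clear_stack 11) (drop_block 6))) s11 (20 * W) ?s2"
        by (rule runs_mono)
      then show ?thesis by (rule that) (use True less in simp_all)
    next
      case False
      then have m: "m = Suc i" using a(2) by simp
      let ?s3 = "?s2(12 := [])"
      have p: "runs (Pop 12) ?s2 1 ?s3"
        by (rule runs_Pop_eq) (simp add: s11 s8 s7 fun_eq_iff)
      let ?s4 = "?s3(14 := [], 8 := rev (encode out))"
      have "?s3(14 := [], 8 := rev (?s3 14) @ ?s3 8) = ?s4"
        by (simp add: s11 s8 s7)
      then have q: "runs (move_stack 14 8) ?s3 (6 * length (encode out) + 1) ?s4"
        using runs_move_stack[of 14 8 ?s3] by (simp add: s11 del: fun_upd_apply add: fun_upd_same fun_upd_other)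
      let ?s5 = "s11(5 := replicate (i + 2) Sep, 7 := [], 12 := [], 14 := [], 1 := encode out)"
      have "?s4(8 := [], 1 := rev (?s4 8) @ ?s4 1) = ?s5"
        by (auto simp: s11 s8 s7 fun_eq_iff m zs_def)
      then have q2: "runs (move_stack 8 1) ?s4 (6 * length (encode out) + 1) ?s5"
        using runs_move_stack[of 8 1 ?s4] by (simp del: fun_upd_apply add: fun_upd_same fun_upd_other)
      have 3: "runs (Branch 7 {None} (Seq (Pop 12) (Seq (move_stack 14 8) (move_stack 8 1))) Skip) ?s2
          (Suc (1 + (6 * length (encode out) + 1 + (6 * length (encode out) + 1)))) ?s5"
        by (rule runs_BranchT[OF _ runs_Seq[OF p runs_Seq[OF q q2]]]) (simp add: m zs_def)
      have "runs (Branch 11 {None} accept_block (Seq (clear_stack 11) (drop_block 6))) s11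
          (Suc (1 + (2 * v + 2 + Suc (1 + (6 * length (encode out) + 1 + (6 * length (encode out) + 1)))))) ?s5"
        unfolding accept_block_def
        by (rule runs_BranchT[OF _ runs_Seq[OF 1 runs_Seq[OF 2 3]]]) (use True in \<open>simp add: s11\<close>)
      moreover have "Suc (1 + (2 * v + 2 + Suc (1 + (6 * length (encode out) + 1 + (6 * length (encode out) + 1))))) \<le> 20 * W"
        using W v_le sum len_out by linarith
      ultimately have "runs (Branch 11 {None} accept_block (Seq (clear_stack 11) (drop_block 6))) s11 (20 * W) ?s5"
        by (rule runs_mono)
      then show ?thesis by (rule that) (use True m in simp_all)
    qed
  qed
  have s12_high: "s12 j = s8 j" if "14 < j" for j
  proof -
    consider "mismatches (concat bs) y \<noteq> 0" | "mismatches (concat bs) y = 0" "Suc i < m"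
      | "mismatches (concat bs) y = 0" "Suc i = m" using a(2) by linarith
    then show ?thesis using that by cases (simp_all add: reject continue final s11)
  qed
  have s12_14: "length (s12 14) \<le> 2 * W" and s12_13: "s12 13 = s8 13"
  proof -
    consider "mismatches (concat bs) y \<noteq> 0" | "mismatches (concat bs) y = 0" "Suc i < m"
      | "mismatches (concat bs) y = 0" "Suc i = m" using a(2) by linarith
    then show "length (s12 14) \<le> 2 * W" "s12 13 = s8 13"
      using W len_out by (cases; simp add: reject continue final s11)+
  qed
  have len12: "length (s12 j) \<le> 2 * W" if "13 \<le> j" for j
  proof -
    have "length (h' (j - 13)) \<le> 2 * W" using len_h[of "j - 13"] len_in[of "j - 13"] W by linarith
    then have "length (s8 j) \<le> 2 * W" using that by (simp add: s8_def join_stores_def)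
    moreover have "j = 13 \<or> j = 14 \<or> 14 < j" using that by linarith
    ultimately show ?thesis using s12_high s12_14 s12_13 by metis
  qed
  \<comment> \<open>The offset 2 has the input and output stacks cleared however small
    \<open>stack_bound c\<close> is.\<close>
  define s13 where "s13 = (\<lambda>j. if 13 \<le> j \<and> j < 13 + (stack_bound c + 2) then [] else s12 j)"
  have r13: "runs (clear_stacks 13 (stack_bound c + 2)) s12 ((stack_bound c + 2) * (2 * (2 * W) + 1) + 1) s13"
    unfolding s13_def by (rule runs_clear_stacks) (rule len12)
  have s13_high: "s13 j = []" if "13 \<le> j" for j
  proof (cases "j < 13 + (stack_bound c + 2)")
    case False
    then have "s12 j = h' (j - 13)" using s12_high by (simp add: s8_def join_stores_def)
    also have "\<dots> = input_store (replicate n True # full (a @ [r])) (j - 13)"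
      by (rule exec_stack_bound[OF run(1)]) (use False in simp)
    also have "\<dots> = []" using False by (simp add: input_store_def)
    finally show ?thesis using False by (simp add: s13_def)
  qed (use that in \<open>simp add: s13_def\<close>)
  have s13_low: "s13 j = s12 j" if "j < 13" for j
    using that by (simp add: s13_def)
  have s12_low: "s11 j = s7 j" if "j < 11 \<or> j = 12" for j
    using that by (auto simp: s11 s8)
  have small: "j \<in> {0, 1, 2, 3, 4, 5, 6, 7, 8, 9, 10, 11, 12}" if "j < 13" for j :: nat
    using that by (auto simp: eval_nat_numeral One_nat_def less_Suc_eq)
  show thesis
  proof (rule that[of s13])
    have "runs (search_body c) s0 (13 * v + 2 + (7 * v + 1 + (1 + (13 * ((m - i) * (v + 1)) + 2 +
        (13 * ((i + 1) * (v + 1)) + 2 + (1 + (13 * n + 2 + (P + (13 * (i + 1) + 2 + (12 * length (encode bs) + 1 +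
        (6 * n + 1 + (20 * W + ((stack_bound c + 2) * (2 * (2 * W) + 1) + 1))))))))))))) s13"
      unfolding search_body_def
      by (rule runs_Seq[OF r1 runs_Seq[OF r2 runs_Seq[OF r3 runs_Seq[OF r4
        runs_Seq[OF r5 runs_Seq[OF r6 runs_Seq[OF r7 runs_Seq[OF r8
        runs_Seq[OF r9 runs_Seq[OF r10 runs_Seq[OF r11 runs_Seq[OF r12 r13]]]]]]]]]]]])
    moreover have "13 * v + 2 + (7 * v + 1 + (1 + (13 * ((m - i) * (v + 1)) + 2 +
        (13 * ((i + 1) * (v + 1)) + 2 + (1 + (13 * n + 2 + (P + (13 * (i + 1) + 2 + (12 * length (encode bs) + 1 +
        (6 * n + 1 + (20 * W + ((stack_bound c + 2) * (2 * (2 * W) + 1) + 1)))))))))))) \<le> search_cost c * W"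
    proof -
      have "(stack_bound c + 2) * (2 * (2 * W) + 1) \<le> (stack_bound c + 2) * (5 * W)"
        using W by (intro mult_le_mono2) linarith
      moreover have "search_cost c * W = 200 * W + (stack_bound c + 2) * (5 * W)"
        by (simp add: search_cost_def algebra_simps)
      \<comment> \<open>With the products replaced by variables the estimate becomes linear.\<close>
      moreover have "13 * v + 2 + (7 * v + 1 + (1 + (13 * A2 + 2 + (13 * A1 + 2 + (1 + (13 * n + 2 + (P +
          (13 * I + 2 + (12 * L + 1 + (6 * n + 1 + (20 * W + (Z + 1)))))))))))) \<le> S"
        if "Z \<le> Z'" "S = 200 * W + Z'" "A1 + A2 = A" "n + A + P + 2 \<le> W" "v + 1 \<le> A1" "I \<le> A1" "L \<le> P"
        for A1 A2 A I L Z Z' S :: nat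
        using that by linarith
      moreover have "length (encode bs) \<le> P" using len_out by simp
      ultimately show ?thesis using W sum v_le by blast
    qed
    ultimately show "runs (search_body c) (search_store n y v m a (r @ cs)) (search_cost c * W) s13"
      unfolding s0_def by (rule runs_mono)
  next
    assume *: "mismatches (concat bs) y \<noteq> 0"
    show "s13 = search_store n y v m a cs"
    proof
      fix j
      show "s13 j = search_store n y v m a cs j"
      proof (cases "j < 13")
        case True
        then show ?thesis
          using small[OF True] by (auto simp: s13_low reject[OF *] s12_low s7 search_store_simps la zs_def)
      qed (simp add: s13_high search_store_simps)
    qed
  next
    assume *: "mismatches (concat bs) y = 0" "Suc i < m"
    show "s13 = search_store n y v m (a @ [r]) cs"
    proof
      fix j
      show "s13 j = search_store n y v m (a @ [r]) cs j"
      proof (cases "j < 13")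
        case True
        have "s11 11 = []" using * by (simp add: s11)
        with True show ?thesis
          using small[OF True]
          by (auto simp: s13_low continue[OF *] s12_low s7 search_store_simps la zs_def simp flip: Suc_eq_plus1)
      qed (simp add: s13_high search_store_simps)
    qed
  next
    assume *: "mismatches (concat bs) y = 0" "Suc i = m"
    show "s13 12 = [] \<and> s13 1 = encode out"
      by (simp add: s13_low final[OF *])
  qed
qed

lemma tuples_snoc: "a \<in> tuples v i \<Longrightarrow> r \<in> bitstrings v \<Longrightarrow> a @ [r] \<in> tuples v (Suc i)"
  using tuples_append[OF _ tuples_singleton, of a v i r] by simp

text \<open>One round of the program is one step of \<open>climb\<close>, with the coins cut into
  blocks of length \<open>v\<close>. The premise \<open>test\<close> is confined to prefixes whose
  earlier blocks match, since only there does comparing all bits so far amount to comparing the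
  newest block.\<close>

lemma runs_search_loop:
  fixes n v m :: nat and Z :: "bool list list \<Rightarrow> 'b"
  assumes run: "\<And>rs. rs \<in> tuples v (Suc m) \<Longrightarrow>
      \<exists>t h. exec c (input_store (replicate n True # rs)) t h \<and> t \<le> P \<and> h 1 = encode (H rs)"
    and len: "\<And>rs. rs \<in> tuples v (Suc m) \<Longrightarrow> length (H rs) = Suc m"
    and test: "\<And>a i. a \<in> tuples v (Suc i) \<Longrightarrow> i < m \<Longrightarrow> \<forall>j<i. Z (take (Suc j) a) = w j \<Longrightarrow>
      mismatches (concat (take (Suc i) (H (a @ replicate (m - i) (replicate v False))))) y = 0 \<longleftrightarrow> Z a = w i"
    and y: "length y = n"
    and W: "n + (m + 1) * (v + 1) + P + 2 \<le> W"
    and "a \<in> tuples v i" "i < m" "\<forall>j<i. Z (take (Suc j) a) = w j" "rs \<in> tuples v N"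
      "length (climb m Z w a rs) = m"
  shows "\<exists>s' a'. a' \<in> tuples v m \<and> (\<forall>j<m. Z (take (Suc j) a') = w j) \<and>
    runs (Loop 12 (- {None}) (search_body c)) (search_store n y v m a (concat rs @ cs))
      (N * (search_cost c * W + 1) + 1) s' \<and> s' 1 = encode [H (a' @ [replicate v False]) ! m]"
  using assms(6-)
proof (induction N arbitrary: a i rs)
  case 0
  then show ?case by (simp add: length_tuples)
next
  case (Suc N)
  obtain r rs' where rs: "rs = r # rs'" "r \<in> bitstrings v" "rs' \<in> tuples v N"
    using Suc.prems(4) by (auto simp: tuples_Suc)
  have la: "length a = i" using Suc.prems(1) by (simp add: length_tuples)
  have ar: "a @ [r] \<in> tuples v (Suc i)" by (rule tuples_snoc[OF Suc.prems(1) rs(2)])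
  let ?zs = "replicate (m - i) (replicate v False)"
  let ?full = "(a @ [r]) @ ?zs"
  have "?full \<in> tuples v (Suc i + (m - i))"
    by (rule tuples_append[OF ar tuples_replicate])
  then have full: "?full \<in> tuples v (Suc m)" using Suc.prems(2) by simp
  obtain t h where h: "exec c (input_store (replicate n True # ?full)) t h" "t \<le> P" "h 1 = encode (H ?full)"
    using run[OF full] by blast
  let ?bs = "take (Suc i) (H ?full)" and ?out = "drop (Suc i) (H ?full)"
  have test': "mismatches (concat ?bs) y = 0 \<longleftrightarrow> Z (a @ [r]) = w i"
    by (rule test[OF ar Suc.prems(2)]) (use Suc.prems(3) la in simp)
  have eq: "(a @ [r]) @ replicate (Suc m - length (a @ [r])) (replicate v False) = ?full"
    by (simp add: la)
  obtain s' where s': "runs (search_body c) (search_store n y v m a (r @ concat rs' @ cs)) (search_cost c * W) s'"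
    "mismatches (concat ?bs) y \<noteq> 0 \<Longrightarrow> s' = search_store n y v m a (concat rs' @ cs)"
    "mismatches (concat ?bs) y = 0 \<Longrightarrow> Suc i < m \<Longrightarrow> s' = search_store n y v m (a @ [r]) (concat rs' @ cs)"
    "mismatches (concat ?bs) y = 0 \<Longrightarrow> Suc i = m \<Longrightarrow> s' 12 = [] \<and> s' 1 = encode ?out"
  proof (rule runs_search_body[OF Suc.prems(1,2) rs(2) y, of c t h P ?bs ?out W "concat rs' @ cs"])
    show "exec c (input_store (replicate n True # (a @ [r]) @ replicate (Suc m - length (a @ [r])) (replicate v False))) t h"
      unfolding eq by (rule h(1))
    show "h 1 = encode (?bs @ ?out)" using h(3) by simp
    show "length ?bs = Suc i" using len[OF full] Suc.prems(2) by simp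
  qed (use h(2) W in simp_all)
  have loop: "runs (Loop 12 (- {None}) (search_body c)) (search_store n y v m a (concat rs @ cs)) (Suc N * (search_cost c * W + 1) + 1) fin"
    if "runs (Loop 12 (- {None}) (search_body c)) s' (N * (search_cost c * W + 1) + 1) fin" for fin
  proof -
    have "runs (Loop 12 (- {None}) (search_body c)) (search_store n y v m a (r @ concat rs' @ cs))
        (Suc (search_cost c * W + (N * (search_cost c * W + 1) + 1))) fin"
      by (rule runs_LoopT[OF _ s'(1) that]) (simp add: search_store_simps)
    moreover have "r @ concat rs' @ cs = concat rs @ cs" by (simp add: rs)
    ultimately show ?thesis using runs_mono[of _ "search_store n y v m a (concat rs @ cs)"] by simp
  qed
  consider "Z (a @ [r]) \<noteq> w i" | "Z (a @ [r]) = w i" "Suc i < m" | "Z (a @ [r]) = w i" "Suc i = m"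
    using Suc.prems(2) by linarith
  then show ?case
  proof cases
    case 1
    have s: "s' = search_store n y v m a (concat rs' @ cs)" using s'(2) test' 1 by simp
    have "length (climb m Z w a rs') = m" using Suc.prems(5) 1 la by (simp add: rs)
    from Suc.IH[OF Suc.prems(1-3) rs(3) this] show ?thesis unfolding s[symmetric] using loop by blast
  next
    case 2
    have s: "s' = search_store n y v m (a @ [r]) (concat rs' @ cs)" using s'(3) test' 2 by simp
    have "length (climb m Z w (a @ [r]) rs') = m" using Suc.prems(2,5) 2 la by (simp add: rs)
    moreover have "\<forall>j<Suc i. Z (take (Suc j) (a @ [r])) = w j"
      using Suc.prems(3) 2(1) la by (simp add: less_Suc_eq)
    ultimately show ?thesis using Suc.IH[OF ar 2(2) _ rs(3)] loop unfolding s[symmetric] by blast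
  next
    case 3
    have fin: "s' 12 = []" "s' 1 = encode ?out" using s'(4) test' 3 by simp_all
    \<comment> \<open>One position is left, so the tuple just run ends in a single zero block and
      its output already contains the final block.\<close>
    have zs: "?full = (a @ [r]) @ [replicate v False]" using 3(2) by (simp flip: 3(2))
    have "?out = [H ?full ! m]"
      using len[OF full] 3(2) by (metis Cons_nth_drop_Suc drop_all lessI order_refl)
    then have out: "s' 1 = encode [H ((a @ [r]) @ [replicate v False]) ! m]" using fin(2) zs by simp
    have "runs (Loop 12 (- {None}) (search_body c)) s' (N * (search_cost c * W + 1) + 1) s'"
      by (rule runs_mono[OF runs_LoopF]) (simp_all add: fin)
    from loop[OF this] have "runs (Loop 12 (- {None}) (search_body c)) (search_store n y v m a (concat rs @ cs)) (Suc N * (search_cost c * W + 1) + 1) s'" .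
    moreover have "\<forall>j<m. Z (take (Suc j) (a @ [r])) = w j"
      using Suc.prems(3) 3 la by (auto simp: less_Suc_eq)
    moreover have "a @ [r] \<in> tuples v m" using ar 3(2) by simp
    ultimately show ?thesis using out by blast
  qed
qed

section \<open>Initialisation and the complete inverter\<close>

lemma runs_zero_blocks:
  assumes "s 4 = replicate v (Bit False)" "s 8 = []" "s 7 = rev (encode (replicate k (replicate v False)))"
  shows "runs (Loop 9 (- {None}) (Seq (Pop 9) (Seq (copy_stack 4 7 8) (Push 7 Sep)))) s (length (s 9) * (13 * v + 5) + 1)
     (s(9 := [], 7 := rev (encode (replicate (k + length (s 9)) (replicate v False)))))"
  using assms
proof (induction "s 9" arbitrary: s k)
  case Nil
  then have "s(9 := [], 7 := rev (encode (replicate (k + length (s 9)) (replicate v False)))) = s"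
    by (auto simp: fun_eq_iff)
  with Nil show ?case
    using runs_LoopF[of s 9 "- {None}"] by (simp del: fun_upd_apply)
next
  case (Cons d w)
  note s9 = Cons.hyps(2)[symmetric]
  let ?z = "replicate v False"
  let ?t = "s(9 := w)"
  let ?s = "?t(7 := rev (encode (replicate (Suc k) ?z)))"
  have snoc: "replicate (Suc k) ?z = replicate k ?z @ [?z]" by (simp add: replicate_append_same)
  have 1: "runs (Pop 9) s 1 ?t" by (rule runs_Pop_eq) (simp add: s9)
  have 2: "runs (copy_stack 4 7 8) ?t (13 * v + 2) (?t(7 := rev (?t 4) @ ?t 7))"
    by (rule runs_mono[OF runs_copy_stack]) (simp_all add: Cons.prems)
  have 3: "runs (Push 7 Sep) (?t(7 := rev (?t 4) @ ?t 7)) 1 ?s"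
    by (rule runs_Push_eq) (simp add: Cons.prems snoc del: replicate_Suc)
  have body: "runs (Seq (Pop 9) (Seq (copy_stack 4 7 8) (Push 7 Sep))) s (1 + (13 * v + 2 + 1)) ?s"
    by (rule runs_Seq[OF 1 runs_Seq[OF 2 3]])
  have "?s(9 := [], 7 := rev (encode (replicate (Suc k + length (?s 9)) ?z)))
      = s(9 := [], 7 := rev (encode (replicate (k + length (s 9)) ?z)))"
    by (auto simp: fun_eq_iff s9)
  moreover have "runs (Loop 9 (- {None}) (Seq (Pop 9) (Seq (copy_stack 4 7 8) (Push 7 Sep)))) ?s (length (?s 9) * (13 * v + 5) + 1)
     (?s(9 := [], 7 := rev (encode (replicate (Suc k + length (?s 9)) ?z))))"
    by (rule Cons.hyps(1)) (simp_all add: Cons.prems)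
  ultimately have rest: "runs (Loop 9 (- {None}) (Seq (Pop 9) (Seq (copy_stack 4 7 8) (Push 7 Sep)))) ?s (length w * (13 * v + 5) + 1)
     (s(9 := [], 7 := rev (encode (replicate (k + length (s 9)) ?z))))"
    by (simp del: fun_upd_apply add: fun_upd_same fun_upd_other)
  show ?case
    by (rule runs_LoopT_mono[OF _ body rest]) (simp_all add: s9 flip: Suc_eq_plus1)
qed

text \<open>Decoding into unary and writing \<open>m\<close> blocks of \<open>v\<close> zeros
  account for the quadratic time.\<close>

lemma runs_search_init:
  assumes y: "length y = n" and W: "n + (m + 1) * (v + 1) + 2 \<le> W"
  shows "runs search_init (input_store [replicate n True, y, number_code v @ number_code m @ cs])
     (100 * W\<^sup>2) (search_store n y v m [] cs)"
proof -
  define s0 where "s0 = input_store [replicate n True, y, number_code v @ number_code m @ cs]"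
  define r where "r = map Bit (number_code v) @ map Bit (number_code m) @ map Bit cs @ [Sep]"
  have s0: "s0 0 = map Bit (replicate n True) @ Sep # map Bit y @ Sep # r" "\<And>j. j \<noteq> 0 \<Longrightarrow> s0 j = []"
    by (simp_all add: s0_def input_store_def r_def)
  define s1 where "s1 = s0(0 := Sep # map Bit y @ Sep # r, 2 := rev (map Bit (replicate n True)) @ s0 2)"
  have r1: "runs (move_bits 0 2) s0 (6 * n + 1) s1"
    unfolding s1_def using runs_move_bits[of 0 2 s0 "replicate n True"] s0(1) by (simp del: fun_upd_apply)
  define s2 where "s2 = s1(0 := map Bit y @ Sep # r)"
  have r2: "runs (Pop 0) s1 1 s2"
    unfolding s2_def by (rule runs_Pop_eq) (simp add: s1_def)
  define s3 where "s3 = s2(0 := Sep # r, 8 := rev (map Bit y) @ s2 8)"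
  have r3: "runs (move_bits 0 8) s2 (6 * n + 1) s3"
    unfolding s3_def y[symmetric] by (rule runs_move_bits) (simp_all add: s2_def)
  define s4 where "s4 = s3(0 := r)"
  have r4: "runs (Pop 0) s3 1 s4"
    unfolding s4_def by (rule runs_Pop_eq) (simp add: s3_def)
  define s5 where "s5 = s4(8 := [], 3 := rev (s4 8) @ s4 3)"
  have r5: "runs (move_stack 8 3) s4 (6 * n + 1) s5"
    unfolding s5_def by (rule runs_mono[OF runs_move_stack]) (simp_all add: s4_def s3_def s2_def s1_def s0 y)
  define s6 where "s6 = s5(0 := map Bit (number_code m) @ map Bit cs @ [Sep], 4 := replicate v (Bit False))"
  have r6: "runs (read_number 4) s5 (v * (10 * v + 7) + 2) s6"
    unfolding s6_def by (rule runs_read_number) (simp_all add: s5_def s4_def s3_def s2_def s1_def s0 r_def)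
  define s7 where "s7 = s6(0 := map Bit cs @ [Sep], 9 := replicate m (Bit False))"
  have r7: "runs (read_number 9) s6 (m * (10 * m + 7) + 2) s7"
    unfolding s7_def by (rule runs_read_number) (simp_all add: s6_def s5_def s4_def s3_def s2_def s1_def s0)
  define s8 where "s8 = s7(9 := [], 7 := rev (encode (replicate (0 + length (s7 9)) (replicate v False))))"
  have len9: "length (s7 9) = m" by (simp add: s7_def)
  have r8: "runs (Loop 9 (- {None}) (Seq (Pop 9) (Seq (copy_stack 4 7 8) (Push 7 Sep)))) s7 (m * (13 * v + 5) + 1) s8"
    unfolding s8_def len9[symmetric]
    by (rule runs_zero_blocks) (simp_all add: s7_def s6_def s5_def s4_def s3_def s2_def s1_def s0)
  define s9 where "s9 = s8(5 := Sep # s8 5)"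
  have r9: "runs (Push 5 Sep) s8 1 s9"
    unfolding s9_def by (rule runs_Push)
  have r10: "runs (Push 12 Sep) s9 1 (search_store n y v m [] cs)"
  proof (rule runs_Push_eq)
    show "search_store n y v m [] cs = s9(12 := Sep # s9 12)"
      by (auto simp: fun_eq_iff s9_def s8_def s7_def s6_def s5_def s4_def s3_def s2_def s1_def s0 search_store_def)
  qed
  have "runs search_init s0 (6 * n + 1 + (1 + (6 * n + 1 + (1 + (6 * n + 1 + (v * (10 * v + 7) + 2 +
      (m * (10 * m + 7) + 2 + (m * (13 * v + 5) + 1 + (1 + 1))))))))) (search_store n y v m [] cs)"
    unfolding search_init_def
    by (rule runs_Seq[OF r1 runs_Seq[OF r2 runs_Seq[OF r3 runs_Seq[OF r4 runs_Seq[OF r5 runs_Seq[OF r6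
        runs_Seq[OF r7 runs_Seq[OF r8 runs_Seq[OF r9 r10]]]]]]]]])
  moreover have "6 * n + 1 + (1 + (6 * n + 1 + (1 + (6 * n + 1 + (v * (10 * v + 7) + 2 +
      (m * (10 * m + 7) + 2 + (m * (13 * v + 5) + 1 + (1 + 1)))))))) \<le> 100 * W\<^sup>2"
  proof -
    have "v + m \<le> (m + 1) * (v + 1)" unfolding add_mult_distrib add_mult_distrib2 by simp
    then have le: "n \<le> W" "v \<le> W" "m \<le> W" "2 \<le> W" using W by linarith+
    have W2: "2 * W \<le> W * W" using le(4) by (rule mult_le_mono1)
    have "v * (10 * v + 7) \<le> W * (10 * W + 7)" "m * (10 * m + 7) \<le> W * (10 * W + 7)" "m * (13 * v + 5) \<le> W * (13 * W + 5)"
      by (intro mult_le_mono add_le_mono le order_refl)+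
    moreover have "W * (10 * W + 7) = 10 * (W * W) + 7 * W" "W * (13 * W + 5) = 13 * (W * W) + 5 * W"
      by (simp_all add: algebra_simps)
    ultimately show ?thesis using W2 le unfolding power2_eq_square by linarith
  qed
  ultimately show ?thesis unfolding s0_def by (rule runs_mono)
qed

theorem runs_inverter:
  fixes n v m :: nat and Z :: "bool list list \<Rightarrow> 'b"
  assumes "\<And>rs. rs \<in> tuples v (Suc m) \<Longrightarrow>
      \<exists>t h. exec c (input_store (replicate n True # rs)) t h \<and> t \<le> P \<and> h 1 = encode (H rs)"
    and "\<And>rs. rs \<in> tuples v (Suc m) \<Longrightarrow> length (H rs) = Suc m"
    and "\<And>a i. a \<in> tuples v (Suc i) \<Longrightarrow> i < m \<Longrightarrow> \<forall>j<i. Z (take (Suc j) a) = w j \<Longrightarrow>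
      mismatches (concat (take (Suc i) (H (a @ replicate (m - i) (replicate v False))))) y = 0 \<longleftrightarrow> Z a = w i"
    and y: "length y = n"
    and W: "n + (m + 1) * (v + 1) + P + 2 \<le> W"
    and "0 < m" "rs \<in> tuples v N" "length (climb m Z w [] rs) = m"
  shows "\<exists>s a. a \<in> tuples v m \<and> (\<forall>j<m. Z (take (Suc j) a) = w j) \<and>
    runs (inverter c) (input_store [replicate n True, y, number_code v @ number_code m @ concat rs @ cs])
      (100 * W\<^sup>2 + (N * (search_cost c * W + 1) + 1)) s \<and> s 1 = encode [H (a @ [replicate v False]) ! m]"
proof -
  have nil: "[] \<in> tuples v 0" "\<forall>j<0. Z (take (Suc j) []) = w j" by simp_all
  have "\<exists>s a. a \<in> tuples v m \<and> (\<forall>j<m. Z (take (Suc j) a) = w j) \<and>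
    runs (Loop 12 (- {None}) (search_body c)) (search_store n y v m [] (concat rs @ cs))
      (N * (search_cost c * W + 1) + 1) s \<and> s 1 = encode [H (a @ [replicate v False]) ! m]"
    by (rule runs_search_loop[where i = 0, OF assms(1-5) nil(1) assms(6) nil(2) assms(7,8)])
  then obtain s a where sa: "a \<in> tuples v m" "\<forall>j<m. Z (take (Suc j) a) = w j"
    "runs (Loop 12 (- {None}) (search_body c)) (search_store n y v m [] (concat rs @ cs)) (N * (search_cost c * W + 1) + 1) s"
    "s 1 = encode [H (a @ [replicate v False]) ! m]"
    by (elim exE conjE)
  have "n + (m + 1) * (v + 1) + 2 \<le> W" using W by linarith
  note init = runs_search_init[OF y this, of "concat rs @ cs"]
  show ?thesis
    unfolding inverter_def by (intro exI[of _ s] exI[of _ a] conjI sa(1,2,4) runs_Seq[OF init sa(3)])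
qed

section \<open>The generator and its accessible entropy\<close>

subsection \<open>The blocks of the generator\<close>

definition padded :: "(bool list \<Rightarrow> bool list) \<Rightarrow> nat \<Rightarrow> bool list \<Rightarrow> bool list" where
  "padded f n x = pad (num_pieces n * block_length n) (f x)"

lemma length_Gf: "length (Gf f n x) = Suc (num_pieces n)"
  by (simp add: Gf_def Let_def)

lemma Gf_nth: "i < num_pieces n \<Longrightarrow> Gf f n x ! i = take (block_length n) (drop (i * block_length n) (padded f n x))"
  by (simp add: Gf_def Let_def nth_append padded_def)

lemma Gf_last: "Gf f n x ! num_pieces n = x"
  by (simp add: Gf_def Let_def nth_append)

lemma concat_pieces: "concat (map (\<lambda>j. take l (drop (j * l) u)) [0..<k]) = take (k * l) u"
proof (induction k)
  case (Suc k)
  have "take (k * l + l) u = take (k * l) u @ take l (drop (k * l) u)" by (rule take_add)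
  then show ?case using Suc by (simp add: add.commute)
qed simp

lemma concat_take_Gf:
  assumes "k \<le> num_pieces n"
  shows "concat (take k (Gf f n x)) = take (k * block_length n) (padded f n x)"
proof -
  have "take k (Gf f n x) = map (\<lambda>j. take (block_length n) (drop (j * block_length n) (padded f n x))) [0..<k]"
    using assms by (simp add: Gf_def Let_def padded_def take_map)
  then show ?thesis by (simp add: concat_pieces)
qed

lemma length_padded: "length (f x) = n \<Longrightarrow> length (padded f n x) = num_pieces n * block_length n"
  using le_num_pieces_times_block_length[of n] by (simp add: padded_def pad_def)

lemma length_Gf_nth:
  assumes "length (f x) = n" "i < num_pieces n"
  shows "length (Gf f n x ! i) = block_length n"
proof -
  have "Suc i * block_length n \<le> num_pieces n * block_length n"
    using assms(2) by (intro mult_le_mono1) simp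
  then show ?thesis using assms by (simp add: Gf_nth length_padded)
qed

lemma padded_eq:
  assumes "length (f x) = n"
  shows "padded f n x = f x @ replicate (num_pieces n * block_length n - n) False"
  using assms by (simp add: padded_def pad_def)

lemma Gf_inj:
  assumes "length (f x) = n" "length (f x') = n"
    and "\<And>i. i < num_pieces n \<Longrightarrow> Gf f n x ! i = Gf f n x' ! i"
  shows "f x = f x'"
proof -
  have "take (num_pieces n) (Gf f n x) = take (num_pieces n) (Gf f n x')"
    by (rule nth_equalityI) (simp_all add: length_Gf assms(3))
  then have "take (num_pieces n * block_length n) (padded f n x) = take (num_pieces n * block_length n) (padded f n x')"
    by (metis concat_take_Gf order_refl)
  then show ?thesis
    using assms(1,2) le_num_pieces_times_block_length[of n] by (simp add: padded_eq)
qed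

text \<open>Behind two words of equal length the same padding follows, so ignoring it is
  harmless.\<close>

lemma mismatches_take:
  assumes "length y = length y'"
  shows "mismatches (take k (y' @ z)) y = 0 \<longleftrightarrow> take k (y' @ z) = take k (y @ z)"
  using assms
proof (induction y y' arbitrary: k rule: list_induct2)
  case (Cons b y b' y')
  then show ?case by (cases k) auto
qed simp

text \<open>Equal earlier blocks make all earlier bits agree, which leaves the decision to block
  \<open>i\<close>. This is what the premise \<open>test\<close> of the search loop
  requires.\<close>

lemma mismatches_Gf:
  assumes "length (f x) = n" "length (f x') = n" "i < num_pieces n"
    and "\<And>j. j < i \<Longrightarrow> Gf f n x' ! j = Gf f n x ! j"
  shows "mismatches (concat (take (Suc i) (Gf f n x'))) (f x) = 0 \<longleftrightarrow> Gf f n x' ! i = Gf f n x ! i"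
proof -
  let ?l = "block_length n"
  have take_eq: "mismatches (concat (take (Suc i) (Gf f n x'))) (f x) = 0
      \<longleftrightarrow> take (Suc i * ?l) (padded f n x') = take (Suc i * ?l) (padded f n x)"
    using assms(1,2) mismatches_take[of "f x" "f x'"]
    unfolding concat_take_Gf[OF Suc_leI[OF assms(3)]] padded_eq[of f x n, OF assms(1)] padded_eq[of f x' n, OF assms(2)]
    by (simp del: take_append mult_Suc)
  show ?thesis
  proof
    assume "mismatches (concat (take (Suc i) (Gf f n x'))) (f x) = 0"
    then have "drop (i * ?l) (take (Suc i * ?l) (padded f n x')) = drop (i * ?l) (take (Suc i * ?l) (padded f n x))"
      using take_eq by simp
    then show "Gf f n x' ! i = Gf f n x ! i" using assms(3) by (simp add: Gf_nth drop_take)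
  next
    assume "Gf f n x' ! i = Gf f n x ! i"
    with assms(4) have "take (Suc i) (Gf f n x') = take (Suc i) (Gf f n x)"
      using assms(3) by (intro nth_equalityI) (auto simp: length_Gf less_Suc_eq)
    then have "concat (take (Suc i) (Gf f n x')) = concat (take (Suc i) (Gf f n x))" by simp
    then have "take (Suc i * ?l) (padded f n x') = take (Suc i * ?l) (padded f n x)"
      using assms(3) by (simp only: concat_take_Gf Suc_le_eq)
    then show "mismatches (concat (take (Suc i) (Gf f n x'))) (f x) = 0" using take_eq by simp
  qed
qed

lemma num_pieces_le: "num_pieces n \<le> n"
proof -
  have "real n / real (block_length n) \<le> real n / 1"
    by (rule divide_left_mono) (auto simp: block_length_def)
  then show ?thesis unfolding num_pieces_def by simp
qed

lemma num_pieces_pos: "0 < n \<Longrightarrow> 0 < num_pieces n"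
  using le_num_pieces_times_block_length[of n] by (cases "num_pieces n") auto

lemma block_length_le: "2 \<le> n \<Longrightarrow> block_length n \<le> log 2 n + 1"
proof -
  assume "2 \<le> n"
  then have "1 \<le> log 2 n" by (simp add: le_log_iff)
  moreover have "real (nat \<lceil>log 2 n\<rceil>) \<le> log 2 n + 1"
    using \<open>1 \<le> log 2 n\<close> by linarith
  ultimately show ?thesis by (simp add: block_length_def max_def One_nat_def)
qed

lemma two_power_block_length_le:
  assumes "2 \<le> n"
  shows "2 ^ block_length n \<le> (2 * n :: real)"
proof -
  have "2 ^ block_length n = 2 powr (block_length n)" by (simp add: powr_realpow)
  also have "\<dots> \<le> 2 powr (log 2 n + 1)" using block_length_le[OF assms] by simp
  also have "\<dots> = 2 * n" using assms by (simp add: powr_add)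
  finally show ?thesis .
qed

subsection \<open>Accessible entropy as an average\<close>

text \<open>Makes an output block a function of the input prefix that determines it. For online
  generators any completion gives the same block; zero blocks are what the inverter uses.\<close>

definition prefix_block :: "nat \<Rightarrow> nat \<Rightarrow> (bool list list \<Rightarrow> bool list list) \<Rightarrow> bool list list \<Rightarrow> bool list" where
  "prefix_block v M h a = h (a @ replicate (M - length a) (replicate v False)) ! (length a - 1)"

lemma tuples_extend:
  assumes "a \<in> tuples v i" "i \<le> M"
  shows "a @ replicate (M - i) (replicate v False) \<in> tuples v M"
  using tuples_append[OF assms(1) tuples_replicate, of "M - i" False] assms(2) by simp

lemma prefix_block_take:
  assumes "online_generator v M H" "rs \<in> tuples (v n) (M n)" "i < M n"
  shows "prefix_block (v n) (M n) (H n) (take (Suc i) rs) = H n rs ! i"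
proof -
  have "take (Suc i) rs \<in> tuples (v n) (Suc i)" using assms(2,3) by (intro tuples_take) auto
  then have ext: "take (Suc i) rs @ replicate (M n - Suc i) (replicate (v n) False) \<in> tuples (v n) (M n)"
    by (rule tuples_extend) (use assms(3) in simp)
  have len: "length (take (Suc i) rs) = Suc i" using assms(2,3) by (simp add: length_tuples)
  have "take (Suc i) (take (Suc i) rs @ replicate (M n - Suc i) (replicate (v n) False)) = take (Suc i) rs"
    using len by (metis append_eq_conv_conj take_all order_refl)
  then have "H n (take (Suc i) rs @ replicate (M n - Suc i) (replicate (v n) False)) ! i = H n rs ! i"
    using assms(1) ext assms(2,3) unfolding online_generator_def by blast
  then show ?thesis unfolding prefix_block_def len by simp
qed

lemma tuples_nonempty [simp]: "tuples v M \<noteq> {}"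
  using tuples_replicate by blast

lemma card_prefix:
  assumes "a \<in> tuples v i" "i < M"
  shows "card {rs \<in> tuples v M. P (rs ! i) \<and> take i rs = a} = card {x \<in> bitstrings v. P x} * 2 ^ (v * (M - Suc i))"
proof -
  have la: "length a = i" using assms by (simp add: length_tuples)
  have "bij_betw (\<lambda>(x, b). a @ x # b) ({x \<in> bitstrings v. P x} \<times> tuples v (M - Suc i)) {rs \<in> tuples v M. P (rs ! i) \<and> take i rs = a}"
    unfolding bij_betw_def
  proof
    show "inj_on (\<lambda>(x, b). a @ x # b) ({x \<in> bitstrings v. P x} \<times> tuples v (M - Suc i))"
      by (auto simp: inj_on_def)
    show "(\<lambda>(x, b). a @ x # b) ` ({x \<in> bitstrings v. P x} \<times> tuples v (M - Suc i)) = {rs \<in> tuples v M. P (rs ! i) \<and> take i rs = a}"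
    proof (intro set_eqI iffI)
      fix rs assume "rs \<in> (\<lambda>(x, b). a @ x # b) ` ({x \<in> bitstrings v. P x} \<times> tuples v (M - Suc i))"
      then show "rs \<in> {rs \<in> tuples v M. P (rs ! i) \<and> take i rs = a}"
        using assms la by (auto simp: tuples_def nth_append)
    next
      fix rs assume rs: "rs \<in> {rs \<in> tuples v M. P (rs ! i) \<and> take i rs = a}"
      then have "rs = a @ rs ! i # drop (Suc i) rs"
        using assms(2) by (auto simp: tuples_def id_take_nth_drop)
      moreover have "rs ! i \<in> {x \<in> bitstrings v. P x}" "drop (Suc i) rs \<in> tuples v (M - Suc i)"
        using rs assms(2) by (auto simp: tuples_def dest: in_set_dropD)
      ultimately show "rs \<in> (\<lambda>(x, b). a @ x # b) ` ({x \<in> bitstrings v. P x} \<times> tuples v (M - Suc i))"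
        by (auto intro!: rev_image_eqI[where x = "(rs ! i, drop (Suc i) rs)"])
    qed
  qed
  then show ?thesis
    by (simp add: bij_betw_same_card[symmetric] card_cartesian_product card_tuples)
qed

text \<open>Given the earlier input blocks, output block \<open>i\<close> depends on the fresh block
  \<open>R ! i\<close> alone. The later blocks are free in both events, and their number
  cancels.\<close>

lemma transcript_cond_prob:
  assumes H: "online_generator v M H" and rs: "rs \<in> tuples (v n) (M n)" and i: "i < M n"
  shows "\<P>((R, Y) in measure_pmf (transcript v M H n). Y ! i = y \<bar> take i R = take i rs)
    = hit (v n) (prefix_block (v n) (M n) (H n)) (take i rs) y"
proof -
  let ?T = "tuples (v n) (M n)" and ?Z = "prefix_block (v n) (M n) (H n)"
  have a: "take i rs \<in> tuples (v n) i" using rs i by (intro tuples_take) auto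
  have prob: "measure (measure_pmf (transcript v M H n)) {\<omega>. Q \<omega>} = card {r \<in> ?T. Q (r, H n r)} / card ?T" for Q
  proof -
    have "measure (measure_pmf (transcript v M H n)) {\<omega>. Q \<omega>} = measure (measure_pmf (pmf_of_set ?T)) {r. Q (r, H n r)}"
      unfolding transcript_def by (simp add: vimage_def)
    also have "\<dots> = card (?T \<inter> {r. Q (r, H n r)}) / card ?T"
      by (rule measure_pmf_of_set) simp_all
    finally show ?thesis by (simp add: Int_def)
  qed
  have Z: "H n r ! i = ?Z (take i rs @ [r ! i])" if "r \<in> ?T" "take i r = take i rs" for r
  proof -
    have "take (Suc i) r = take i rs @ [r ! i]"
      using that i by (simp add: take_Suc_conv_app_nth length_tuples)
    then show ?thesis using prefix_block_take[OF H that(1) i] by simp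
  qed
  have num: "{r \<in> ?T. H n r ! i = y \<and> take i r = take i rs} = {r \<in> ?T. ?Z (take i rs @ [r ! i]) = y \<and> take i r = take i rs}"
    using Z by auto
  have "\<P>((R, Y) in measure_pmf (transcript v M H n). Y ! i = y \<bar> take i R = take i rs)
     = (card {r \<in> ?T. H n r ! i = y \<and> take i r = take i rs} / card ?T) / (card {r \<in> ?T. take i r = take i rs} / card ?T)"
    unfolding cond_prob_def by (simp add: prob case_prod_beta)
  also have "\<dots> = card {x \<in> bitstrings (v n). ?Z (take i rs @ [x]) = y} / 2 ^ v n"
    unfolding num card_prefix[OF a i, of "\<lambda>x. ?Z (take i rs @ [x]) = y"]
    using card_prefix[OF a i, of "\<lambda>_. True"] by (simp add: card_tuples)
  finally show ?thesis by (simp add: hit_def)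
qed

lemma expectation_AccH:
  assumes "online_generator v M H"
  shows "measure_pmf.expectation (transcript v M H n) (AccH v M H n)
    = avg (v n) (M n) (\<lambda>rs. \<Sum>i<M n. log 2 (1 / hit (v n) (prefix_block (v n) (M n) (H n)) (take i rs)
        (prefix_block (v n) (M n) (H n) (take (Suc i) rs))))"
proof -
  let ?T = "tuples (v n) (M n)"
  have "measure_pmf.expectation (transcript v M H n) (AccH v M H n)
      = measure_pmf.expectation (pmf_of_set ?T) (\<lambda>rs. AccH v M H n (rs, H n rs))"
    unfolding transcript_def by simp
  also have "\<dots> = (\<Sum>rs\<in>?T. AccH v M H n (rs, H n rs)) / card ?T"
    by (rule integral_pmf_of_set) simp_all
  also have "\<dots> = avg (v n) (M n) (\<lambda>rs. AccH v M H n (rs, H n rs))"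
    by (simp add: avg_def card_tuples)
  also have "\<dots> = avg (v n) (M n) (\<lambda>rs. \<Sum>i<M n. log 2 (1 / hit (v n) (prefix_block (v n) (M n) (H n)) (take i rs)
        (prefix_block (v n) (M n) (H n) (take (Suc i) rs))))"
    by (rule avg_cong) (auto simp: AccH_def transcript_cond_prob[OF assms] prefix_block_take[OF assms] simp del: take_Suc)
  finally show ?thesis .
qed

subsection \<open>Generators whose blocks are longer than their running time\<close>

lemma encode_inject: "encode xs = encode ys \<Longrightarrow> xs = ys"
proof (induction xs arbitrary: ys)
  case Nil
  then show ?case by (cases ys) auto
next
  case (Cons x xs)
  show ?case
  proof (cases ys)
    case Nil
    with Cons.prems show ?thesis by simp
  next
    case ys: (Cons y ys')
    have "x = y"
      by (rule bits_append_eq[of x "Sep # encode xs" y "encode ys'"]) (use Cons.prems ys in simp_all)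
    then show ?thesis using Cons ys by simp
  qed
qed

text \<open>Fewer than \<open>v\<close> steps cannot get past \<open>1\<^sup>n\<close> and the first
  block, so exchanging the rest of the input leaves the output unchanged.\<close>

lemma first_block_determines_output:
  assumes run: "\<And>rs. rs \<in> tuples v (Suc m) \<Longrightarrow>
      \<exists>t s. exec c (input_store (replicate n True # rs)) t s \<and> t \<le> P \<and> s 1 = encode (h rs)"
    and "P < v" "rs \<in> tuples v (Suc m)" "rs' \<in> tuples v (Suc m)" "rs ! 0 = rs' ! 0"
  shows "h rs = h rs'"
proof -
  obtain x b b' where rs: "rs = x # b" "rs' = x # b'" and x: "length x = v"
  proof -
    obtain x b where x: "rs = x # b" "length x = v"
      using assms(3) unfolding tuples_Suc bitstrings_def by auto
    moreover obtain x' b' where "rs' = x' # b'"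
      using assms(4) unfolding tuples_Suc by auto
    moreover have "x' = x" using assms(5) calculation by simp
    ultimately show thesis using that by simp
  qed
  let ?u = "map Bit (replicate n True) @ Sep # map Bit x"
  let ?in = "\<lambda>rs. input_store (replicate n True # rs)"
  obtain t s where s: "exec c (?in rs) t s" "t \<le> P" "s 1 = encode (h rs)"
    using run assms(3) by blast
  obtain t' s' where s': "exec c (?in rs') t' s'" "s' 1 = encode (h rs')"
    using run assms(4) by blast
  have "?in rs 0 = ?u @ Sep # encode b"
    by (simp add: input_store_def rs)
  moreover have "t \<le> length ?u" using s(2) assms(2) x by simp
  ultimately obtain u' where "exec c ((?in rs)(0 := ?u @ Sep # encode b')) t (s(0 := u' @ Sep # encode b'))"
    using exec_input_prefix[OF s(1)] by blast
  moreover have "(?in rs)(0 := ?u @ Sep # encode b') = ?in rs'"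
    by (auto simp: input_store_def rs fun_eq_iff)
  ultimately have "exec c (?in rs') t (s(0 := u' @ Sep # encode b'))" by simp
  then have "s' = s(0 := u' @ Sep # encode b')"
    using exec_deterministic[OF s'(1)] by blast
  then have "encode (h rs) = encode (h rs')" using s(3) s'(2) by simp
  then show ?thesis by (rule encode_inject)
qed

text \<open>All blocks after the first have conditional probability 1 and contribute 0; the first
  one takes at most \<open>2 ^ l\<close> values.\<close>

lemma entropy_first_block:
  fixes h :: "bool list list \<Rightarrow> bool list list" and v m :: nat
  defines "Z \<equiv> prefix_block v (Suc m) h"
  assumes det: "\<And>rs rs'. rs \<in> tuples v (Suc m) \<Longrightarrow> rs' \<in> tuples v (Suc m) \<Longrightarrow> rs ! 0 = rs' ! 0 \<Longrightarrow> h rs = h rs'"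
    and range: "\<And>x. x \<in> bitstrings v \<Longrightarrow> Z [x] \<in> bitstrings l"
  shows "avg v (Suc m) (\<lambda>rs. \<Sum>i<Suc m. log 2 (1 / hit v Z (take i rs) (Z (take (Suc i) rs)))) \<le> l"
proof -
  have "hit v Z (take i rs) (Z (take (Suc i) rs)) = 1" if rs: "rs \<in> tuples v (Suc m)" and i: "0 < i" "i < Suc m" for rs i
  proof -
    have a: "take i rs \<in> tuples v i" using rs i by (intro tuples_take) auto
    have snoc: "take (Suc i) rs = take i rs @ [rs ! i]" "rs ! i \<in> bitstrings v"
      using rs i by (auto simp: tuples_def take_Suc_conv_app_nth dest: nth_mem)
    have len: "length (take i rs) = i" by (rule length_tuples[OF a])
    have ext: "(take i rs @ [x]) @ replicate (Suc m - Suc i) (replicate v False) \<in> tuples v (Suc m)"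
      if "x \<in> bitstrings v" for x
      by (rule tuples_extend[OF tuples_snoc[OF a that]]) (use i in simp)
    have "Z (take i rs @ [x]) = Z (take i rs @ [rs ! i])" if x: "x \<in> bitstrings v" for x
    proof -
      have "h ((take i rs @ [x]) @ replicate (Suc m - Suc i) (replicate v False))
          = h ((take i rs @ [rs ! i]) @ replicate (Suc m - Suc i) (replicate v False))"
        by (rule det[OF ext[OF x] ext[OF snoc(2)]]) (use i len in \<open>simp add: nth_append\<close>)
      moreover have "length (take i rs @ [x]) = Suc i" for x using len by (simp del: length_take)
      ultimately show ?thesis by (simp only: Z_def prefix_block_def diff_Suc_1)
    qed
    then have "{x \<in> bitstrings v. Z (take i rs @ [x]) = Z (take (Suc i) rs)} = bitstrings v"
      unfolding snoc(1) by blast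
    then show ?thesis by (simp add: hit_def)
  qed
  then have "(\<Sum>i<Suc m. log 2 (1 / hit v Z (take i rs) (Z (take (Suc i) rs)))) = log 2 (1 / hit v Z [] (Z ([] @ take (Suc 0) rs)))"
    if "rs \<in> tuples v (Suc m)" for rs
    using that unfolding sum.lessThan_Suc_shift by simp
  then have "avg v (Suc m) (\<lambda>rs. \<Sum>i<Suc m. log 2 (1 / hit v Z (take i rs) (Z (take (Suc i) rs))))
      = avg v (Suc m) (\<lambda>rs. log 2 (1 / hit v Z [] (Z ([] @ take (Suc 0) rs))))"
    by (rule avg_cong)
  also have "\<dots> = avg v (Suc 0) (\<lambda>r. log 2 (1 / hit v Z [] (Z ([] @ r))))"
    by (rule avg_take[where F = "\<lambda>r. log 2 (1 / hit v Z [] (Z ([] @ r)))"]) simp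
  also have "\<dots> \<le> log 2 (card ((\<lambda>x. Z ([] @ [x])) ` bitstrings v))"
    by (rule avg_log_inverse_hit)
  also have "\<dots> \<le> log 2 (2 ^ l)"
  proof -
    have "card ((\<lambda>x. Z ([] @ [x])) ` bitstrings v) \<le> card (bitstrings l)"
      using range by (intro card_mono) auto
    then have "real (card ((\<lambda>x. Z ([] @ [x])) ` bitstrings v)) \<le> real (2 ^ l)"
      by (subst of_nat_le_iff) simp
    then show ?thesis by (subst log_le_cancel_iff) (auto simp: card_gt_0_iff)
  qed
  finally show ?thesis by (simp add: log_nat_power)
qed

subsection \<open>Success probability\<close>

lemma concat_tuples_inject:
  assumes "a \<in> tuples v k" "b \<in> tuples v k" "concat a = concat b"
  shows "a = b"
  using assms
proof (induction k arbitrary: a b)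
  case (Suc k)
  obtain x a' where a: "a = x # a'" "length x = v" "a' \<in> tuples v k"
    using Suc.prems(1) unfolding tuples_Suc bitstrings_def by auto
  obtain y b' where b: "b = y # b'" "length y = v" "b' \<in> tuples v k"
    using Suc.prems(2) unfolding tuples_Suc bitstrings_def by auto
  have "x = y" "concat a' = concat b'" using Suc.prems(3) a b by simp_all
  then show ?case using Suc.IH[OF a(3) b(3)] a(1) b(1) by simp
qed simp

lemma length_concat_tuples: "rs \<in> tuples v k \<Longrightarrow> length (concat rs) = k * v"
  by (induction k arbitrary: rs) (auto simp: tuples_Suc bitstrings_def)

text \<open>Good coin strings are counted through an injection: the right guess \<open>g\<close>, a
  successful sequence of tries, and \<open>e\<close> arbitrary unread bits.\<close>

lemma card_coins:
  assumes "S \<subseteq> tuples v N" "length g + N * v + e = q"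
    and "\<And>rs r. rs \<in> S \<Longrightarrow> r \<in> bitstrings e \<Longrightarrow> good (g @ concat rs @ r)"
  shows "card S * 2 ^ e \<le> card {r \<in> bitstrings q. good r}"
proof -
  let ?f = "\<lambda>(rs, r). g @ concat rs @ r"
  have fin: "finite S" using assms(1) finite_subset finite_tuples by blast
  have "inj_on ?f (S \<times> bitstrings e)"
  proof (rule inj_onI)
    fix u u' assume u: "u \<in> S \<times> bitstrings e" "u' \<in> S \<times> bitstrings e" "?f u = ?f u'"
    obtain a r b r' where ab: "u = (a, r)" "u' = (b, r')" by (cases u, cases u')
    then have *: "a \<in> S" "b \<in> S" "g @ concat a @ r = g @ concat b @ r'" using u by auto
    then have "length (concat a) = length (concat b)" using assms(1) by (metis length_concat_tuples subsetD)
    with * have "concat a = concat b" "r = r'" by auto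
    with * assms(1) show "u = u'" unfolding ab using concat_tuples_inject by blast
  qed
  then have "card (?f ` (S \<times> bitstrings e)) = card S * 2 ^ e"
    by (simp add: card_image card_cartesian_product)
  moreover have "?f ` (S \<times> bitstrings e) \<subseteq> {r \<in> bitstrings q. good r}"
  proof clarify
    fix rs r assume "rs \<in> S" "r \<in> bitstrings e"
    with assms show "g @ concat rs @ r \<in> bitstrings q \<and> good (g @ concat rs @ r)"
      by (auto simp: bitstrings_def length_concat_tuples)
  qed
  then have "card (?f ` (S \<times> bitstrings e)) \<le> card {r \<in> bitstrings q. good r}"
    by (intro card_mono) auto
  ultimately show ?thesis by simp
qed

lemma inversion_prob_eq:
  assumes "\<And>x. x \<in> bitstrings n \<Longrightarrow> f x \<in> bitstrings n"
    and "\<And>y. y \<in> bitstrings n \<Longrightarrow> A n y = map_pmf (G y) (uniform q)"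
  shows "inversion_prob f A n =
    (\<Sum>x\<in>bitstrings n. card {r \<in> bitstrings q. G (f x) r \<in> bitstrings n \<and> f (G (f x) r) = f x} / 2 ^ q) / 2 ^ n"
proof -
  let ?U = "uniform n" and ?X = "{(y, x'). x' \<in> bitstrings n \<and> f x' = y}"
  have set_U: "set_pmf (uniform k) = bitstrings k" for k
    by (simp add: uniform_def)
  have prob: "measure_pmf.prob (map_pmf (\<lambda>r. (f x, G (f x) r)) (uniform q)) ?X
      = card {r \<in> bitstrings q. G (f x) r \<in> bitstrings n \<and> f (G (f x) r) = f x} / 2 ^ q" for x
    by (simp add: uniform_def measure_pmf_of_set vimage_def Int_def)
  have "inversion_prob f A n = measure_pmf.prob (bind_pmf ?U (\<lambda>x. map_pmf (\<lambda>r. (f x, G (f x) r)) (uniform q))) ?X"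
  proof -
    have "bind_pmf (map_pmf f ?U) (\<lambda>y. bind_pmf (A n y) (\<lambda>x'. return_pmf (y, x')))
        = bind_pmf ?U (\<lambda>x. map_pmf (\<lambda>r. (f x, G (f x) r)) (uniform q))"
      unfolding bind_map_pmf
      by (rule bind_pmf_cong[OF refl])
        (use assms in \<open>simp add: set_U map_pmf_def[symmetric] map_pmf_comp\<close>)
    then show ?thesis unfolding inversion_prob_def by simp
  qed
  also have "\<dots> = measure_pmf.expectation ?U (\<lambda>x. measure_pmf.prob (map_pmf (\<lambda>r. (f x, G (f x) r)) (uniform q)) ?X)"
    unfolding measure_pmf_bind
    by (subst measure_pmf.measure_bind[where N = "count_space UNIV"]) (auto simp: measure_subprob)
  also have "\<dots> = (\<Sum>x\<in>bitstrings n. measure_pmf.prob (map_pmf (\<lambda>r. (f x, G (f x) r)) (uniform q)) ?X) / card (bitstrings n)"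
    unfolding uniform_def by (rule integral_pmf_of_set) simp_all
  finally show ?thesis unfolding prob by simp
qed

lemma of_nat_poly_eval: "poly (map_poly real p) (real n) = real (poly p n)"
  by (induction p) (simp_all add: map_poly_pCons)

section \<open>The reduction\<close>

lemma Gf_preimage:
  assumes "\<And>x. x \<in> bitstrings n \<Longrightarrow> f x \<in> bitstrings n"
    and "x \<in> bitstrings n" "x' \<in> bitstrings n"
    and "\<And>i. i < num_pieces n \<Longrightarrow> Gf f n x' ! i = Gf f n x ! i"
  shows "f x' = f x"
  by (rule Gf_inj[of f x' n x]) (use assms in \<open>simp_all add: bitstrings_def\<close>)

lemma consistentD:
  assumes "consistent (\<lambda>n. n) M (Gf f) v H" "rs \<in> tuples (v n) (M n)"
  shows "H n rs \<in> Gf f n ` bitstrings n"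
  using assms unfolding consistent_def by (fastforce simp: uniform_def)

section \<open>The attack at a fixed security parameter\<close>

locale online_attack =
  fixes f :: "bool list \<Rightarrow> bool list" and v :: "nat \<Rightarrow> nat" and H and n :: nat
  assumes length_f: "x \<in> bitstrings n \<Longrightarrow> f x \<in> bitstrings n"
    and online: "online_generator v (\<lambda>n. num_pieces n + 1) H"
    and consistent: "consistent (\<lambda>n. n) (\<lambda>n. num_pieces n + 1) (Gf f) v H"
    and n: "2 \<le> n"
begin

abbreviation "m \<equiv> num_pieces n"
text \<open>On a complete tuple this is the candidate preimage; on a shorter prefix it is the piece
  produced most recently.\<close>

abbreviation "last_block \<equiv> prefix_block (v n) (Suc m) (H n)"

lemma H_Gf: "rs \<in> tuples (v n) (Suc m) \<Longrightarrow> H n rs \<in> Gf f n ` bitstrings n"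
  using consistentD[OF consistent, of rs n] by (simp flip: Suc_eq_plus1)

lemma last_block_take: "rs \<in> tuples (v n) (Suc m) \<Longrightarrow> i < Suc m \<Longrightarrow> last_block (take (Suc i) rs) = H n rs ! i"
  using prefix_block_take[OF online, of rs n i] by (simp flip: Suc_eq_plus1)

lemma last_block_eq: "rs \<in> tuples (v n) (Suc m) \<Longrightarrow> last_block rs = H n rs ! m"
  using last_block_take[of rs m] by (simp add: length_tuples)

lemma last_block_preimage:
  assumes "rs \<in> tuples (v n) (Suc m)"
  shows "last_block rs \<in> bitstrings n" "H n rs = Gf f n (last_block rs)"
  using H_Gf[OF assms] by (auto simp: last_block_eq[OF assms] Gf_last)

lemma length_Gf_block: "x \<in> bitstrings n \<Longrightarrow> i < m \<Longrightarrow> Gf f n x ! i \<in> bitstrings (block_length n)"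
  using length_f[of x] length_Gf_nth[of f x n i] by (simp add: bitstrings_def)

abbreviation "entropy \<equiv> measure_pmf.expectation (transcript v (\<lambda>n. num_pieces n + 1) H n) (AccH v (\<lambda>n. num_pieces n + 1) H n)"
abbreviation "success x \<equiv> climb_prob (v n) m last_block (\<lambda>i. Gf f n x ! i) (m * n\<^sup>2) []"

lemma entropy_eq:
  "entropy = avg (v n) (Suc m) (\<lambda>rs. \<Sum>i<Suc m. log 2 (1 / hit (v n) last_block (take i rs) (last_block (take (Suc i) rs))))"
  using expectation_AccH[OF online, of n] unfolding Suc_eq_plus1 .

lemma success_ge:
  assumes "n - c * log 2 n < entropy"
  shows "1 / (8 * real n ^ nat \<lceil>c\<rceil>) \<le> (\<Sum>x\<in>bitstrings n. success x) / 2 ^ n"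
proof -
  let ?S = "(\<Sum>x\<in>bitstrings n. success x) / 2 ^ n" and ?d = "nat \<lceil>c\<rceil>"
  have n2: "0 < n\<^sup>2" using n by simp
  have cons: "Gf f n (last_block rs) ! i = last_block (take (Suc i) rs)" if "rs \<in> tuples (v n) (Suc m)" "i < m" for rs i
    using last_block_preimage(2)[OF that(1)] last_block_take[OF that(1), of i] that(2) by simp
  note bound = log_climb_prob_ge[where Z = last_block and w = "\<lambda>x i. Gf f n x ! i" and l = "block_length n" and K = "n\<^sup>2",
      OF cons last_block_preimage(1) length_Gf_block n2]
  have S: "0 < ?S" by (rule bound(1))
  have le: "entropy - n - real m * 2 ^ block_length n / (n\<^sup>2 * ln 2) \<le> log 2 ?S"
    unfolding entropy_eq by (rule bound(2))
  \<comment> \<open>The choice \<open>K = n\<^sup>2\<close> matches the \<open>n\<close> pieces with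
    \<open>2 * n\<close> values each. As \<open>ln 2 \<ge> 2 / 3\<close>, the loss is at most 3
    bits, which is the 8 in the claim.\<close>
  have "real m * 2 ^ block_length n \<le> real n * (2 * n)"
    using num_pieces_le[of n] two_power_block_length_le[OF n] by (intro mult_mono) auto
  also have "\<dots> \<le> 3 * (n\<^sup>2 * ln 2)"
  proof -
    have "2 * real (n\<^sup>2) \<le> (3 * ln 2) * real (n\<^sup>2)"
      using ln2_ge_two_thirds by (intro mult_right_mono) auto
    then show ?thesis by (simp add: power2_eq_square algebra_simps)
  qed
  finally have "real m * 2 ^ block_length n / (n\<^sup>2 * ln 2) \<le> 3"
    using n2 by (subst pos_divide_le_eq) (simp_all only: mult_pos_pos ln_gt_zero of_nat_0_less_iff one_less_numeral_iff semiring_norm)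
  \<comment> \<open>Rounding \<open>c\<close> up makes the bound the reciprocal of a
    polynomial.\<close>
  moreover have "c * log 2 n \<le> ?d * log 2 n"
    using n by (intro mult_right_mono) (auto simp: real_nat_ceiling_ge)
  ultimately have "- (?d * log 2 n) - 3 \<le> log 2 ?S" using le assms by linarith
  moreover have "log 2 (1 / (8 * real n ^ ?d)) = - (?d * log 2 n) - 3"
  proof -
    have pos: "0 < real n ^ ?d" using n by simp
    then have "log 2 (1 / (8 * real n ^ ?d)) = log 2 1 - log 2 (8 * real n ^ ?d)"
      by (intro log_divide_pos) simp_all
    also have "log 2 (8 * real n ^ ?d) = log 2 8 + log 2 (real n ^ ?d)"
      using pos by (intro log_mult_pos) simp_all
    also have "log 2 (8::real) = 3"
      using log_pow_cancel[of 2 3] by simp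
    also have "log 2 (real n ^ ?d) = ?d * log 2 n"
      using n by (simp add: log_nat_power)
    finally show ?thesis by simp
  qed
  ultimately have "log 2 (1 / (8 * real n ^ ?d)) \<le> log 2 ?S" by simp
  then show ?thesis using S n by (subst (asm) log_le_cancel_iff) simp_all
qed

text \<open>By consistency even a tuple filled with zeros is answered by \<open>Gf f n x'\<close>,
  where \<open>x'\<close> is its last block. Comparing the output with \<open>f x\<close> thus
  compares two values of \<open>f\<close>, and a complete match makes \<open>x'\<close> a
  preimage.\<close>

lemma inverter_succeeds:
  assumes run: "\<And>rs. rs \<in> tuples (v n) (Suc m) \<Longrightarrow>
      \<exists>t h. exec c (input_store (replicate n True # rs)) t h \<and> t \<le> P \<and> h 1 = encode (H n rs)"
    and x: "x \<in> bitstrings n" and rs: "rs \<in> tuples (v n) N"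
    and climb: "length (climb m last_block (\<lambda>i. Gf f n x ! i) [] rs) = m"
    and W: "n + (m + 1) * (v n + 1) + P + 2 \<le> W"
  shows "\<exists>s x'. x' \<in> bitstrings n \<and> f x' = f x \<and>
    runs (inverter c) (input_store [replicate n True, f x, number_code (v n) @ number_code m @ concat rs @ cs])
      (100 * W\<^sup>2 + (N * (search_cost c * W + 1) + 1)) s \<and> s 1 = encode [x']"
proof -
  have test: "mismatches (concat (take (Suc i) (H n (a @ replicate (m - i) (replicate (v n) False))))) (f x) = 0
      \<longleftrightarrow> last_block a = Gf f n x ! i"
    if a: "a \<in> tuples (v n) (Suc i)" and i: "i < m" and prev: "\<forall>j<i. last_block (take (Suc j) a) = Gf f n x ! j" for a i
  proof -
    let ?full = "a @ replicate (m - i) (replicate (v n) False)"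
    have full: "?full \<in> tuples (v n) (Suc m)" using tuples_extend[OF a, of "Suc m"] i by simp
    have la: "length a = Suc i" using a by (rule length_tuples)
    have block: "last_block (take (Suc j) a) = Gf f n (last_block ?full) ! j" if "j \<le> i" for j
      using last_block_take[OF full, of j] last_block_preimage(2)[OF full] that i la by simp
    show ?thesis
      using mismatches_Gf[of f x n "last_block ?full" i] length_f x last_block_preimage[OF full] prev block block[of i] i la
      by (simp add: bitstrings_def)
  qed
  have lenH: "length (H n rs) = Suc m" if "rs \<in> tuples (v n) (Suc m)" for rs
    using last_block_preimage(2)[OF that] by (simp add: length_Gf)
  have y: "length (f x) = n" using length_f[OF x] by (simp add: bitstrings_def)
  have m: "0 < m" using num_pieces_pos[of n] n by simp
  have "\<exists>s a. a \<in> tuples (v n) m \<and> (\<forall>j<m. last_block (take (Suc j) a) = Gf f n x ! j) \<and>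
    runs (inverter c) (input_store [replicate n True, f x, number_code (v n) @ number_code m @ concat rs @ cs])
      (100 * W\<^sup>2 + (N * (search_cost c * W + 1) + 1)) s \<and> s 1 = encode [H n (a @ [replicate (v n) False]) ! m]"
    by (rule runs_inverter[where Z = last_block and w = "\<lambda>i. Gf f n x ! i", OF run lenH test y W m rs climb])
  then obtain s a where sa: "a \<in> tuples (v n) m" "\<forall>j<m. last_block (take (Suc j) a) = Gf f n x ! j"
    "runs (inverter c) (input_store [replicate n True, f x, number_code (v n) @ number_code m @ concat rs @ cs])
      (100 * W\<^sup>2 + (N * (search_cost c * W + 1) + 1)) s"
    "s 1 = encode [H n (a @ [replicate (v n) False]) ! m]"
    by (elim exE conjE)
  let ?full = "a @ [replicate (v n) False]"
  have full: "?full \<in> tuples (v n) (Suc m)"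
    by (rule tuples_snoc[OF sa(1)]) (simp add: bitstrings_def)
  have "f (last_block ?full) = f x"
  proof (rule Gf_preimage[OF length_f x last_block_preimage(1)[OF full]])
    fix i assume i: "i < m"
    have "last_block (take (Suc i) ?full) = Gf f n (last_block ?full) ! i"
      using last_block_take[OF full, of i] last_block_preimage(2)[OF full] i by simp
    then show "Gf f n (last_block ?full) ! i = Gf f n x ! i"
      using sa(2) i length_tuples[OF sa(1)] by simp
  qed
  then show ?thesis
    using sa(3,4) last_block_preimage(1)[OF full] last_block_eq[OF full] by auto
qed

end


section \<open>Asymptotics and polynomial bounds\<close>

lemma block_length_eventually:
  "\<forall>\<^sub>F n in sequentially. block_length n \<le> real n - c * log 2 n"
proof -
  have "\<forall>\<^sub>F n in sequentially. log 2 (real n) + 1 \<le> real n - c * log 2 (real n)"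
    by real_asymp
  with eventually_ge_at_top[of 2] show ?thesis
    by eventually_elim (use block_length_le in fastforce)
qed

lemma (in online_attack) entropy_le:
  assumes "\<And>rs. rs \<in> tuples (v n) (Suc m) \<Longrightarrow>
      \<exists>t h. exec c (input_store (replicate n True # rs)) t h \<and> t \<le> P \<and> h 1 = encode (H n rs)"
    and "P < v n"
  shows "entropy \<le> block_length n"
  unfolding entropy_eq
proof (rule entropy_first_block)
  show "H n rs = H n rs'" if "rs \<in> tuples (v n) (Suc m)" "rs' \<in> tuples (v n) (Suc m)" "rs ! 0 = rs' ! 0" for rs rs'
    by (rule first_block_determines_output[OF assms that])
  fix x assume "x \<in> bitstrings (v n)"
  then have "[x] \<in> tuples (v n) (Suc 0)" by (rule tuples_singleton)
  from tuples_extend[OF this, of "Suc m"]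
  have full: "[x] @ replicate m (replicate (v n) False) \<in> tuples (v n) (Suc m)" by simp
  have "0 < m" using num_pieces_pos[of n] n by simp
  moreover have "last_block [x] = H n ([x] @ replicate m (replicate (v n) False)) ! 0"
    using last_block_take[OF full, of 0] by simp
  ultimately show "last_block [x] \<in> bitstrings (block_length n)"
    using length_Gf_block[OF last_block_preimage(1)[OF full], of 0] last_block_preimage(2)[OF full] by simp
qed

text \<open>The bound \<open>W\<close> on sizes, with \<open>n\<close> in place of \<open>m\<close>
  and \<open>p\<close> in place of both \<open>v\<close> and the running time.\<close>

definition work_poly :: "nat poly \<Rightarrow> nat poly" where
  "work_poly p = [:0, 1:] + [:1, 1:] * (p + 1) + p + 2"

text \<open>The first three summands are the time of the inverter for at most \<open>n ^ 3\<close>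
  tries: \<open>totalize\<close> uses the input length as its clock, so the coins must be at least
  that many. The last two make room for the guesses and for the tries themselves.\<close>

definition coins_poly :: "nat \<Rightarrow> nat poly \<Rightarrow> nat poly" where
  "coins_poly k p = 100 * (work_poly p)\<^sup>2 + [:0, 1:] ^ 3 * (smult k (work_poly p) + 1) + 1
     + 2 * work_poly p + [:0, 1:] ^ 3 * work_poly p"

lemma poly_work_poly: "poly (work_poly p) n = n + (n + 1) * (poly p n + 1) + poly p n + 2"
  by (simp add: work_poly_def algebra_simps)

lemma poly_coins_poly:
  "poly (coins_poly k p) n = 100 * (poly (work_poly p) n)\<^sup>2 + n ^ 3 * (k * poly (work_poly p) n + 1) + 1
     + 2 * poly (work_poly p) n + n ^ 3 * poly (work_poly p) n"
  by (simp add: coins_poly_def)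

lemma length_number_code: "length (number_code x) \<le> 2 * x + 1"
  using length_digit_code_le[of x] by (simp add: number_code_def)

text \<open>512 is 8 times 64: the first factor comes from \<open>success_ge\<close>, the second
  from the factors 8 of the two number codes.\<close>

definition loss_poly :: "nat poly \<Rightarrow> nat \<Rightarrow> real poly" where
  "loss_poly p d = [:512:] * (map_poly real p + 1)\<^sup>2 * [:1, 1:]\<^sup>2 * [:0, 1:] ^ d"

lemma poly_loss_poly: "poly (loss_poly p d) (real n) = 512 * (real (poly p n) + 1)\<^sup>2 * (real n + 1)\<^sup>2 * real n ^ d"
  by (simp add: loss_poly_def of_nat_poly_eval add.commute)

lemma ppt_inverter:
  assumes "\<And>ws. \<exists>s. runs c (input_store ws) (C * (length (encode ws) + 1)) s \<and> s 1 = encode [g ws]"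
  shows "ppt (\<lambda>n y. map_pmf (\<lambda>r. g [replicate n True, y, r]) (uniform (poly q n)))"
proof -
  let ?R = "[:C:] * (q + [:4, 2:])"
  have "poly_time (\<lambda>n. {[y, r] | y r. y \<in> bitstrings n \<and> r \<in> bitstrings (poly q n)})
     (\<lambda>n ws. [g (replicate n True # ws)])"
    unfolding poly_time_def
  proof (rule exI[of _ c], rule exI[of _ ?R], intro allI ballI)
    fix n ws assume "ws \<in> {[y, r] | y r. y \<in> bitstrings n \<and> r \<in> bitstrings (poly q n)}"
    then have "length (encode (replicate n True # ws)) + 1 = poly q n + 2 * n + 4"
      by (auto simp: bitstrings_def)
    then have time: "C * (length (encode (replicate n True # ws)) + 1) = poly ?R n"
      by (simp add: algebra_simps)
    show "\<exists>t s. exec c (input_store (replicate n True # ws)) t s \<and> t \<le> poly ?R n \<and>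
        s 1 = encode [g (replicate n True # ws)]"
      using assms[of "replicate n True # ws"] unfolding time runs_def by blast
  qed
  then show ?thesis unfolding ppt_def
    by (intro exI[of _ q] exI[of _ "\<lambda>n ws. g (replicate n True # ws)"]) simp
qed

text \<open>Only coins that begin with the correct guess are counted. They form a fraction of at
  least \<open>1 / B\<close>, and on them the program carries out the search faithfully.\<close>

lemma (in online_attack) inversion_prob_ge:
  fixes p :: "nat poly" and c :: program
  defines "q \<equiv> poly (coins_poly (search_cost c) p) n"
  assumes run: "\<And>rs. rs \<in> tuples (v n) (Suc m) \<Longrightarrow>
      \<exists>t h. exec c (input_store (replicate n True # rs)) t h \<and> t \<le> poly p n \<and> h 1 = encode (H n rs)"
    and v: "v n \<le> poly p n"
    and g: "\<And>ws t s x. exec (inverter c) (input_store ws) t s \<Longrightarrow> t \<le> length (encode ws) \<Longrightarrow> s 1 = encode [x] \<Longrightarrow> g ws = x"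
    and A: "A = (\<lambda>n y. map_pmf (\<lambda>r. g [replicate n True, y, r]) (uniform (poly (coins_poly (search_cost c) p) n)))"
    and entropy: "n - C * log 2 n < entropy"
  shows "1 / poly (loss_poly p (nat \<lceil>C\<rceil>)) n \<le> inversion_prob f A n"
proof -
  define W where "W = poly (work_poly p) n"
  define N where "N = m * n\<^sup>2"
  define code where "code = number_code (v n) @ number_code m"
  define B where "B = 64 * (real (poly p n) + 1)\<^sup>2 * (real n + 1)\<^sup>2"
  have B: "0 < B" by (simp add: B_def)
  have m_le: "m \<le> n" by (rule num_pieces_le)
  have q: "q = 100 * W\<^sup>2 + n ^ 3 * (search_cost c * W + 1) + 1 + 2 * W + n ^ 3 * W"
    unfolding q_def poly_coins_poly W_def ..
  have "(m + 1) * (v n + 1) \<le> (n + 1) * (poly p n + 1)"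
    using m_le v by (intro mult_le_mono) auto
  then have W: "n + (m + 1) * (v n + 1) + poly p n + 2 \<le> W"
    unfolding W_def poly_work_poly by linarith
  have "N \<le> n * n\<^sup>2" unfolding N_def using m_le by (rule mult_le_mono1)
  then have N: "N \<le> n ^ 3" by (simp add: power2_eq_square power3_eq_cube)
  have "v n + m + 1 \<le> (m + 1) * (v n + 1)" unfolding add_mult_distrib add_mult_distrib2 by simp
  then have vm: "v n + m + 1 \<le> W" "v n \<le> W" using W by linarith+
  have "length code \<le> 2 * W"
    using length_number_code[of "v n"] length_number_code[of m] vm unfolding code_def length_append by linarith
  moreover have "N * v n \<le> n ^ 3 * W" using N vm(2) by (rule mult_le_mono)
  ultimately have "length code + N * v n \<le> q" unfolding q by linarith
  then obtain e where e: "length code + N * v n + e = q" using le_Suc_ex by metis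
  have time: "100 * W\<^sup>2 + (N * (search_cost c * W + 1) + 1) \<le> q"
    using mult_le_mono1[OF N, of "search_cost c * W + 1"] unfolding q by linarith
  have "(2::nat) ^ length code \<le> (8 * (v n + 1)\<^sup>2) * (8 * (m + 1)\<^sup>2)"
    unfolding code_def length_append power_add by (intro mult_le_mono two_power_length_number_code)
  also have "\<dots> \<le> (8 * (poly p n + 1)\<^sup>2) * (8 * (n + 1)\<^sup>2)"
    using v m_le by (intro mult_le_mono power_mono) auto
  finally have "real (2 ^ length code) \<le> real ((8 * (poly p n + 1)\<^sup>2) * (8 * (n + 1)\<^sup>2))"
    by (subst of_nat_le_iff)
  then have code: "2 ^ length code \<le> B" by (simp add: B_def add.commute)
  let ?good = "\<lambda>x r. g [replicate n True, f x, r] \<in> bitstrings n \<and> f (g [replicate n True, f x, r]) = f x"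
  have good: "success x / B \<le> card {r \<in> bitstrings q. ?good x r} / 2 ^ q" if x: "x \<in> bitstrings n" for x
  proof -
    define S where "S = {rs \<in> tuples (v n) N. length (climb m last_block (\<lambda>i. Gf f n x ! i) [] rs) = m}"
    have "card S * 2 ^ e \<le> card {r \<in> bitstrings q. ?good x r}"
    proof (rule card_coins[of S "v n" N code e q])
      fix rs r assume rs: "rs \<in> S" "r \<in> bitstrings e"
      let ?in = "[replicate n True, f x, code @ concat rs @ r]"
      obtain s x' where s: "x' \<in> bitstrings n" "f x' = f x"
        "runs (inverter c) (input_store ?in) (100 * W\<^sup>2 + (N * (search_cost c * W + 1) + 1)) s" "s 1 = encode [x']"
        using inverter_succeeds[OF run x, of rs N W r] rs(1) W unfolding S_def code_def by auto
      have "length (code @ concat rs @ r) = q"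
        using e rs length_concat_tuples[of rs "v n" N] by (simp add: S_def bitstrings_def)
      \<comment> \<open>The coins alone make the clock long enough, so \<open>g\<close> returns the
        answer of the unclocked inverter.\<close>
      then have "q \<le> length (encode ?in)" by simp
      then have "g ?in = x'" using s(3,4) time g unfolding runs_def by (meson order_trans)
      then show "?good x (code @ concat rs @ r)" using s by simp
    qed (use e in \<open>auto simp: S_def\<close>)
    then have "real (card S * 2 ^ e) \<le> card {r \<in> bitstrings q. ?good x r}"
      by (subst of_nat_le_iff)
    then have le: "real (card S) * 2 ^ e \<le> card {r \<in> bitstrings q. ?good x r}"
      by simp
    have "success x = card S / 2 ^ (v n * N)"
    proof -
      have "(\<Sum>rs\<in>tuples (v n) N. of_bool (length (climb m last_block (\<lambda>i. Gf f n x ! i) [] rs) = m)) = real (card S)"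
        by (subst sum_of_bool_eq) (auto simp: S_def intro!: arg_cong[where f = card])
      then show ?thesis unfolding climb_prob_def avg_def N_def[symmetric] by simp
    qed
    \<comment> \<open>Code, tries and unread bits make up all \<open>q\<close> coins.\<close>
    then have "success x / 2 ^ length code = (card S * 2 ^ e) / 2 ^ q"
      unfolding e[symmetric] by (simp add: power_add mult.commute)
    also have "\<dots> \<le> card {r \<in> bitstrings q. ?good x r} / 2 ^ q"
      using le by (intro divide_right_mono) auto
    finally have "success x / 2 ^ length code \<le> card {r \<in> bitstrings q. ?good x r} / 2 ^ q" .
    moreover have "success x / B \<le> success x / 2 ^ length code"
      using code by (intro divide_left_mono climb_prob_nonneg) (auto intro: mult_pos_pos B)
    ultimately show ?thesis by linarith
  qed
  have "1 / poly (loss_poly p (nat \<lceil>C\<rceil>)) n = 1 / (8 * real n ^ nat \<lceil>C\<rceil>) / B"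
    unfolding poly_loss_poly B_def by (simp add: mult_ac)
  also have "\<dots> \<le> (\<Sum>x\<in>bitstrings n. success x) / 2 ^ n / B"
    using success_ge[OF entropy] B by (intro divide_right_mono) auto
  also have "\<dots> = (\<Sum>x\<in>bitstrings n. success x / B) / 2 ^ n"
    by (simp add: sum_divide_distrib[symmetric])
  also have "\<dots> \<le> (\<Sum>x\<in>bitstrings n. card {r \<in> bitstrings q. ?good x r} / 2 ^ q) / 2 ^ n"
    using good by (intro divide_right_mono sum_mono) auto
  also have "\<dots> = inversion_prob f A n"
    by (rule inversion_prob_eq[symmetric, of n f A "\<lambda>y r. g [replicate n True, y, r]" q])
      (simp_all add: length_f A q_def)
  finally show ?thesis .
qed

theorem theorem4p2:
  fixes f :: "bool list \<Rightarrow> bool list" and c :: real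
  assumes "one_way f"
    and "c > 0"
  shows "accessible_entropy_at_most (\<lambda>n. n) (\<lambda>n. num_pieces n + 1) (Gf f)
           (\<lambda>n. real n - c * log 2 (real n))"
  unfolding accessible_entropy_at_most_def
proof (intro allI impI, elim conjE)
  fix v H
  let ?M = "\<lambda>n. num_pieces n + 1"
  let ?E = "\<lambda>n. measure_pmf.expectation (transcript v ?M H n) (AccH v ?M H n)"
  assume H: "online_generator v ?M H" "consistent (\<lambda>n. n) ?M (Gf f) v H"
    and "poly_time (\<lambda>n. tuples (v n) (?M n)) H"
  then obtain prog p where run: "\<And>n rs. rs \<in> tuples (v n) (?M n) \<Longrightarrow>
      \<exists>t s. exec prog (input_store (replicate n True # rs)) t s \<and> t \<le> poly p n \<and> s 1 = encode (H n rs)"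
    unfolding poly_time_def by blast
  obtain C :: nat and g where
    total: "\<And>ws. \<exists>s. runs (totalize (inverter prog)) (input_store ws) (C * (length (encode ws) + 1)) s \<and> s 1 = encode [g ws]"
    and g: "\<And>ws t s x. exec (inverter prog) (input_store ws) t s \<Longrightarrow> t \<le> length (encode ws) \<Longrightarrow> s 1 = encode [x] \<Longrightarrow> g ws = x"
    using totalize[of "inverter prog"] by blast
  define A where "A = (\<lambda>n y. map_pmf (\<lambda>r. g [replicate n True, y, r]) (uniform (poly (coins_poly (search_cost prog) p) n)))"
  have "ppt A" unfolding A_def by (rule ppt_inverter[OF total])
  then have "negligible (inversion_prob f A)" using assms(1) by (simp add: one_way_def)
  moreover have "\<forall>n>0. 0 < poly (loss_poly p (nat \<lceil>c\<rceil>)) (real n)"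
    by (simp add: poly_loss_poly add_nonneg_pos)
  ultimately have small: "\<forall>\<^sub>F n in sequentially. inversion_prob f A n < 1 / poly (loss_poly p (nat \<lceil>c\<rceil>)) n"
    by (simp add: negligible_def)
  show "\<forall>\<^sub>F n in sequentially. ?E n \<le> real n - c * log 2 (real n)"
    using small block_length_eventually[of c] eventually_ge_at_top[of 2]
  proof eventually_elim
    case (elim n)
    interpret online_attack f v H n
      using assms(1) H elim(3) by unfold_locales (auto simp: one_way_def)
    have run': "\<exists>t s. exec prog (input_store (replicate n True # rs)) t s \<and> t \<le> poly p n \<and> s 1 = encode (H n rs)"
      if "rs \<in> tuples (v n) (Suc (num_pieces n))" for rs
      using run[of rs n] that by (simp flip: Suc_eq_plus1)
    show ?case
    proof (rule ccontr)
      assume "\<not> ?E n \<le> real n - c * log 2 (real n)"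
      then have E: "real n - c * log 2 (real n) < ?E n" by simp
      \<comment> \<open>Otherwise only the first input block could be read and the entropy would be
        at most \<open>block_length n\<close>, which is below the assumed value for large
        \<open>n\<close>.\<close>
      have "v n \<le> poly p n"
        using entropy_le[OF run'] E elim(2) by (meson not_le order.strict_trans2 order.asym)
      from inversion_prob_ge[OF run' this g A_def E] elim(1) show False by simp
    qed
  qed
qed

end
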